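(* Let $\varphi \in L^\infty$. Then $T_\varphi \in \mathcal{AM}(H^2)$ if and only if there exists $\alpha \in \sigma_{ess}(|T_\varphi|)$ such that $|\varphi| = \alpha$ $\mu$-almost everywhere, and $\varphi \in H^\infty + C(\mathbb{T})$.
   Context: Let $\mathbb{T}$ be the unit circle in $\mathbb{C}$ with normalized Lebesgue measure $\mu$. $L^2$ is the Hilbert space of complex-valued square integrable functions on $\mathbb{T}$ with respect to $\mu$, and $L^\infty$ is the Banach space of complex-valued essentially bounded $\mu$-measurable functions on $\mathbb{T}$. $H^2$ is the closed subspace of $L^2$ of all functions whose negative Fourier coefficients vanish, and $P$ is the orthogonal projection of $L^2$ onto $H^2$. $H^\infty = H^2 \cap L^\infty$, $C(\mathbb{T})$ is the set of complex-valued continuous functions on $\mathbb{T}$, and $H^\infty + C(\mathbb{T}) = \{f+g : f \in H^\infty, g \in C(\mathbb{T})\} \subset L^\infty$. For $\varphi \in L^\infty$ the Toeplitz operator $T_\varphi : H^2 \to H^2$ is $T_\varphi f = P(\varphi f)$, where $(\varphi f)(z) = \varphi(z) f(z)$. $|T_\varphi| = (T_\varphi^* T_\varphi)^{1/2}$, and $\sigma_{ess}$ denotes the essential spectrum. For a bounded linear operator $T : H_1 \to H_2$ between Hilbert spaces with $H_1 \neq \{0\}$, let $m(T) = \inf\{\|Tx\| : x \in H_1, \|x\| = 1\}$. $T$ is minimum attaining if there is a unit vector $x \in H_1$ with $\|Tx\| = m(T)$. It is absolutely minimum attaining (an $\mathcal{AM}$-operator) if for every nonzero closed subspace $M$ of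 $H_1$ the restriction $T|_M : M \to H_2$ is minimum attaining. $\mathcal{AM}(H^2)$ denotes the set of all $\mathcal{AM}$-operators from $H^2$ to $H^2$. *)

theory Defs
  imports "HOL-Probability.Probability"
begin

section \<open>Complex inner product spaces and Hilbert spaces\<close>

text \<open>The inner product is linear in its first argument. The real Hilbert space structure
  (norm, topology) is that of the real part of \<open>cinner\<close>.\<close>

class complex_inner = real_inner +
  fixes scaleC :: "complex \<Rightarrow> 'a \<Rightarrow> 'a" (infixr \<open>*\<^sub>C\<close> 75)
    and cinner :: "'a \<Rightarrow> 'a \<Rightarrow> complex"
  assumes scaleC_add_right: "a *\<^sub>C (x + y) = a *\<^sub>C x + a *\<^sub>C y"
    and scaleC_add_left: "(a + b) *\<^sub>C x = a *\<^sub>C x + b *\<^sub>C x"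
    and scaleC_scaleC: "a *\<^sub>C (b *\<^sub>C x) = (a * b) *\<^sub>C x"
    and scaleR_scaleC: "r *\<^sub>R x = of_real r *\<^sub>C x"
    and cinner_commute: "cinner x y = cnj (cinner y x)"
    and cinner_add_left: "cinner (x + y) z = cinner x z + cinner y z"
    and cinner_scaleC_left: "cinner (a *\<^sub>C x) y = a * cinner x y"
    and inner_eq_Re_cinner: "inner x y = Re (cinner x y)"

class chilbert_space = complex_inner + complete_space

global_interpretation complex_vector:
  vector_space "scaleC :: complex \<Rightarrow> 'a \<Rightarrow> 'a::complex_inner"
proof
  show "1 *\<^sub>C x = x" for x :: 'a
    using scaleR_scaleC [of 1 x] by simp
qed (rule scaleC_add_right scaleC_add_left scaleC_scaleC)+


section \<open>Operators\<close>

definition bounded_clinear :: "('a::complex_inner \<Rightarrow> 'b::complex_inner) \<Rightarrow> bool" where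
  "bounded_clinear T \<longleftrightarrow> bounded_linear T \<and> Vector_Spaces.linear scaleC scaleC T"

text \<open>The next two definitions concern the restriction of \<open>T\<close> to a subspace \<open>M\<close>.\<close>

definition min_modulus :: "'a::complex_inner set \<Rightarrow> ('a \<Rightarrow> 'b::complex_inner) \<Rightarrow> real" where
  "min_modulus M T = (INF x\<in>{x\<in>M. norm x = 1}. norm (T x))"

definition minimum_attaining :: "'a::complex_inner set \<Rightarrow> ('a \<Rightarrow> 'b::complex_inner) \<Rightarrow> bool" where
  "minimum_attaining M T \<longleftrightarrow> (\<exists>x\<in>M. norm x = 1 \<and> norm (T x) = min_modulus M T)"

definition AM_operators :: "('a::chilbert_space \<Rightarrow> 'b::chilbert_space) set" where
  "AM_operators = {T. bounded_clinear T \<and>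
     (\<forall>M. complex_vector.subspace M \<and> closed M \<and> M \<noteq> {0} \<longrightarrow> minimum_attaining M T)}"

definition cadjoint :: "('a::chilbert_space \<Rightarrow> 'b::chilbert_space) \<Rightarrow> 'b \<Rightarrow> 'a" where
  "cadjoint T = (THE S. \<forall>x y. cinner (T x) y = cinner x (S y))"

definition positive_operator :: "('a::chilbert_space \<Rightarrow> 'a) \<Rightarrow> bool" where
  "positive_operator S \<longleftrightarrow> bounded_clinear S \<and> (\<forall>x. cinner (S x) x \<in> \<real>\<^sub>\<ge>\<^sub>0)"

definition sqrt_operator :: "('a::chilbert_space \<Rightarrow> 'a) \<Rightarrow> 'a \<Rightarrow> 'a" where
  "sqrt_operator A = (THE S. positive_operator S \<and> S \<circ> S = A)"

definition abs_operator :: "('a::chilbert_space \<Rightarrow> 'b::chilbert_space) \<Rightarrow> 'a \<Rightarrow> 'a" where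
  "abs_operator T = sqrt_operator (cadjoint T \<circ> T)"

definition fredholm :: "('a::chilbert_space \<Rightarrow> 'b::chilbert_space) \<Rightarrow> bool" where
  "fredholm T \<longleftrightarrow> bounded_clinear T \<and> closed (range T) \<and>
     (\<exists>B. finite B \<and> {x. T x = 0} \<subseteq> complex_vector.span B) \<and>
     (\<exists>B. finite B \<and> complex_vector.span (range T \<union> B) = UNIV)"

definition essential_spectrum :: "('a::chilbert_space \<Rightarrow> 'a) \<Rightarrow> complex set" where
  "essential_spectrum T = {c. \<not> fredholm (\<lambda>x. T x - c *\<^sub>C x)}"

definition orthogonal_projection :: "'a::chilbert_space set \<Rightarrow> 'a \<Rightarrow> 'a" where
  "orthogonal_projection M x = (THE y. y \<in> M \<and> (\<forall>z\<in>M. cinner (x - y) z = 0))"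


section \<open>The Hilbert space \<open>L\<^sup>2\<close> of the circle\<close>

text \<open>Normalized Lebesgue measure; the completion makes the measurable sets the Lebesgue
  measurable subsets of the circle.\<close>

definition circle :: "complex measure" where
  "circle = completion (distr (uniform_measure lborel {0..2 * pi})
                              (restrict_space borel (sphere 0 1)) cis)"

lemma prob_space_circle: "prob_space circle"
proof -
  have "cis \<in> borel_measurable borel"
    by (intro borel_measurable_continuous_onI continuous_intros)
  then have "cis \<in> uniform_measure lborel {0..2 * pi} \<rightarrow>\<^sub>M restrict_space borel (sphere 0 1)"
    by (intro measurable_restrict_space2) auto
  moreover have "prob_space (uniform_measure lborel {0..2 * pi})"
    by (rule prob_space_uniform_measure) auto
  ultimately have "prob_space (distr (uniform_measure lborel {0..2 * pi})
                              (restrict_space borel (sphere 0 1)) cis)"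
    by (rule prob_space.prob_space_distr[rotated])
  moreover have "prob_space (completion M)" if "prob_space M" for M :: "complex measure"
    using that by (intro prob_spaceI) (simp add: prob_space.emeasure_space_1)
  ultimately show ?thesis
    unfolding circle_def by blast
qed

definition square_integrable :: "(complex \<Rightarrow> complex) set" where
  "square_integrable =
     {f \<in> borel_measurable circle. integrable circle (\<lambda>z. (cmod (f z))\<^sup>2)}"

lemma square_integrable_measurable: "f \<in> square_integrable \<Longrightarrow> f \<in> borel_measurable circle"
  by (simp add: square_integrable_def)

lemma square_integrable_zero: "(\<lambda>z. 0) \<in> square_integrable"
  by (simp add: square_integrable_def)

lemma square_integrable_scale:
  "f \<in> square_integrable \<Longrightarrow> (\<lambda>z. c * f z) \<in> square_integrable"
  by (auto simp: square_integrable_def norm_mult power_mult_distrib)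

lemma cmod_add_square_le: "(cmod (a + b))\<^sup>2 \<le> 2 * (cmod a)\<^sup>2 + 2 * (cmod b)\<^sup>2"
proof -
  have "(cmod (a + b))\<^sup>2 \<le> (cmod a + cmod b)\<^sup>2"
    by (intro power_mono norm_triangle_ineq) auto
  also have "\<dots> \<le> 2 * (cmod a)\<^sup>2 + 2 * (cmod b)\<^sup>2"
    using sum_squares_bound[of "cmod a" "cmod b"] by (simp add: power2_sum)
  finally show ?thesis .
qed

lemma square_integrable_add:
  assumes "f \<in> square_integrable" "g \<in> square_integrable"
  shows "(\<lambda>z. f z + g z) \<in> square_integrable"
proof -
  have [measurable]: "f \<in> borel_measurable circle" "g \<in> borel_measurable circle"
    using assms by (auto simp: square_integrable_def)
  have "integrable circle (\<lambda>z. 2 * (cmod (f z))\<^sup>2 + 2 * (cmod (g z))\<^sup>2)"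
    using assms by (auto simp: square_integrable_def)
  then have "integrable circle (\<lambda>z. (cmod (f z + g z))\<^sup>2)"
    by (rule Bochner_Integration.integrable_bound) (auto intro!: cmod_add_square_le)
  then show ?thesis by (simp add: square_integrable_def)
qed

lemma square_integrable_prod:
  assumes "f \<in> square_integrable" "g \<in> square_integrable"
  shows "integrable circle (\<lambda>z. f z * cnj (g z))"
proof -
  have [measurable]: "f \<in> borel_measurable circle" "g \<in> borel_measurable circle"
    using assms by (auto simp: square_integrable_def)
  have [measurable]: "(\<lambda>z. cnj (g z)) \<in> borel_measurable circle"
    by (rule borel_measurable_continuous_on[OF continuous_on_cnj[OF continuous_on_id]]) simp
  have "integrable circle (\<lambda>z. (cmod (f z))\<^sup>2 + (cmod (g z))\<^sup>2)"
    using assms by (auto simp: square_integrable_def)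
  moreover have "cmod (a * cnj b) \<le> (cmod a)\<^sup>2 + (cmod b)\<^sup>2" for a b
    using sum_squares_bound[of "cmod a" "cmod b"] mult_nonneg_nonneg[OF norm_ge_zero[of a] norm_ge_zero[of b]]
    unfolding norm_mult complex_mod_cnj by linarith
  ultimately show ?thesis
    by (elim Bochner_Integration.integrable_bound) auto
qed

quotient_type L2 = "complex \<Rightarrow> complex" / partial:
  "\<lambda>f g. f \<in> square_integrable \<and> g \<in> square_integrable \<and> (AE z in circle. f z = g z)"
  by (rule part_equivpI) (auto intro!: exI[of _ "\<lambda>z. 0"] square_integrable_zero sympI transpI)

instantiation L2 :: complex_inner
begin

lift_definition zero_L2 :: L2 is "\<lambda>z. 0"
  by (simp add: square_integrable_zero)

lift_definition plus_L2 :: "L2 \<Rightarrow> L2 \<Rightarrow> L2" is "\<lambda>f g z. f z + g z"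
  by (auto intro: square_integrable_add)

lift_definition scaleC_L2 :: "complex \<Rightarrow> L2 \<Rightarrow> L2" is "\<lambda>c f z. c * f z"
  by (auto intro: square_integrable_scale)

lift_definition cinner_L2 :: "L2 \<Rightarrow> L2 \<Rightarrow> complex" is
  "\<lambda>f g. \<integral>z. f z * cnj (g z) \<partial>circle"
  apply (rule integral_cong_AE)
  apply (auto intro!: borel_measurable_integrable square_integrable_prod)
  done

definition "scaleR_L2 r (x :: L2) = complex_of_real r *\<^sub>C x"
definition "uminus_L2 (x :: L2) = (- 1) *\<^sub>C x"
definition "minus_L2 (x :: L2) y = x + (- 1) *\<^sub>C y"
definition "inner_L2 (x :: L2) y = Re (cinner x y)"
definition "norm_L2 (x :: L2) = sqrt (inner x x)"
definition "dist_L2 (x :: L2) y = norm (x - y)"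
definition "sgn_L2 (x :: L2) = complex_of_real (inverse (norm x)) *\<^sub>C x"
definition "uniformity_L2 = (INF e\<in>{0<..}. principal {(x :: L2, y). dist x y < e})"
definition "open_L2 (U :: L2 set) =
  (\<forall>x\<in>U. eventually (\<lambda>(x', y). x' = x \<longrightarrow> y \<in> U) uniformity)"

instance
proof
  fix x y z :: L2 and a b :: complex and r s :: real
  show add_assoc: "x + y + z = x + (y + z)"
    by transfer (simp add: square_integrable_add add.assoc)
  show add_comm: "x + y = y + x"
    by transfer (simp add: square_integrable_add add.commute)
  show "0 + x = x"
    by transfer auto
  show "- x + x = 0" unfolding uminus_L2_def
    by transfer (simp add: square_integrable_add square_integrable_scale[where c="-1", simplified]
                           square_integrable_zero)
  show "x - y = x + - y"
    by (simp add: minus_L2_def uminus_L2_def)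
  show cadd_right: "a *\<^sub>C (x + y) = a *\<^sub>C x + a *\<^sub>C y" for a :: complex and x y :: L2
    by transfer (simp add: square_integrable_add square_integrable_scale ring_distribs)
  show cadd_left: "(a + b) *\<^sub>C x = a *\<^sub>C x + b *\<^sub>C x" for a b :: complex and x :: L2
    by transfer (simp add: square_integrable_add square_integrable_scale ring_distribs)
  show cscale: "a *\<^sub>C b *\<^sub>C x = (a * b) *\<^sub>C x" for a b :: complex and x :: L2
    by transfer (simp add: square_integrable_scale mult.assoc)
  show "r *\<^sub>R x = complex_of_real r *\<^sub>C x"
    by (simp add: scaleR_L2_def)
  show "r *\<^sub>R (x + y) = r *\<^sub>R x + r *\<^sub>R y" "(r + s) *\<^sub>R x = r *\<^sub>R x + s *\<^sub>R x"
       "r *\<^sub>R s *\<^sub>R x = (r * s) *\<^sub>R x"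
    by (simp_all add: scaleR_L2_def cadd_right cadd_left cscale)
  show "1 *\<^sub>R x = x"
    unfolding scaleR_L2_def by transfer auto
  show comm: "cinner x y = cnj (cinner y x)" for x y :: L2
    by transfer (simp add: mult.commute flip: Bochner_Integration.integral_cnj)
  show add: "cinner (x + y) z = cinner x z + cinner y z" for x y z :: L2
    by transfer (simp add: ring_distribs Bochner_Integration.integral_add square_integrable_prod)
  show scale: "cinner (a *\<^sub>C x) y = a * cinner x y" for a :: complex and x y :: L2
    by transfer (simp add: mult.assoc)
  show inner: "inner x y = Re (cinner x y)" for x y :: L2
    by (simp add: inner_L2_def)
  show "inner x y = inner y x"
    unfolding inner by (subst comm) simp
  show "inner (x + y) z = inner x z + inner y z" "inner (r *\<^sub>R x) y = r * inner x y"
    by (simp_all add: inner add scale scaleR_L2_def)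
  have self: "cinner x x = complex_of_real (\<integral>z. (cmod (rep_L2 x z))\<^sup>2 \<partial>circle)"
    unfolding cinner_L2.rep_eq complex_norm_square[symmetric] by (rule integral_complex_of_real)
  show "0 \<le> inner x x"
    by (simp add: inner self)
  show "inner x x = 0 \<longleftrightarrow> x = 0"
    unfolding inner
  proof transfer
    fix f :: "complex \<Rightarrow> complex"
    assume "f \<in> square_integrable \<and> f \<in> square_integrable \<and> (AE z in circle. f z = f z)"
    then have f: "f \<in> square_integrable" by simp
    then have int: "integrable circle (\<lambda>z. (cmod (f z))\<^sup>2)"
      by (simp add: square_integrable_def)
    have "Re (\<integral>z. f z * cnj (f z) \<partial>circle) = (\<integral>z. (cmod (f z))\<^sup>2 \<partial>circle)"
      unfolding complex_norm_square[symmetric] integral_complex_of_real by simp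
    also have "\<dots> = 0 \<longleftrightarrow> (AE z in circle. f z = 0)"
      by (subst integral_nonneg_eq_0_iff_AE[OF int]) auto
    finally show "Re (\<integral>z. f z * cnj (f z) \<partial>circle) = 0 \<longleftrightarrow>
       f \<in> square_integrable \<and> (\<lambda>z. 0) \<in> square_integrable \<and> (AE z in circle. f z = 0)"
      using f square_integrable_zero by simp
  qed
  show "norm x = sqrt (inner x x)" by (rule norm_L2_def)
  show "dist x y = norm (x - y)" by (rule dist_L2_def)
  show "sgn x = inverse (norm x) *\<^sub>R x" by (simp add: sgn_L2_def scaleR_L2_def)
  show "uniformity = (INF e\<in>{0<..}. principal {(x :: L2, y). dist x y < e})"
    by (rule uniformity_L2_def)
  show "open U \<longleftrightarrow> (\<forall>x\<in>U. eventually (\<lambda>(x', y). x' = x \<longrightarrow> y \<in> U) uniformity)"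
    for U :: "L2 set"
    by (rule open_L2_def)
qed

end

lemma rep_L2_square_integrable: "rep_L2 x \<in> square_integrable"
  using Quotient3_rep_reflp[OF Quotient3_L2] by blast

lemma abs_rep_L2: "abs_L2 (rep_L2 x) = x"
  by (rule Quotient3_abs_rep[OF Quotient3_L2])

lemma rep_abs_L2: "f \<in> square_integrable \<Longrightarrow> AE z in circle. rep_L2 (abs_L2 f) z = f z"
  using rep_abs_rsp_left[OF Quotient3_L2, of f f] by simp

lemma abs_L2_diff:
  assumes "f \<in> square_integrable" "g \<in> square_integrable"
  shows "abs_L2 f - abs_L2 g = abs_L2 (\<lambda>z. f z - g z)"
proof -
  have "abs_L2 f - abs_L2 g = abs_L2 f + (- 1) *\<^sub>C abs_L2 g"
    by (rule minus_L2_def)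
  also have "\<dots> = abs_L2 (\<lambda>z. f z + (- 1) * g z)"
    using assms square_integrable_scale[OF assms(2), of "- 1"]
    by (simp only: scaleC_L2.abs_eq plus_L2.abs_eq simp_thms AE_I2)
  finally show ?thesis by simp
qed

lemma square_integrable_diff:
  assumes "f \<in> square_integrable" "g \<in> square_integrable"
  shows "(\<lambda>z. f z - g z) \<in> square_integrable"
  using square_integrable_add[OF assms(1) square_integrable_scale[OF assms(2), of "-1"]] by simp

lemma norm_abs_L2:
  assumes "f \<in> square_integrable"
  shows "ennreal ((norm (abs_L2 f))\<^sup>2) = (\<integral>\<^sup>+z. ennreal ((cmod (f z))\<^sup>2) \<partial>circle)"
proof -
  have "(norm (abs_L2 f))\<^sup>2 = Re (cinner (abs_L2 f) (abs_L2 f))"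
    by (simp add: power2_norm_eq_inner inner_eq_Re_cinner)
  also have "\<dots> = Re (\<integral>z. f z * cnj (f z) \<partial>circle)"
    using assms by (simp add: cinner_L2.abs_eq)
  also have "\<dots> = (\<integral>z. (cmod (f z))\<^sup>2 \<partial>circle)"
    unfolding complex_norm_square[symmetric] integral_complex_of_real by simp
  finally show ?thesis
    using assms by (simp add: square_integrable_def nn_integral_eq_integral)
qed

text \<open>The Riesz--Fischer theorem.\<close>

instance L2 :: chilbert_space
proof
  fix X :: "nat \<Rightarrow> L2"
  assume X: "Cauchy X"
  have "\<exists>r. \<forall>k. (\<forall>m\<ge>r k. \<forall>n\<ge>r k. dist (X m) (X n) < (1/2)^k) \<and> r k < r (Suc k)"
  proof (rule dependent_nat_choice)
    show "\<exists>x. \<forall>m\<ge>x. \<forall>n\<ge>x. dist (X m) (X n) < (1/2)^0"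
      using X by (simp add: metric_CauchyD)
  next
    fix x k
    obtain N where "\<forall>m\<ge>N. \<forall>n\<ge>N. dist (X m) (X n) < (1/2)^Suc k"
      using metric_CauchyD[OF X, of "(1/2)^Suc k"] by auto
    then show "\<exists>y. (\<forall>m\<ge>y. \<forall>n\<ge>y. dist (X m) (X n) < (1/2)^Suc k) \<and> x < y"
      by (intro exI[of _ "max N (Suc x)"]) auto
  qed
  then obtain r where r: "\<And>k m n. m \<ge> r k \<Longrightarrow> n \<ge> r k \<Longrightarrow> dist (X m) (X n) < (1/2)^k"
    and "\<And>k. r k < r (Suc k)" by blast
  then have "strict_mono r" by (simp add: strict_mono_Suc_iff)
  define f where "f k = rep_L2 (X (r k))" for k
  have f: "f k \<in> square_integrable" for k
    by (simp add: f_def rep_L2_square_integrable)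
  have [measurable]: "f k \<in> borel_measurable circle" for k
    using f by (rule square_integrable_measurable)
  have le: "(\<integral>\<^sup>+z. ennreal ((cmod (f i z - f j z))\<^sup>2) \<partial>circle) \<le> ennreal (((1/2)^k)\<^sup>2)"
    if "i \<ge> k" "j \<ge> k" for i j k
  proof -
    have "norm (abs_L2 (\<lambda>z. f i z - f j z)) = dist (X (r i)) (X (r j))"
      by (simp add: f f_def abs_rep_L2 dist_norm rep_L2_square_integrable flip: abs_L2_diff)
    also have "\<dots> \<le> (1/2)^k"
      by (rule less_imp_le, rule r) (use that \<open>strict_mono r\<close> in \<open>simp_all add: strict_mono_less_eq\<close>)
    finally show ?thesis
      unfolding norm_abs_L2[OF square_integrable_diff[OF f f], symmetric]
      by (intro ennreal_leI power_mono) auto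
  qed
  have L1: "(\<integral>\<^sup>+z. ennreal (cmod (f (Suc k) z - f k z)) \<partial>circle) \<le> ennreal ((1/2)^k)" for k
  proof -
    define t :: real where "t = (1/2)^k"
    have t: "t > 0" by (simp add: t_def)
    have "a \<le> t / 2 + a\<^sup>2 * (1 / (2 * t))" for a :: real
      using t sum_squares_bound[of a t] by (simp add: field_simps power2_eq_square)
    then have "(\<integral>\<^sup>+z. ennreal (cmod (f (Suc k) z - f k z)) \<partial>circle)
      \<le> (\<integral>\<^sup>+z. ennreal (t / 2) + ennreal ((cmod (f (Suc k) z - f k z))\<^sup>2) * ennreal (1 / (2 * t)) \<partial>circle)"
      using t by (intro nn_integral_mono) (simp add: ennreal_leI flip: ennreal_mult ennreal_plus)
    also have "\<dots> = ennreal (t / 2) +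
        (\<integral>\<^sup>+z. ennreal ((cmod (f (Suc k) z - f k z))\<^sup>2) \<partial>circle) * ennreal (1 / (2 * t))"
      using t by (simp add: nn_integral_add nn_integral_multc prob_space.emeasure_space_1[OF prob_space_circle])
    also have "\<dots> \<le> ennreal (t / 2) + ennreal (t\<^sup>2) * ennreal (1 / (2 * t))"
      unfolding t_def by (intro add_left_mono mult_right_mono le) auto
    also have "\<dots> = ennreal t"
      using t by (simp add: power2_eq_square flip: ennreal_mult ennreal_plus)
    finally show ?thesis by (simp add: t_def)
  qed
  have "(\<integral>\<^sup>+z. (\<Sum>k. ennreal (cmod (f (Suc k) z - f k z))) \<partial>circle)
      = (\<Sum>k. \<integral>\<^sup>+z. ennreal (cmod (f (Suc k) z - f k z)) \<partial>circle)"
    by (rule nn_integral_suminf) simp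
  also have "\<dots> \<le> (\<Sum>k. ennreal ((1/2)^k))"
    by (intro suminf_le L1) auto
  also have "\<dots> = ennreal (\<Sum>k. (1/2)^k)"
    by (intro suminf_ennreal2) (auto intro: summable_geometric)
  also have "\<dots> < \<infinity>" by simp
  finally have "AE z in circle. (\<Sum>k. ennreal (cmod (f (Suc k) z - f k z))) \<noteq> \<infinity>"
    by (intro nn_integral_noteq_infinite) auto
  then have conv: "AE z in circle. (\<lambda>k. f k z) \<longlonglongrightarrow> lim (\<lambda>k. f k z)"
  proof eventually_elim
    case (elim z)
    then have "summable (\<lambda>k. cmod (f (Suc k) z - f k z))"
      by (intro summable_suminf_not_top) auto
    then have "summable (\<lambda>k. f (Suc k) z - f k z)"
      by (rule summable_norm_cancel)
    then have "convergent (\<lambda>n. \<Sum>k<n. f (Suc k) z - f k z)"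
      by (simp add: summable_iff_convergent)
    then have "convergent (\<lambda>n. f n z - f 0 z)"
      by (simp only: sum_lessThan_telescope[of "\<lambda>k. f k z"])
    then have "convergent (\<lambda>n. f n z)"
      by (simp add: convergent_diff_const_right_iff)
    then show ?case by (simp add: convergent_LIMSEQ_iff)
  qed
  define g where "g z = lim (\<lambda>k. f k z)" for z
  have [measurable]: "g \<in> borel_measurable circle"
    unfolding g_def by (rule borel_measurable_lim_metric) simp
  have g_le: "(\<integral>\<^sup>+z. ennreal ((cmod (g z - f k z))\<^sup>2) \<partial>circle) \<le> ennreal (((1/2)^k)\<^sup>2)" for k
  proof -
    have "(\<integral>\<^sup>+z. ennreal ((cmod (g z - f k z))\<^sup>2) \<partial>circle)
        = (\<integral>\<^sup>+z. liminf (\<lambda>n. ennreal ((cmod (f n z - f k z))\<^sup>2)) \<partial>circle)"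
      using conv
    proof (intro nn_integral_cong_AE, eventually_elim)
      case (elim z)
      then have "(\<lambda>n. ennreal ((cmod (f n z - f k z))\<^sup>2)) \<longlonglongrightarrow> ennreal ((cmod (g z - f k z))\<^sup>2)"
        unfolding g_def by (intro tendsto_intros)
      from lim_imp_Liminf[OF _ this] show ?case by simp
    qed
    also have "\<dots> \<le> liminf (\<lambda>n. \<integral>\<^sup>+z. ennreal ((cmod (f n z - f k z))\<^sup>2) \<partial>circle)"
      by (rule nn_integral_liminf) simp
    also have "\<dots> \<le> limsup (\<lambda>n. \<integral>\<^sup>+z. ennreal ((cmod (f n z - f k z))\<^sup>2) \<partial>circle)"
      by (rule Liminf_le_Limsup) simp
    also have "\<dots> \<le> ennreal (((1/2)^k)\<^sup>2)"
      by (intro Limsup_bounded eventually_sequentiallyI[of k] le) auto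
    finally show ?thesis .
  qed
  have "(\<lambda>z. g z - f 0 z) \<in> square_integrable"
    unfolding square_integrable_def
    using le_less_trans[OF g_le[of 0]] by (auto intro!: integrableI_bounded)
  from square_integrable_add[OF this f[of 0]] have g: "g \<in> square_integrable" by simp
  have "dist (X (r k)) (abs_L2 g) \<le> (1/2)^k" for k
  proof -
    have "dist (X (r k)) (abs_L2 g) = norm (abs_L2 g - X (r k))"
      by (metis dist_commute dist_norm)
    also have "\<dots> = norm (abs_L2 (\<lambda>z. g z - f k z))"
      by (simp add: f g f_def abs_rep_L2 rep_L2_square_integrable flip: abs_L2_diff)
    finally have "ennreal ((dist (X (r k)) (abs_L2 g))\<^sup>2) \<le> ennreal (((1/2)^k)\<^sup>2)"
      using g_le[of k] by (simp add: norm_abs_L2 square_integrable_diff f g)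
    then have "(dist (X (r k)) (abs_L2 g))\<^sup>2 \<le> ((1/2)^k)\<^sup>2"
      by (subst (asm) ennreal_le_iff) auto
    then show ?thesis by (rule power2_le_imp_le) auto
  qed
  then have "(\<lambda>k. dist (X (r k)) (abs_L2 g)) \<longlonglongrightarrow> 0"
    by (intro tendsto_sandwich[OF _ _ tendsto_const LIMSEQ_power_zero[of "1/2 :: real"]]) auto
  then have lim: "(X \<circ> r) \<longlonglongrightarrow> abs_L2 g"
    unfolding o_def by (rule tendsto_dist_iff[THEN iffD2])
  have "X \<longlonglongrightarrow> abs_L2 g"
  proof (rule metric_LIMSEQ_I)
    fix e :: real assume e: "e > 0"
    then have e2: "e / 2 > 0" by simp
    obtain M where M: "\<And>m n. m \<ge> M \<Longrightarrow> n \<ge> M \<Longrightarrow> dist (X m) (X n) < e / 2"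
      using metric_CauchyD[OF X e2] by blast
    obtain K where K: "\<And>k. k \<ge> K \<Longrightarrow> dist (X (r k)) (abs_L2 g) < e / 2"
      using metric_LIMSEQ_D[OF lim e2] unfolding o_def by blast
    have "dist (X n) (abs_L2 g) < e" if "n \<ge> M" for n
    proof -
      have "M \<le> r (max K M)"
        using seq_suble[OF \<open>strict_mono r\<close>, of "max K M"] by linarith
      then have "dist (X n) (X (r (max K M))) < e / 2"
        using that by (intro M)
      moreover have "dist (X (r (max K M))) (abs_L2 g) < e / 2"
        by (intro K) simp
      ultimately show ?thesis
        using dist_triangle[of "X n" "abs_L2 g" "X (r (max K M))"] by linarith
    qed
    then show "\<exists>N. \<forall>n\<ge>N. dist (X n) (abs_L2 g) < e" by blast
  qed
  then show "convergent X" by (rule convergentI)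
qed


section \<open>The Hardy space \<open>H\<^sup>2\<close>\<close>

definition fourier_coeff :: "(complex \<Rightarrow> complex) \<Rightarrow> int \<Rightarrow> complex" where
  "fourier_coeff f n = (\<integral>z. f z * z powi (- n) \<partial>circle)"

definition hardy_space :: "L2 set" where
  "hardy_space = {f. \<forall>n<0. fourier_coeff (rep_L2 f) n = 0}"

lemma space_circle: "space circle = sphere 0 1"
  by (simp add: circle_def space_restrict_space)

lemma square_integrable_powi: "(\<lambda>z. z powi n) \<in> square_integrable"
proof -
  have "(\<lambda>z. z powi n) \<in> borel_measurable (restrict_space borel (sphere 0 1 :: complex set))"
    by (intro borel_measurable_continuous_on_restrict continuous_intros) auto
  then have [measurable]: "(\<lambda>z. z powi n) \<in> borel_measurable circle"
    unfolding circle_def by (intro measurable_completion) simp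
  interpret prob_space circle by (rule prob_space_circle)
  have "integrable circle (\<lambda>z. (cmod (z powi n))\<^sup>2)"
  proof (rule integrable_const_bound[where B = 1])
    show "AE z in circle. norm ((cmod (z powi n))\<^sup>2) \<le> 1"
      by (rule AE_I2) (simp add: space_circle norm_power_int)
  qed measurable
  then show ?thesis by (simp add: square_integrable_def)
qed

lemma fourier_coeff_eq_cinner: "fourier_coeff (rep_L2 f) n = cinner f (abs_L2 (\<lambda>z. z powi n))"
proof -
  have "cinner f (abs_L2 (\<lambda>z. z powi n)) = cinner (abs_L2 (rep_L2 f)) (abs_L2 (\<lambda>z. z powi n))"
    by (simp add: abs_rep_L2)
  also have "\<dots> = (\<integral>z. rep_L2 f z * cnj (z powi n) \<partial>circle)"
    by (subst cinner_L2.abs_eq) (auto simp: rep_L2_square_integrable square_integrable_powi)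
  also have "\<dots> = fourier_coeff (rep_L2 f) n"
    unfolding fourier_coeff_def
  proof (rule Bochner_Integration.integral_cong[OF refl])
    fix z assume "z \<in> space circle"
    then have "cnj z = inverse z"
      by (simp add: space_circle inverse_complex_def complex_eq_iff)
        (simp add: cmod_power2[symmetric])
    then show "rep_L2 f z * cnj (z powi n) = rep_L2 f z * z powi (- n)"
      by (simp add: power_int_minus power_int_inverse)
  qed
  finally show ?thesis by simp
qed

lemma hardy_space_subspace: "complex_vector.subspace hardy_space"
proof (rule complex_vector.subspaceI)
  have "cinner (0 :: L2) y = 0" for y
    using cinner_scaleC_left[of 0 0 y] by simp
  then show "0 \<in> hardy_space"
    by (simp add: hardy_space_def fourier_coeff_eq_cinner)
qed (auto simp: hardy_space_def fourier_coeff_eq_cinner cinner_add_left cinner_scaleC_left)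

lemma hardy_space_closed: "closed hardy_space"
proof -
  have Im: "Im (cinner x y) = inner x (\<i> *\<^sub>C y)" for x y :: L2
    by (subst cinner_commute, subst inner_commute) (simp add: inner_eq_Re_cinner cinner_scaleC_left)
  have "hardy_space = (\<Inter>n\<in>{..<0}. {f. inner f (abs_L2 (\<lambda>z. z powi n)) = 0} \<inter>
                             {f. inner f (\<i> *\<^sub>C abs_L2 (\<lambda>z. z powi n)) = 0})"
    by (auto simp: hardy_space_def fourier_coeff_eq_cinner complex_eq_iff Im inner_eq_Re_cinner[symmetric])
  also have "closed \<dots>"
    by (intro closed_INT ballI closed_Int closed_Collect_eq continuous_intros)
  finally show ?thesis .
qed

typedef H2 = hardy_space
  using complex_vector.subspace_0[OF hardy_space_subspace] by blast

setup_lifting type_definition_H2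

instantiation H2 :: complex_inner
begin

lift_definition zero_H2 :: H2 is 0
  by (rule complex_vector.subspace_0[OF hardy_space_subspace])

lift_definition plus_H2 :: "H2 \<Rightarrow> H2 \<Rightarrow> H2" is "(+)"
  by (rule complex_vector.subspace_add[OF hardy_space_subspace])

lift_definition scaleC_H2 :: "complex \<Rightarrow> H2 \<Rightarrow> H2" is scaleC
  by (rule complex_vector.subspace_scale[OF hardy_space_subspace])

lift_definition scaleR_H2 :: "real \<Rightarrow> H2 \<Rightarrow> H2" is scaleR
  unfolding scaleR_scaleC by (rule complex_vector.subspace_scale[OF hardy_space_subspace])

lift_definition uminus_H2 :: "H2 \<Rightarrow> H2" is uminus
  by (rule complex_vector.subspace_neg[OF hardy_space_subspace])

lift_definition minus_H2 :: "H2 \<Rightarrow> H2 \<Rightarrow> H2" is "(-)"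
  by (rule complex_vector.subspace_diff[OF hardy_space_subspace])

lift_definition sgn_H2 :: "H2 \<Rightarrow> H2" is sgn
  unfolding sgn_div_norm scaleR_scaleC
  by (rule complex_vector.subspace_scale[OF hardy_space_subspace])

lift_definition cinner_H2 :: "H2 \<Rightarrow> H2 \<Rightarrow> complex" is cinner .
lift_definition inner_H2 :: "H2 \<Rightarrow> H2 \<Rightarrow> real" is inner .
lift_definition norm_H2 :: "H2 \<Rightarrow> real" is norm .
lift_definition dist_H2 :: "H2 \<Rightarrow> H2 \<Rightarrow> real" is dist .

definition "uniformity_H2 = (INF e\<in>{0<..}. principal {(x :: H2, y). dist x y < e})"
definition "open_H2 (U :: H2 set) =
  (\<forall>x\<in>U. eventually (\<lambda>(x', y). x' = x \<longrightarrow> y \<in> U) uniformity)"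

instance
proof
  show "uniformity = (INF e\<in>{0<..}. principal {(x :: H2, y). dist x y < e})"
    by (rule uniformity_H2_def)
  show "open U \<longleftrightarrow> (\<forall>x\<in>U. eventually (\<lambda>(x', y). x' = x \<longrightarrow> y \<in> U) uniformity)"
    for U :: "H2 set"
    by (rule open_H2_def)
  show "cinner x y = cnj (cinner y x)" for x y :: H2
    by transfer (rule cinner_commute)
  show "inner x y = inner y x" for x y :: H2
    by transfer (rule inner_commute)
  show "r *\<^sub>R x = complex_of_real r *\<^sub>C x" for x :: H2 and r :: real
    by transfer (rule scaleR_scaleC)
  show "norm x = sqrt (inner x x)" for x :: H2
    by transfer (rule norm_eq_sqrt_inner)
  show "inner x y = Re (cinner x y)" for x y :: H2
    by transfer (rule inner_eq_Re_cinner)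
  fix x y z :: H2 and a b :: complex and r s :: real
  show "x + y + z = x + (y + z)" "x - y = x + - y"
    by (transfer, simp)+
  show "x + y = y + x"
    by transfer (rule add.commute)
  show "0 + x = x" "- x + x = 0"
    by (transfer, simp)+
  show "r *\<^sub>R (x + y) = r *\<^sub>R x + r *\<^sub>R y"
    by transfer (rule scaleR_add_right)
  show "(r + s) *\<^sub>R x = r *\<^sub>R x + s *\<^sub>R x"
    by transfer (rule scaleR_add_left)
  show "r *\<^sub>R s *\<^sub>R x = (r * s) *\<^sub>R x" "1 *\<^sub>R x = x"
    by (transfer, simp)+
  show "sgn x = inverse (norm x) *\<^sub>R x"
    by transfer (rule sgn_div_norm)
  show "dist x y = norm (x - y)"
    by transfer (rule dist_norm)
  show "inner (x + y) z = inner x z + inner y z"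
    by transfer (rule inner_add_left)
  show "inner (r *\<^sub>R x) y = r * inner x y" "0 \<le> inner x x" "inner x x = 0 \<longleftrightarrow> x = 0"
    by (transfer, simp)+
  show "a *\<^sub>C (x + y) = a *\<^sub>C x + a *\<^sub>C y"
    by transfer (rule scaleC_add_right)
  show "(a + b) *\<^sub>C x = a *\<^sub>C x + b *\<^sub>C x"
    by transfer (rule scaleC_add_left)
  show "a *\<^sub>C b *\<^sub>C x = (a * b) *\<^sub>C x"
    by transfer (rule scaleC_scaleC)
  show "cinner (x + y) z = cinner x z + cinner y z"
    by transfer (rule cinner_add_left)
  show "cinner (a *\<^sub>C x) y = a * cinner x y"
    by transfer (rule cinner_scaleC_left)
qed

end

instance H2 :: chilbert_space
proof
  fix X :: "nat \<Rightarrow> H2"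
  assume "Cauchy X"
  then have "Cauchy (\<lambda>n. Rep_H2 (X n))"
    unfolding Cauchy_def dist_H2.rep_eq .
  then obtain l where l: "(\<lambda>n. Rep_H2 (X n)) \<longlonglongrightarrow> l"
    using Cauchy_convergent unfolding convergent_def by blast
  have "l \<in> hardy_space"
    by (intro closed_sequentially[OF hardy_space_closed _ l] allI Rep_H2)
  have "X \<longlonglongrightarrow> Abs_H2 l"
    using l unfolding tendsto_dist_iff[where f = X] tendsto_dist_iff[where l = l] dist_H2.rep_eq
    by (simp only: Abs_H2_inverse[OF \<open>l \<in> hardy_space\<close>])
  then show "convergent X" by (rule convergentI)
qed


section \<open>Symbol classes and Toeplitz operators\<close>

text \<open>Elements of \<open>L\<^sup>\<infinity>\<close> are represented by functions; everything below depends
  only on their values almost everywhere on the circle.\<close>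

definition L_infinity :: "(complex \<Rightarrow> complex) set" where
  "L_infinity = {\<phi> \<in> borel_measurable circle. \<exists>K. AE z in circle. cmod (\<phi> z) \<le> K}"

definition H_infinity :: "(complex \<Rightarrow> complex) set" where
  "H_infinity = {\<phi> \<in> L_infinity. abs_L2 \<phi> \<in> hardy_space}"

definition H_infinity_plus_C :: "(complex \<Rightarrow> complex) set" where
  "H_infinity_plus_C = {\<phi> \<in> L_infinity. \<exists>f\<in>H_infinity. \<exists>g.
     continuous_on (sphere 0 1) g \<and> (AE z in circle. \<phi> z = f z + g z)}"

definition multiplication :: "(complex \<Rightarrow> complex) \<Rightarrow> L2 \<Rightarrow> L2" where
  "multiplication \<phi> f = abs_L2 (\<lambda>z. \<phi> z * rep_L2 f z)"

definition toeplitz :: "(complex \<Rightarrow> complex) \<Rightarrow> H2 \<Rightarrow> H2" where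
  "toeplitz \<phi> f = Abs_H2 (orthogonal_projection hardy_space (multiplication \<phi> (Rep_H2 f)))"

end

theory Submission
  imports Defs
begin

text \<open>Let \<open>H\<^sub>\<phi> f = (1 - P) (\<phi> f)\<close> be the Hankel operator and \<open>S\<close> the shift. Since
  \<open>\<parallel>T\<^sub>\<phi> f\<parallel>\<^sup>2 = \<parallel>\<phi> f\<parallel>\<^sup>2 - \<parallel>H\<^sub>\<phi> f\<parallel>\<^sup>2\<close>, everything is governed by \<open>\<bar>\<phi>\<bar>\<close> and by whether
  \<open>\<parallel>H\<^sub>\<phi> S\<^sup>N\<parallel> \<rightarrow> 0\<close>, that is, whether \<open>H\<^sub>\<phi>\<close> is compact.

  An absolutely minimum attaining operator cannot have two different limits of \<open>\<parallel>T x\<parallel>\<^sup>2\<close> along weakly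
  null sequences of unit vectors. As \<open>\<parallel>T\<^sub>\<phi> z\<^sup>n f\<parallel> \<rightarrow> \<parallel>\<phi> f\<parallel>\<close>, this forces \<open>\<bar>\<phi>\<bar>\<close> to be constant, and
  then \<open>\<parallel>H\<^sub>\<phi> S\<^sup>N\<parallel> \<rightarrow> 0\<close>. By Nehari's theorem \<open>\<phi>\<close> is at small distance from \<open>z\<^bsup>-N\<^esup> H\<^sup>\<infinity>\<close>, and a
  telescoping series with Fejer means puts \<open>\<phi>\<close> into \<open>H\<^sup>\<infinity> + C\<close>.

  Conversely, on a closed subspace \<open>\<parallel>T\<^sub>\<phi> x\<parallel>\<^sup>2 = \<alpha>\<^sup>2 - \<parallel>H\<^sub>\<phi> x\<parallel>\<^sup>2\<close> is minimised by a unit vector because the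
  compact operator \<open>H\<^sub>\<phi>\<close> attains its norm there. Moreover
  \<open>\<parallel>(\<bar>T\<^sub>\<phi>\<bar> - \<alpha>) x\<parallel> \<le> \<parallel>H\<^sub>\<phi> x\<parallel>\<close>, so \<open>\<bar>T\<^sub>\<phi>\<bar> - \<alpha>\<close> is compact, and the condition
  \<open>\<alpha> \<in> \<sigma>\<^bsub>ess\<^esub>(\<bar>T\<^sub>\<phi>\<bar>)\<close> holds automatically.\<close>

section \<open>Complex inner product spaces\<close>

text \<open>The main obstacle is to pass from a norm bound for the Hankel operator to a bounded
  analytic function. The duality proof of Nehari's theorem needs \<open>H^1\<close> and the
  factorisation of its elements; here everything stays in \<open>L^2\<close>. The coefficients of
  the approximant are chosen one at a time, each by a completion problem with one unknown scalar,
  and square summability of the choices follows from the same norm bounds. Pointwise bounds are read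
  off from \<open>L^2\<close> by integrating a weight against \<open>|p|^2\<close> for trigonometric
  polynomials \<open>p\<close>. The second obstacle is that the approximants are bounded but not
  continuous. The difference of two of them has only finitely many negative coefficients, and these
  alone have to be reproduced: a trigonometric polynomial of comparable supremum norm does so, and
  \<open>H^2\<close> absorbs the error. The bound for \<open>|T| - \<alpha>\<close> rests on
  \<open>|T|^2 <= \<alpha> |T|\<close>, and the spectral condition on the fact that a compact
  operator on an infinite-dimensional Hilbert space is not Fredholm. Square roots of positive
  operators are constructed because \<open>sqrt_operator\<close> is a definite description, which
  carries information only after existence and uniqueness.\<close>

lemma norm_scaleC: "norm (a *\<^sub>C x) = cmod a * norm (x :: 'a::complex_inner)"
proof -
  have "cinner (a *\<^sub>C x) (a *\<^sub>C x) = a * cnj a * cnj (cinner x x)"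
    by (simp add: cinner_scaleC_left cinner_commute[of x "a *\<^sub>C x"])
  also have "\<dots> = of_real ((cmod a)\<^sup>2) * cnj (cinner x x)"
    by (simp only: complex_norm_square)
  finally have "inner (a *\<^sub>C x) (a *\<^sub>C x) = (cmod a)\<^sup>2 * inner x x"
    by (simp add: inner_eq_Re_cinner)
  then have "(norm (a *\<^sub>C x))\<^sup>2 = (cmod a * norm x)\<^sup>2"
    by (simp add: power2_norm_eq_inner power_mult_distrib)
  then show ?thesis
    by (rule power2_eq_imp_eq) auto
qed

lemma norm_cinner_le: "cmod (cinner x y) \<le> norm x * norm (y :: 'a::complex_inner)"
proof (cases "cinner x y = 0")
  case False
  \<comment> \<open>A unimodular factor that rotates \<open>cinner x y\<close> onto the positive
    real axis, so that the real Cauchy-Schwarz inequality gives the complex one.\<close>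
  define c where "c = cnj (cinner x y) / cmod (cinner x y)"
  have c: "cmod c = 1"
    using False by (simp add: c_def norm_divide)
  have "cinner (c *\<^sub>C x) y = cnj (cinner x y) * cinner x y / cmod (cinner x y)"
    by (simp add: cinner_scaleC_left c_def)
  also have "cnj (cinner x y) * cinner x y = of_real ((cmod (cinner x y))\<^sup>2)"
    by (simp only: complex_norm_square mult.commute)
  also have "complex_of_real ((cmod (cinner x y))\<^sup>2) / of_real (cmod (cinner x y)) = of_real (cmod (cinner x y))"
    using False by (simp add: power2_eq_square)
  finally have "inner (c *\<^sub>C x) y = cmod (cinner x y)"
    by (simp add: inner_eq_Re_cinner)
  moreover have "inner (c *\<^sub>C x) y \<le> norm (c *\<^sub>C x) * norm y"
    by (rule norm_cauchy_schwarz)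
  ultimately show ?thesis
    by (simp add: norm_scaleC c)
qed simp

lemma Re_cinner_le:
  fixes x y :: "'a::complex_inner"
  assumes "norm y \<le> k * norm x"
  shows "Re (cinner y x) \<le> k * (norm x)\<^sup>2"
proof -
  have "Re (cinner y x) \<le> norm y * norm x"
    by (rule order_trans[OF complex_Re_le_cmod norm_cinner_le])
  also have "\<dots> \<le> k * norm x * norm x"
    by (intro mult_right_mono assms) simp
  finally show ?thesis by (simp add: power2_eq_square mult.assoc)
qed

lemma cinner_add_right: "cinner x (y + z) = cinner x y + cinner x (z :: 'a::complex_inner)"
  by (metis cinner_add_left cinner_commute complex_cnj_add)

lemma cinner_scaleC_right: "cinner x (a *\<^sub>C y) = cnj a * cinner x (y :: 'a::complex_inner)"
  by (metis cinner_commute cinner_scaleC_left complex_cnj_mult)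

text \<open>Over the reals the conjugate-linear second argument is linear as well, so limits, sums
  and differences are inherited from the theory of bounded bilinear maps.\<close>

interpretation cinner: bounded_bilinear "cinner :: 'a::complex_inner \<Rightarrow> 'a \<Rightarrow> complex"
proof
  show "cinner (r *\<^sub>R x) y = r *\<^sub>R cinner x y" "cinner x (r *\<^sub>R y) = r *\<^sub>R cinner x y" for r and x y :: 'a
    by (simp_all add: scaleR_scaleC cinner_scaleC_left cinner_scaleC_right scaleR_conv_of_real)
  show "\<exists>K. \<forall>x y :: 'a. cmod (cinner x y) \<le> norm x * norm y * K"
    by (rule exI[of _ 1]) (simp add: norm_cinner_le)
qed (rule cinner_add_left cinner_add_right)+

interpretation scaleC: bounded_bilinear "scaleC :: complex \<Rightarrow> 'a::complex_inner \<Rightarrow> 'a"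
proof
  show "(r *\<^sub>R a) *\<^sub>C x = r *\<^sub>R a *\<^sub>C x" "a *\<^sub>C r *\<^sub>R x = r *\<^sub>R a *\<^sub>C x" for r a and x :: 'a
    by (simp_all add: scaleR_scaleC scaleC_scaleC scaleR_conv_of_real mult.commute)
  show "\<exists>K. \<forall>a (x :: 'a). norm (a *\<^sub>C x) \<le> norm a * norm x * K"
    by (rule exI[of _ 1]) (simp add: norm_scaleC)
qed (rule scaleC_add_left scaleC_add_right)+

lemma cinner_self: "cinner x x = of_real ((norm (x :: 'a::complex_inner))\<^sup>2)"
proof -
  have "cnj (cinner x x) = cinner x x"
    by (rule cinner_commute[symmetric])
  then have "Im (cinner x x) = 0"
    by (simp add: complex_eq_iff)
  then show ?thesis
    by (simp add: complex_eq_iff power2_norm_eq_inner inner_eq_Re_cinner)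
qed

lemma norm_add_square:
  "(norm (x + y))\<^sup>2 = (norm x)\<^sup>2 + 2 * Re (cinner x y) + (norm (y :: 'a::complex_inner))\<^sup>2"
  by (simp add: power2_norm_eq_inner inner_add_left inner_add_right inner_commute inner_eq_Re_cinner[symmetric])

lemma norm_diff_square:
  "(norm (x - y))\<^sup>2 = (norm x)\<^sup>2 - 2 * Re (cinner x y) + (norm (y :: 'a::complex_inner))\<^sup>2"
  by (simp add: power2_norm_eq_inner inner_diff_left inner_diff_right inner_commute inner_eq_Re_cinner[symmetric])

lemma pythagoras:
  "cinner x y = 0 \<Longrightarrow> (norm (x + y))\<^sup>2 = (norm x)\<^sup>2 + (norm (y :: 'a::complex_inner))\<^sup>2"
  by (simp add: norm_add_square)

text \<open>The exact convexity defect of a quadratic form. It carries over to differences of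
  squared norms, which is the identity that \<open>parrott\<close> asks of \<open>F\<close>.\<close>

lemma norm_convex_combination:
  "(norm ((1 - t) *\<^sub>R x + t *\<^sub>R y))\<^sup>2
     = (1 - t) * (norm x)\<^sup>2 + t * (norm y)\<^sup>2 - t * (1 - t) * (norm (x - y :: 'a::real_inner))\<^sup>2"
  unfolding power2_norm_eq_inner inner_add_left inner_add_right inner_diff_left inner_diff_right
    inner_scaleR_left inner_scaleR_right inner_commute[of y x]
  by (simp add: algebra_simps)

lemma eq_if_cinner_eq: "(\<And>z. cinner x z = cinner y z) \<Longrightarrow> x = (y :: 'a::complex_inner)"
proof -
  assume "\<And>z. cinner x z = cinner y z"
  then have "cinner (x - y) (x - y) = 0"
    by (simp add: cinner.diff_left)
  then show ?thesis
    by (simp add: cinner_self)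
qed

section \<open>Bounded complex-linear maps\<close>

lemma bounded_clinear_imp_bounded_linear: "bounded_clinear T \<Longrightarrow> bounded_linear T"
  by (simp add: bounded_clinear_def)

lemma bounded_clinear_scaleC: "bounded_clinear T \<Longrightarrow> T (a *\<^sub>C x) = a *\<^sub>C T x"
  by (auto simp: bounded_clinear_def Vector_Spaces.linear_def module_hom_def module_hom_axioms_def)

lemma bounded_clinear_add: "bounded_clinear T \<Longrightarrow> T (x + y) = T x + T y"
  by (auto simp: bounded_clinear_def Vector_Spaces.linear_def module_hom_def module_hom_axioms_def)

lemma bounded_clinearI:
  assumes "\<And>x y. T (x + y) = T x + T y" "\<And>a x. T (a *\<^sub>C x) = a *\<^sub>C T x"
    "\<And>x. norm (T x) \<le> norm x * K"
  shows "bounded_clinear T"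
proof -
  have "bounded_linear T"
    using assms by (intro bounded_linear_intro[where K = K]) (auto simp: scaleR_scaleC)
  moreover have "Vector_Spaces.linear scaleC scaleC T"
    by unfold_locales (use assms in auto)
  ultimately show ?thesis
    by (simp add: bounded_clinear_def)
qed

instance chilbert_space \<subseteq> banach ..

section \<open>Orthonormal sequences\<close>

definition orthonormal :: "('i \<Rightarrow> 'a::complex_inner) \<Rightarrow> bool" where
  "orthonormal u \<longleftrightarrow> (\<forall>i j. cinner (u i) (u j) = (if i = j then 1 else 0))"

lemma orthonormal_cinner: "orthonormal u \<Longrightarrow> cinner (u i) (u j) = (if i = j then 1 else 0)"
  by (simp add: orthonormal_def)

lemma orthonormal_norm: "orthonormal u \<Longrightarrow> norm (u i) = 1"
proof -
  assume "orthonormal u"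
  then have "complex_of_real ((norm (u i))\<^sup>2) = of_real 1"
    by (simp only: cinner_self[symmetric] orthonormal_cinner) simp
  then show ?thesis
    unfolding of_real_eq_iff using norm_ge_zero[of "u i"] by (auto simp: power2_eq_1_iff)
qed

lemma orthonormal_dist:
  assumes "orthonormal u" "i \<noteq> j"
  shows "dist (u i) (u j) = sqrt 2"
proof -
  have "(dist (u i) (u j))\<^sup>2 = 2"
    using assms by (simp add: dist_norm norm_diff_square orthonormal_cinner orthonormal_norm)
  then show ?thesis
    by (metis real_sqrt_abs abs_of_nonneg zero_le_dist)
qed

lemma cinner_orthonormal_sum:
  assumes "orthonormal u" "finite I" "i \<in> I"
  shows "cinner (\<Sum>k\<in>I. a k *\<^sub>C u k) (u i) = a i"
proof -
  have "cinner (\<Sum>k\<in>I. a k *\<^sub>C u k) (u i) = (\<Sum>k\<in>I. if k = i then a i else 0)"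
    unfolding cinner.sum_left
    using assms(1) by (intro sum.cong refl) (simp add: cinner_scaleC_left orthonormal_cinner)
  also have "\<dots> = a i"
    using assms by simp
  finally show ?thesis .
qed

lemma norm_orthogonal_sum:
  fixes v :: "'i \<Rightarrow> 'a::complex_inner"
  assumes "finite I" "\<And>i j. i \<in> I \<Longrightarrow> j \<in> I \<Longrightarrow> i \<noteq> j \<Longrightarrow> cinner (v i) (v j) = 0"
  shows "(norm (\<Sum>i\<in>I. a i *\<^sub>C v i))\<^sup>2 = (\<Sum>i\<in>I. (cmod (a i))\<^sup>2 * (norm (v i))\<^sup>2)"
  using assms
proof (induction I rule: finite_induct)
  case (insert i I)
  have "cinner (a i *\<^sub>C v i) (\<Sum>k\<in>I. a k *\<^sub>C v k) = 0"
    unfolding cinner.sum_right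
  proof (rule sum.neutral, rule ballI)
    fix k assume "k \<in> I"
    with insert have "cinner (v i) (v k) = 0" by (metis insertCI)
    then show "cinner (a i *\<^sub>C v i) (a k *\<^sub>C v k) = 0"
      by (simp add: cinner_scaleC_left cinner_scaleC_right)
  qed
  with insert show ?case
    by (simp add: pythagoras norm_scaleC power_mult_distrib)
qed simp

lemma norm_orthonormal_sum:
  assumes "orthonormal u" "finite I"
  shows "(norm (\<Sum>k\<in>I. a k *\<^sub>C u k))\<^sup>2 = (\<Sum>k\<in>I. (cmod (a k))\<^sup>2)"
  using assms norm_orthogonal_sum[of I u a] by (simp add: orthonormal_norm orthonormal_cinner)

lemma bessel:
  assumes "orthonormal u" "finite I"
  shows "(\<Sum>k\<in>I. (cmod (cinner x (u k)))\<^sup>2) \<le> (norm x)\<^sup>2"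
proof -
  define s where "s = (\<Sum>k\<in>I. cinner x (u k) *\<^sub>C u k)"
  have "cinner x s = (\<Sum>k\<in>I. of_real ((cmod (cinner x (u k)))\<^sup>2))"
    unfolding s_def cinner.sum_right
    by (intro sum.cong refl) (simp only: cinner_scaleC_right complex_norm_square mult.commute)
  then have "Re (cinner x s) = (\<Sum>k\<in>I. (cmod (cinner x (u k)))\<^sup>2)"
    by simp
  moreover have "(norm s)\<^sup>2 = (\<Sum>k\<in>I. (cmod (cinner x (u k)))\<^sup>2)"
    unfolding s_def using assms by (rule norm_orthonormal_sum)
  moreover have "0 \<le> (norm (x - s))\<^sup>2" by simp
  ultimately show ?thesis
    unfolding norm_diff_square by simp
qed

lemma orthonormal_series_convergent:
  fixes u :: "nat \<Rightarrow> 'a::chilbert_space"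
  assumes u: "orthonormal u" and a: "summable (\<lambda>n. (cmod (a n))\<^sup>2)"
  shows "convergent (\<lambda>n. \<Sum>k<n. a k *\<^sub>C u k)"
proof -
  have "summable (\<lambda>n. a n *\<^sub>C u n)"
    unfolding summable_Cauchy
  proof (intro allI impI)
    fix e :: real assume "e > 0"
    then obtain N where N: "\<And>m n. m \<ge> N \<Longrightarrow> norm (\<Sum>k=m..<n. (cmod (a k))\<^sup>2) < e\<^sup>2"
      using a unfolding summable_Cauchy by (meson zero_less_power)
    have "norm (\<Sum>k=m..<n. a k *\<^sub>C u k) < e" if "m \<ge> N" for m n
    proof (rule power2_less_imp_less)
      show "(norm (\<Sum>k=m..<n. a k *\<^sub>C u k))\<^sup>2 < e\<^sup>2"
        using N[OF that, of n] norm_orthonormal_sum[OF u, of "{m..<n}" a] by simp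
    qed (use \<open>e > 0\<close> in simp)
    then show "\<exists>N. \<forall>m\<ge>N. \<forall>n. norm (\<Sum>k=m..<n. a k *\<^sub>C u k) < e" by blast
  qed
  then show ?thesis
    by (simp add: summable_iff_convergent)
qed

lemma orthonormal_series_coeff:
  fixes u :: "nat \<Rightarrow> 'a::complex_inner"
  assumes u: "orthonormal u" and lim: "(\<lambda>n. \<Sum>k<n. a k *\<^sub>C u k) \<longlonglongrightarrow> y"
  shows "cinner y (u k) = a k"
proof -
  have "(\<lambda>n. cinner (\<Sum>k<n. a k *\<^sub>C u k) (u k)) \<longlonglongrightarrow> cinner y (u k)"
    by (intro cinner.tendsto lim tendsto_const)
  moreover have "(\<lambda>n. cinner (\<Sum>k<n. a k *\<^sub>C u k) (u k)) \<longlonglongrightarrow> a k"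
    by (rule tendsto_eventually, rule eventually_sequentiallyI[of "Suc k"])
      (simp add: cinner_orthonormal_sum[OF u])
  ultimately show ?thesis
    by (rule LIMSEQ_unique)
qed

lemma summable_bessel:
  fixes u :: "nat \<Rightarrow> 'a::complex_inner"
  assumes "orthonormal u"
  shows "summable (\<lambda>n. (cmod (cinner x (u n)))\<^sup>2)"
  by (rule bounded_imp_summable[where B = "(norm x)\<^sup>2"]) (auto intro: bessel assms)

lemma orthonormal_projection_exists:
  fixes u :: "nat \<Rightarrow> 'a::chilbert_space"
  assumes u: "orthonormal u"
  obtains y where "(\<lambda>n. \<Sum>k<n. cinner x (u k) *\<^sub>C u k) \<longlonglongrightarrow> y" "\<And>k. cinner (x - y) (u k) = 0"
proof -
  obtain y where y: "(\<lambda>n. \<Sum>k<n. cinner x (u k) *\<^sub>C u k) \<longlonglongrightarrow> y"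
    using orthonormal_series_convergent[OF u summable_bessel[OF u, of x]] unfolding convergent_def by blast
  moreover have "cinner (x - y) (u k) = 0" for k
    by (simp add: cinner.diff_left orthonormal_series_coeff[OF u y])
  ultimately show ?thesis
    using that by blast
qed

section \<open>Operators with small values on a weakly null sequence\<close>

definition weakly_null :: "(nat \<Rightarrow> 'a::complex_inner) \<Rightarrow> bool" where
  "weakly_null v \<longleftrightarrow> (\<forall>w. (\<lambda>n. cinner (v n) w) \<longlonglongrightarrow> 0)"

text \<open>Each new constraint \<open>w\<close> is enforced by subtracting a multiple of a vector
  that is dual to \<open>w\<close> and orthogonal to the earlier constraints; the multiple tends to
  0 by weak convergence.\<close>

lemma weakly_null_perturb:
  assumes v: "weakly_null v" and "finite W"
  obtains v' where "\<And>n w. w \<in> W \<Longrightarrow> cinner (v' n) w = 0" "(\<lambda>n. v' n - v n) \<longlonglongrightarrow> 0"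
  using \<open>finite W\<close>
proof (induction W arbitrary: thesis rule: finite_induct)
  case empty
  show ?case by (rule empty[of v]) auto
next
  case (insert w W)
  obtain v' where v': "\<And>n w. w \<in> W \<Longrightarrow> cinner (v' n) w = 0" "(\<lambda>n. v' n - v n) \<longlonglongrightarrow> 0"
    using insert.IH by blast
  show ?case
  proof (cases "\<exists>e. cinner e w \<noteq> 0 \<and> (\<forall>z\<in>W. cinner e z = 0)")
    case True
    then obtain e0 where e0: "cinner e0 w \<noteq> 0" "\<forall>z\<in>W. cinner e0 z = 0" by blast
    define e where "e = (1 / cinner e0 w) *\<^sub>C e0"
    have e: "cinner e w = 1" "\<forall>z\<in>W. cinner e z = 0"
      using e0 by (simp_all add: e_def cinner_scaleC_left)
    have "(\<lambda>n. cinner (v n) w + cinner (v' n - v n) w) \<longlonglongrightarrow> 0 + cinner 0 w"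
      using v by (intro tendsto_add cinner.tendsto v' tendsto_const) (simp add: weakly_null_def)
    then have lim: "(\<lambda>n. cinner (v' n) w) \<longlonglongrightarrow> 0"
      by (simp add: cinner.diff_left cinner.zero_left)
    show ?thesis
    proof (rule insert.prems)
      have "(\<lambda>n. (v' n - v n) - cinner (v' n) w *\<^sub>C e) \<longlonglongrightarrow> 0 - 0 *\<^sub>C e"
        by (intro tendsto_diff scaleC.tendsto lim v' tendsto_const)
      then show "(\<lambda>n. (v' n - cinner (v' n) w *\<^sub>C e) - v n) \<longlonglongrightarrow> 0"
        by (simp add: scaleC.zero_left algebra_simps)
      show "cinner (v' n - cinner (v' n) w *\<^sub>C e) z = 0" if "z \<in> insert w W" for n z
        using that e v'(1) by (auto simp: cinner.diff_left cinner_scaleC_left)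
    qed
  next
    \<comment> \<open>Without a dual vector, orthogonality to \<open>W\<close> already implies
      orthogonality to \<open>w\<close>.\<close>
    case False
    show ?thesis
      using False v' by (intro insert.prems[of v']) auto
  qed
qed

text \<open>Orthogonality of \<open>x\<close> to a finite set is a closed condition of finite codimension, so a weakly null
  sequence can be moved into it at no asymptotic cost.\<close>

lemma weakly_null_perturb_le:
  assumes T: "bounded_clinear T" and v: "weakly_null v" "\<And>n. norm (v n) = 1" and "finite W"
    and le: "\<forall>\<^sub>F n in sequentially. s * (norm (T (v n)))\<^sup>2 \<le> s * a" and "s * a < s * c"
  shows "\<exists>x. (\<forall>w\<in>W. cinner x w = 0) \<and> s * (norm (T x))\<^sup>2 < s * (c * (norm x)\<^sup>2)"
proof -
  interpret T: bounded_linear T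
    using T by (rule bounded_clinear_imp_bounded_linear)
  obtain v' where v': "\<And>n w. w \<in> W \<Longrightarrow> cinner (v' n) w = 0" "(\<lambda>n. v' n - v n) \<longlonglongrightarrow> 0"
    using weakly_null_perturb[OF v(1) \<open>finite W\<close>] by blast
  have N: "(\<lambda>n. norm (v' n) - norm (v n)) \<longlonglongrightarrow> 0"
    by (rule Lim_null_comparison[OF _ tendsto_norm_zero[OF v'(2)]]) (simp add: norm_triangle_ineq3)
  have "(\<lambda>n. (norm (v' n) - norm (v n)) + 1) \<longlonglongrightarrow> 0 + 1"
    by (intro tendsto_add N tendsto_const)
  then have N1: "(\<lambda>n. norm (v' n)) \<longlonglongrightarrow> 1"
    by (simp add: v)
  have "(\<lambda>n. T (v' n - v n)) \<longlonglongrightarrow> T 0"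
    by (intro T.tendsto v')
  then have "(\<lambda>n. T (v' n) - T (v n)) \<longlonglongrightarrow> 0"
    by (simp add: T.diff T.zero)
  then have TN: "(\<lambda>n. norm (T (v' n)) - norm (T (v n))) \<longlonglongrightarrow> 0"
    by (rule Lim_null_comparison[OF always_eventually tendsto_norm_zero, rotated])
      (simp add: norm_triangle_ineq3)
  obtain K where K: "\<And>x. norm (T x) \<le> norm x * K"
    using T.bounded by blast
  have bd: "norm (norm (T (v' n)) + norm (T (v n))) \<le> (norm (v' n) + 1) * K" for n
    using K[of "v' n"] K[of "v n"] v(2)[of n] by (simp add: algebra_simps)
  have "(\<lambda>n. norm ((norm (T (v' n)) - norm (T (v n)))) * ((norm (v' n) + 1) * K)) \<longlonglongrightarrow> 0 * ((1 + 1) * K)"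
    by (intro tendsto_intros N1 tendsto_norm_zero TN)
  then have L: "(\<lambda>n. norm ((norm (T (v' n)) - norm (T (v n)))) * ((norm (v' n) + 1) * K)) \<longlonglongrightarrow> 0"
    by simp
  have "(\<lambda>n. (norm (T (v' n)) - norm (T (v n))) * (norm (T (v' n)) + norm (T (v n)))) \<longlonglongrightarrow> 0"
    by (rule Lim_null_comparison[OF always_eventually L])
      (use bd in \<open>auto simp: abs_mult intro!: mult_left_mono\<close>)
  then have D: "(\<lambda>n. (norm (T (v' n)))\<^sup>2 - (norm (T (v n)))\<^sup>2) \<longlonglongrightarrow> 0"
    by (simp add: power2_eq_square algebra_simps)
  \<comment> \<open>The margin between \<open>s * a\<close> and \<open>s * c\<close> absorbs all
    errors that tend to 0. The sign \<open>s\<close> is used with 1 and -1, to get vectors below and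
    above the level \<open>c\<close>.\<close>
  have "(\<lambda>n. s * ((norm (T (v' n)))\<^sup>2 - (norm (T (v n)))\<^sup>2) + (s * a - s * (c * (norm (v' n))\<^sup>2)))
           \<longlonglongrightarrow> s * 0 + (s * a - s * (c * 1\<^sup>2))"
    by (intro tendsto_intros D N1)
  then have "\<forall>\<^sub>F n in sequentially.
     s * ((norm (T (v' n)))\<^sup>2 - (norm (T (v n)))\<^sup>2) + (s * a - s * (c * (norm (v' n))\<^sup>2)) < 0"
    using \<open>s * a < s * c\<close> by (intro order_tendstoD) auto
  with le have "\<forall>\<^sub>F n in sequentially. s * (norm (T (v' n)))\<^sup>2 < s * (c * (norm (v' n))\<^sup>2)"
    by eventually_elim (simp add: algebra_simps)
  then obtain n where "s * (norm (T (v' n)))\<^sup>2 < s * (c * (norm (v' n))\<^sup>2)"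
    by (meson eventually_happens sequentially_bot)
  with v'(1) show ?thesis by blast
qed

lemma span_orthonormal_sum:
  fixes x :: "nat \<Rightarrow> 'a::complex_inner"
  assumes x: "orthonormal x" and y: "y \<in> complex_vector.span (range x)"
  shows "\<exists>n. y = (\<Sum>k<n. cinner y (x k) *\<^sub>C x k)"
proof -
  \<comment> \<open>Asking for all large truncations, not for one, makes \<open>V\<close> closed
    under sums: two vectors then share an index.\<close>
  define V where "V = {y. \<exists>n. \<forall>m\<ge>n. y = (\<Sum>k<m. cinner y (x k) *\<^sub>C x k)}"
  have "complex_vector.span (range x) \<subseteq> V"
  proof (rule complex_vector.span_minimal)
    show "range x \<subseteq> V"
    proof safe
      fix j
      have "x j = (\<Sum>k<m. cinner (x j) (x k) *\<^sub>C x k)" if "m \<ge> Suc j" for m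
      proof -
        have "(\<Sum>k<m. cinner (x j) (x k) *\<^sub>C x k) = (\<Sum>k<m. if k = j then x j else 0)"
          by (intro sum.cong refl) (auto simp: orthonormal_cinner[OF x] scaleC.zero_left)
        then show ?thesis using that by simp
      qed
      then show "x j \<in> V" unfolding V_def by blast
    qed
    show "complex_vector.subspace V"
    proof (rule complex_vector.subspaceI)
      show "0 \<in> V" by (simp add: V_def cinner.zero_left scaleC.zero_left)
    next
      fix y z assume "y \<in> V" "z \<in> V"
      then obtain n n' where "\<forall>m\<ge>n. y = (\<Sum>k<m. cinner y (x k) *\<^sub>C x k)"
        "\<forall>m\<ge>n'. z = (\<Sum>k<m. cinner z (x k) *\<^sub>C x k)" unfolding V_def by blast
      then have "\<forall>m\<ge>max n n'. y + z = (\<Sum>k<m. cinner (y + z) (x k) *\<^sub>C x k)"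
        by (simp add: cinner_add_left scaleC_add_left sum.distrib)
      then show "y + z \<in> V" unfolding V_def by blast
    next
      fix c y assume "y \<in> V"
      then obtain n where n: "\<And>m. m \<ge> n \<Longrightarrow> y = (\<Sum>k<m. cinner y (x k) *\<^sub>C x k)"
        unfolding V_def by blast
      have "c *\<^sub>C y = (\<Sum>k<m. cinner (c *\<^sub>C y) (x k) *\<^sub>C x k)" if "m \<ge> n" for m
        by (subst n[OF that]) (simp add: scaleC.sum_right cinner_scaleC_left scaleC_scaleC)
      then show "c *\<^sub>C y \<in> V" unfolding V_def by blast
    qed
  qed
  with y show ?thesis unfolding V_def by blast
qed

lemma complex_subspace_closure:
  fixes M :: "'a::complex_inner set"
  assumes M: "complex_vector.subspace M"
  shows "complex_vector.subspace (closure M)"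
proof (rule complex_vector.subspaceI)
  show "0 \<in> closure M"
    using complex_vector.subspace_0[OF M] closure_subset by blast
next
  fix x y assume "x \<in> closure M" "y \<in> closure M"
  then obtain f g where "\<forall>n. f n \<in> M" "f \<longlonglongrightarrow> x" "\<forall>n. g n \<in> M" "g \<longlonglongrightarrow> y"
    unfolding closure_sequential by blast
  then show "x + y \<in> closure M"
    unfolding closure_sequential
    by (intro exI[of _ "\<lambda>n. f n + g n"]) (auto intro: tendsto_add complex_vector.subspace_add[OF M])
next
  fix c x assume "x \<in> closure M"
  then obtain f where "\<forall>n. f n \<in> M" "f \<longlonglongrightarrow> x"
    unfolding closure_sequential by blast
  then show "c *\<^sub>C x \<in> closure M"
    unfolding closure_sequential
    by (intro exI[of _ "\<lambda>n. c *\<^sub>C f n"])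
      (auto intro: scaleC.tendsto complex_vector.subspace_scale[OF M])
qed

text \<open>The intermediate value theorem for \<open>G\<close> on the segment from \<open>p\<close>
  to \<open>q\<close>. Since \<open>G\<close> is homogeneous of degree 2, a nonzero zero of
  \<open>G\<close> can be normalised.\<close>

lemma exists_unit_with_value:
  assumes T: "bounded_clinear T" and c: "0 \<le> c"
    and p: "\<forall>w\<in>W. cinner p w = 0" "(norm (T p))\<^sup>2 < c * (norm p)\<^sup>2"
    and q: "\<forall>w\<in>W. cinner q w = 0" "c * (norm q)\<^sup>2 < (norm (T q))\<^sup>2"
  shows "\<exists>x. norm x = 1 \<and> (norm (T x))\<^sup>2 = c \<and> (\<forall>w\<in>W. cinner x w = 0)"
proof -
  interpret T: bounded_linear T
    using T by (rule bounded_clinear_imp_bounded_linear)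
  define G where "G x = (norm (T x))\<^sup>2 - c * (norm x)\<^sup>2" for x
  define z where "z t = (1 - t) *\<^sub>R p + t *\<^sub>R q" for t :: real
  have G_scale: "G (r *\<^sub>R x) = r\<^sup>2 * G x" for r x
    by (simp add: G_def T.scaleR power_mult_distrib algebra_simps)
  have "continuous_on {0..1} (\<lambda>t. G (z t))"
    unfolding G_def z_def by (intro continuous_intros T.continuous_on)
  moreover have "G (z 0) \<le> 0" "0 \<le> G (z 1)"
    using p q by (simp_all add: G_def z_def)
  ultimately obtain t where t: "0 \<le> t" "t \<le> 1" "G (z t) = 0"
    using IVT'[of "\<lambda>t. G (z t)" 0 0 1] by auto
  have "t \<noteq> 0"
    using t p by (auto simp: G_def z_def)
  \<comment> \<open>Otherwise \<open>q\<close> is a real multiple of \<open>p\<close>, and by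
    homogeneity \<open>G\<close> could not be negative at \<open>p\<close> and positive at
    \<open>q\<close>.\<close>
  have "z t \<noteq> 0"
  proof
    assume "z t = 0"
    then have "t *\<^sub>R q = (- (1 - t)) *\<^sub>R p"
      unfolding z_def by (simp add: add_eq_0_iff algebra_simps)
    then have "(1 / t) *\<^sub>R t *\<^sub>R q = (1 / t) *\<^sub>R (- (1 - t)) *\<^sub>R p"
      by simp
    then have "q = (- (1 - t) / t) *\<^sub>R p"
      using \<open>t \<noteq> 0\<close> by simp
    then have "G q = (- (1 - t) / t)\<^sup>2 * G p"
      using G_scale by metis
    moreover have "G p < 0" "0 < G q"
      using p q by (simp_all add: G_def)
    ultimately show False
      using mult_nonneg_nonpos[OF zero_le_power2[of "- (1 - t) / t"], of "G p"] by linarith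
  qed
  define x where "x = (1 / norm (z t)) *\<^sub>R z t"
  have n: "norm x = 1"
    using \<open>z t \<noteq> 0\<close> by (simp add: x_def)
  have "G x = 0"
    unfolding x_def G_scale using t by simp
  then have "(norm (T x))\<^sup>2 = c"
    using n by (simp add: G_def)
  moreover have "\<forall>w\<in>W. cinner x w = 0"
    using p q by (simp add: x_def z_def cinner.add_left cinner.scaleR_left)
  ultimately show ?thesis
    using n by blast
qed

text \<open>If the values \<open>\<parallel>T x\<parallel>\<^sup>2\<close> on unit vectors accumulate weakly at two different levels, one can
  choose orthonormal vectors with orthogonal images realising a strictly decreasing sequence of
  values. The infimum over their closed span is not attained.\<close>

lemma AM_operators_no_gap:
  fixes T :: "'a::chilbert_space \<Rightarrow> 'b::chilbert_space"
  assumes AM: "T \<in> AM_operators"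
    and adj: "\<And>x y. cinner (T x) y = cinner x (S y)"
    and u: "weakly_null u" "\<And>n. norm (u n) = 1" "\<forall>\<^sub>F n in sequentially. (norm (T (u n)))\<^sup>2 \<le> a"
    and v: "weakly_null v" "\<And>n. norm (v n) = 1" "\<forall>\<^sub>F n in sequentially. b \<le> (norm (T (v n)))\<^sup>2"
    and "a < b"
  shows False
proof -
  have T: "bounded_clinear T"
    using AM by (simp add: AM_operators_def)
  interpret T: bounded_linear T
    using T by (rule bounded_clinear_imp_bounded_linear)
  have "a \<ge> 0"
  proof -
    obtain n where "(norm (T (u n)))\<^sup>2 \<le> a"
      using eventually_happens[OF u(3)] by auto
    then show ?thesis
      using zero_le_power2 order_trans by blast
  qed
  \<comment> \<open>Strictly decreasing levels with limit \<open>a\<close>. The summand 2 keeps even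
    \<open>c 0\<close> strictly below \<open>b\<close>.\<close>
  define c where "c k = a + (b - a) / (real k + 2)" for k :: nat
  have c: "a < c k" "c k < b" for k
  proof -
    have "(b - a) / (real k + 2) < (b - a) / 1"
      using \<open>a < b\<close> by (intro divide_strict_left_mono) auto
    moreover have "0 < (b - a) / (real k + 2)"
      using \<open>a < b\<close> by (intro divide_pos_pos) auto
    ultimately show "a < c k" "c k < b"
      by (simp_all add: c_def)
  qed
  have "(\<lambda>k. a + (b - a) / real (k + 2)) \<longlonglongrightarrow> a + 0"
    by (intro tendsto_add tendsto_const LIMSEQ_ignore_initial_segment[OF lim_const_over_n])
  then have c_lim: "c \<longlonglongrightarrow> a"
    by (simp add: c_def[abs_def] add.commute)
  have step: "\<exists>x. norm x = 1 \<and> (norm (T x))\<^sup>2 = c k \<and> (\<forall>w\<in>W. cinner x w = 0)"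
    if W: "finite W" for k W
  proof -
    have u': "\<forall>\<^sub>F n in sequentially. 1 * (norm (T (u n)))\<^sup>2 \<le> 1 * a"
      and v': "\<forall>\<^sub>F n in sequentially. (-1) * (norm (T (v n)))\<^sup>2 \<le> (-1) * b"
      using u v by simp_all
    obtain p where "\<forall>w\<in>W. cinner p w = 0" "(norm (T p))\<^sup>2 < c k * (norm p)\<^sup>2"
      using weakly_null_perturb_le[OF T u(1,2) W u', of "c k"] c[of k] by auto
    moreover obtain q where "\<forall>w\<in>W. cinner q w = 0" "c k * (norm q)\<^sup>2 < (norm (T q))\<^sup>2"
      using weakly_null_perturb_le[OF T v(1,2) W v', of "c k"] c[of k] by auto
    moreover have "0 \<le> c k"
      using c(1)[of k] \<open>a \<ge> 0\<close> by linarith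
    ultimately show ?thesis
      using T by (intro exists_unit_with_value)
  qed
  \<comment> \<open>Through the adjoint, orthogonality to \<open>S (T (f k))\<close> is
    orthogonality of the images. Each stage imposes finitely many constraints, and since the levels
    are hit exactly, the quadratic form becomes diagonal on the span.\<close>
  define P where "P f n y \<longleftrightarrow> norm y = 1 \<and> (norm (T y))\<^sup>2 = c n \<and>
    (\<forall>k<n. cinner y (f k) = 0 \<and> cinner y (S (T (f k))) = 0)" for f :: "nat \<Rightarrow> 'a" and n y
  have "\<exists>x. \<forall>n. P x n (x n)"
  proof (rule dependent_wf_choice[OF wf_less_than])
    show "P f n y = P g n y" if "\<And>z. (z, n) \<in> less_than \<Longrightarrow> f z = g z" for f g n y
      using that by (auto simp: P_def)
    show "\<exists>y. P f n y" for n f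
      using step[of "f ` {..<n} \<union> (S \<circ> T \<circ> f) ` {..<n}" n] by (auto simp: P_def)
  qed
  then obtain x where "\<And>n. P x n (x n)" by blast
  then have x: "norm (x n) = 1" "(norm (T (x n)))\<^sup>2 = c n"
    and orth: "k < n \<Longrightarrow> cinner (x n) (x k) = 0" "k < n \<Longrightarrow> cinner (T (x n)) (T (x k)) = 0" for n k
    by (auto simp: P_def adj)
  have o: "orthonormal x"
    unfolding orthonormal_def
  proof (intro allI)
    fix i j :: nat
    consider "i < j" | "i = j" | "j < i" by linarith
    then show "cinner (x i) (x j) = (if i = j then 1 else 0)"
    proof cases
      case 1
      then show ?thesis using orth(1)[OF 1] cinner_commute[of "x i" "x j"] by simp
    qed (auto simp: orth cinner_self x)
  qed
  have To: "cinner (T (x i)) (T (x j)) = 0" if "i \<noteq> j" for i j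
    using that orth(2)[of i j] orth(2)[of j i] cinner_commute[of "T (x i)" "T (x j)"]
    by (metis complex_cnj_zero nat_neq_iff)
  define M where "M = closure (complex_vector.span (range x))"
  have subM: "complex_vector.span (range x) \<subseteq> M"
    unfolding M_def by (rule closure_subset)
  have xM: "x k \<in> M" for k
    by (intro subsetD[OF subM] complex_vector.span_base rangeI)
  have M_sub: "complex_vector.subspace M"
    unfolding M_def by (intro complex_subspace_closure complex_vector.subspace_span)
  have "M \<noteq> {0}"
    using xM[of 0] x(1)[of 0] by auto
  then have "minimum_attaining M T"
    using AM M_sub unfolding AM_operators_def M_def by auto
  then obtain y where y: "y \<in> M" "norm y = 1" "norm (T y) = min_modulus M T"
    unfolding minimum_attaining_def by blast
  have "norm (T y) \<le> norm (T (x k))" for k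
    unfolding y(3) min_modulus_def
    by (rule cINF_lower) (auto intro!: bdd_belowI[of _ 0] xM x)
  then have "(norm (T y))\<^sup>2 \<le> c k" for k
    unfolding x(2)[symmetric] by (intro power_mono) auto
  then have Ty: "(norm (T y))\<^sup>2 \<le> a"
    by (intro LIMSEQ_le_const[OF c_lim]) auto
  \<comment> \<open>On the span the right-hand side is the sum of the nonnegative terms
    \<open>(c k - a) * |y_k|^2\<close>, hence at least each single term; continuity extends this to
    the closure.\<close>
  have "(c j - a) * (cmod (cinner y (x j)))\<^sup>2 \<le> (norm (T y))\<^sup>2 - a * (norm y)\<^sup>2" for j
  proof -
    have "M \<subseteq> {y. (c j - a) * (cmod (cinner y (x j)))\<^sup>2 \<le> (norm (T y))\<^sup>2 - a * (norm y)\<^sup>2}"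
      unfolding M_def
    proof (rule closure_minimal)
      show "closed {y. (c j - a) * (cmod (cinner y (x j)))\<^sup>2 \<le> (norm (T y))\<^sup>2 - a * (norm y)\<^sup>2}"
        by (intro closed_Collect_le continuous_intros T.continuous_on cinner.continuous_on)
      show "complex_vector.span (range x)
        \<subseteq> {y. (c j - a) * (cmod (cinner y (x j)))\<^sup>2 \<le> (norm (T y))\<^sup>2 - a * (norm y)\<^sup>2}"
      proof safe
        fix y assume "y \<in> complex_vector.span (range x)"
        then obtain n where n: "y = (\<Sum>k<n. cinner y (x k) *\<^sub>C x k)"
          using span_orthonormal_sum[OF o] by blast
        define \<alpha> where "\<alpha> k = cinner y (x k)" for k
        have y_eq: "y = (\<Sum>k<n. \<alpha> k *\<^sub>C x k)"
          unfolding \<alpha>_def by (rule n)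
        have ny: "(norm y)\<^sup>2 = (\<Sum>k<n. (cmod (\<alpha> k))\<^sup>2)"
          unfolding y_eq by (rule norm_orthonormal_sum[OF o]) simp
        have "T y = (\<Sum>k<n. \<alpha> k *\<^sub>C T (x k))"
          by (simp add: y_eq T.sum bounded_clinear_scaleC[OF T])
        then have "(norm (T y))\<^sup>2 = (\<Sum>k<n. (cmod (\<alpha> k))\<^sup>2 * c k)"
          by (simp add: norm_orthogonal_sum To x)
        then have eq: "(norm (T y))\<^sup>2 - a * (norm y)\<^sup>2 = (\<Sum>k<n. (c k - a) * (cmod (\<alpha> k))\<^sup>2)"
          by (simp add: ny sum_distrib_left sum_subtractf algebra_simps)
        show "(c j - a) * (cmod (cinner y (x j)))\<^sup>2 \<le> (norm (T y))\<^sup>2 - a * (norm y)\<^sup>2"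
        proof (cases "j < n")
          case True
          have "(c j - a) * (cmod (\<alpha> j))\<^sup>2 \<le> (\<Sum>k<n. (c k - a) * (cmod (\<alpha> k))\<^sup>2)"
            using True c(1) by (intro member_le_sum) (auto simp: less_imp_le)
          then show ?thesis
            by (simp add: eq \<alpha>_def)
        next
          case False
          have "cinner y (x j) = (\<Sum>k<n. \<alpha> k * cinner (x k) (x j))"
            by (subst y_eq) (simp add: cinner.sum_left cinner_scaleC_left)
          also have "\<dots> = 0"
            using False by (intro sum.neutral) (auto simp: orthonormal_cinner[OF o])
          finally show ?thesis
            using c(1) by (simp add: eq sum_nonneg less_imp_le)
        qed
      qed
    qed
    then show ?thesis
      using y(1) by blast
  qed
  then have le0: "(c j - a) * (cmod (cinner y (x j)))\<^sup>2 \<le> 0" for j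
    by (rule order_trans) (use Ty y(2) in simp)
  \<comment> \<open>The excess of \<open>y\<close> over the level \<open>a\<close> is at most 0
    while \<open>c j > a\<close>, so all coefficients of \<open>y\<close> vanish. Then
    \<open>y\<close> is orthogonal to the closed span that contains it.\<close>
  have yx: "cinner y (x j) = 0" for j
    using c(1)[of j] le0[of j] by (simp add: mult_le_0_iff not_le)
  have "M \<subseteq> {z. cinner y z = 0}"
    unfolding M_def
  proof (rule closure_minimal)
    show "complex_vector.span (range x) \<subseteq> {z. cinner y z = 0}"
    proof (rule complex_vector.span_minimal)
      show "complex_vector.subspace {z. cinner y z = 0}"
        by (rule complex_vector.subspaceI) (auto simp: cinner.zero_right cinner_add_right cinner_scaleC_right)
    qed (auto simp: yx)
    show "closed {z. cinner y z = 0}"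
      by (intro closed_Collect_eq continuous_intros cinner.continuous_on)
  qed
  then have "cinner y y = 0"
    using y(1) by blast
  then show False
    using y(2) by (simp add: cinner_self)
qed

section \<open>Compact perturbations\<close>

text \<open>Minimising \<open>norm (T x)\<close> on unit vectors means maximising
  \<open>norm (L x)\<close>. Compactness yields a maximising sequence with convergent images, and
  the parallelogram law then makes the sequence itself Cauchy, so weak compactness of the ball is
  avoided.\<close>

lemma AM_operators_if_compact_defect:
  fixes T :: "'a::chilbert_space \<Rightarrow> 'b::chilbert_space" and L :: "'a \<Rightarrow> 'c::complex_inner"
  assumes T: "bounded_clinear T" and L: "bounded_linear L" "compact (closure (L ` cball 0 1))"
    and defect: "\<And>x. (norm (T x))\<^sup>2 = \<beta> * (norm x)\<^sup>2 - (norm (L x))\<^sup>2"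
  shows "T \<in> AM_operators"
  unfolding AM_operators_def
proof (intro CollectI conjI T allI impI)
  interpret T: bounded_linear T
    using T by (rule bounded_clinear_imp_bounded_linear)
  interpret L: bounded_linear L by (rule L)
  fix M :: "'a set"
  assume M: "complex_vector.subspace M \<and> closed M \<and> M \<noteq> {0}"
  then have sM: "complex_vector.subspace M" and "closed M" by auto
  have scM: "r *\<^sub>R x \<in> M" if "x \<in> M" for x r
    unfolding scaleR_scaleC using that by (rule complex_vector.subspace_scale[OF sM])
  define X where "X = {x \<in> M. norm x = 1}"
  obtain m where m: "m \<in> M" "m \<noteq> 0"
    using M complex_vector.subspace_0[OF sM] by blast
  have "(1 / norm m) *\<^sub>R m \<in> X"
    using m scM by (simp add: X_def)
  then obtain x0 where x0: "x0 \<in> X" by blast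
  then have "X \<noteq> {}" by blast
  obtain K where K: "\<And>x. norm (L x) \<le> norm x * K"
    using L.bounded by blast
  have bdd: "bdd_above ((\<lambda>x. norm (L x)) ` X)"
    by (rule bdd_aboveI[of _ K]) (use K in \<open>auto simp: X_def\<close>, metis mult_1)
  define s where "s = (SUP x\<in>X. norm (L x))"
  have le_s: "norm (L x) \<le> s" if "x \<in> X" for x
    unfolding s_def using that by (intro cSUP_upper bdd)
  have le_s': "norm (L x) \<le> s * norm x" if "x \<in> M" for x
  proof (cases "x = 0")
    case False
    then have "(1 / norm x) *\<^sub>R x \<in> X"
      using that scM by (simp add: X_def)
    from le_s[OF this] show ?thesis
      using False by (simp add: L.scaleR field_simps)
  qed (simp add: L.zero)
  have "s \<ge> 0"
    using le_s[OF x0] norm_ge_zero[of "L x0"] by linarith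
  have "\<exists>x\<in>X. norm (L x) = s"
  proof (cases "s = 0")
    case True
    then show ?thesis
      using le_s[OF x0] x0 by (intro bexI[of _ x0]) auto
  next
    case False
    with \<open>s \<ge> 0\<close> have "s > 0" by simp
    have "\<exists>x\<in>X. s - 1 / real (Suc n) < norm (L x)" for n
      using less_cSUP_iff[OF \<open>X \<noteq> {}\<close> bdd, of "s - 1 / real (Suc n)"] by (simp add: s_def)
    then obtain x where x: "\<And>n. x n \<in> X" "\<And>n. s - 1 / real (Suc n) < norm (L (x n))"
      by metis
    have "(\<lambda>n. s - 1 / real (Suc n)) \<longlonglongrightarrow> s - 0"
      by (intro tendsto_intros LIMSEQ_Suc[OF lim_1_over_n])
    then have lim0: "(\<lambda>n. s - 1 / real (Suc n)) \<longlonglongrightarrow> s"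
      by simp
    have lim_s: "(\<lambda>n. norm (L (x n))) \<longlonglongrightarrow> s"
    proof (rule tendsto_sandwich[OF _ _ lim0 tendsto_const])
      show "\<forall>\<^sub>F n in sequentially. s - 1 / real (Suc n) \<le> norm (L (x n))"
        by (intro always_eventually allI less_imp_le x(2))
      show "\<forall>\<^sub>F n in sequentially. norm (L (x n)) \<le> s"
        by (intro always_eventually allI le_s x(1))
    qed
    have "L (x n) \<in> L ` cball 0 1" for n
      using x(1)[of n] by (intro imageI) (simp add: X_def)
    then have "L (x n) \<in> closure (L ` cball 0 1)" for n
      using closure_subset by (rule subsetD[rotated])
    then obtain l r where r: "strict_mono r" "(\<lambda>n. L (x (r n))) \<longlonglongrightarrow> l"
      using L(2)[unfolded compact_def, rule_format, of "\<lambda>n. L (x n)"] by (auto simp: o_def)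
    define y where "y n = x (r n)" for n
    have y: "y n \<in> M" "norm (y n) = 1" for n
      using x(1)[of "r n"] by (auto simp: y_def X_def)
    have lim_s': "(\<lambda>n. norm (L (y n))) \<longlonglongrightarrow> s"
      unfolding y_def using LIMSEQ_subseq_LIMSEQ[OF lim_s r(1)] by (simp add: o_def)
    have "Cauchy y"
    proof (rule CauchyI)
      fix e :: real assume "e > 0"
      \<comment> \<open>Chosen so that the bound obtained below,
        \<open>4 * d + (s * e / 2)^2\<close>, equals three quarters of
        \<open>(s * e)^2\<close>.\<close>
      define d where "d = (s * e)\<^sup>2 / 8"
      have "d > 0" using \<open>e > 0\<close> \<open>s > 0\<close> by (simp add: d_def)
      have "(\<lambda>n. s\<^sup>2 - (norm (L (y n)))\<^sup>2) \<longlonglongrightarrow> s\<^sup>2 - s\<^sup>2"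
        by (intro tendsto_intros lim_s')
      then have "\<forall>\<^sub>F n in sequentially. s\<^sup>2 - (norm (L (y n)))\<^sup>2 < d"
        using \<open>d > 0\<close> by (intro order_tendstoD) auto
      then obtain N1 where N1: "\<And>n. n \<ge> N1 \<Longrightarrow> s\<^sup>2 - (norm (L (y n)))\<^sup>2 < d"
        unfolding eventually_sequentially by blast
      have "Cauchy (\<lambda>n. L (y n))"
        unfolding y_def using r(2) by (rule LIMSEQ_imp_Cauchy)
      then obtain N2 where N2: "\<And>m n. m \<ge> N2 \<Longrightarrow> n \<ge> N2 \<Longrightarrow> norm (L (y m) - L (y n)) < s * e / 2"
        using CauchyD[of "\<lambda>n. L (y n)" "s * e / 2"] \<open>e > 0\<close> \<open>s > 0\<close> by auto
      have "norm (y m - y n) < e" if "m \<ge> max N1 N2" "n \<ge> max N1 N2" for m n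
      proof -
        have par: "(norm (a + b))\<^sup>2 + (norm (a - b))\<^sup>2 = 2 * (norm a)\<^sup>2 + 2 * (norm b)\<^sup>2"
          for a b :: "'z::real_inner"
          by (simp add: power2_norm_eq_inner inner_add_left inner_add_right inner_diff_left inner_diff_right)
        \<comment> \<open>The bound by \<open>s\<close> on the sum, which lies in \<open>M\<close>,
          together with the parallelogram law turns near maximality of both vectors into smallness
          of their difference.\<close>
        have "norm (L (y m + y n)) \<le> s * norm (y m + y n)"
          by (intro le_s' complex_vector.subspace_add[OF sM] y)
        then have "(norm (L (y m) + L (y n)))\<^sup>2 \<le> s\<^sup>2 * (norm (y m + y n))\<^sup>2"
          by (metis L.add norm_ge_zero power_mono power_mult_distrib)
        also have "(norm (y m + y n))\<^sup>2 = 4 - (norm (y m - y n))\<^sup>2"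
          using par[of "y m" "y n"] y by simp
        finally have "s\<^sup>2 * (norm (y m - y n))\<^sup>2 \<le> 4 * s\<^sup>2 - (norm (L (y m) + L (y n)))\<^sup>2"
          by (simp add: algebra_simps)
        also have "\<dots> = 2 * (s\<^sup>2 - (norm (L (y m)))\<^sup>2) + 2 * (s\<^sup>2 - (norm (L (y n)))\<^sup>2)
             + (norm (L (y m) - L (y n)))\<^sup>2"
          using par[of "L (y m)" "L (y n)"] by simp
        also have "\<dots> < 2 * d + 2 * d + (s * e / 2)\<^sup>2"
          using that N1[of m] N1[of n] N2[of m n]
          by (intro add_strict_mono power_strict_mono) auto
        also have "\<dots> \<le> s\<^sup>2 * e\<^sup>2"
          using \<open>e > 0\<close> \<open>s > 0\<close> by (simp add: d_def field_simps power2_eq_square)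
        finally have "(norm (y m - y n))\<^sup>2 < e\<^sup>2"
          using \<open>s > 0\<close> by simp
        then show ?thesis
          by (rule power2_less_imp_less) (use \<open>e > 0\<close> in simp)
      qed
      then show "\<exists>N. \<forall>m\<ge>N. \<forall>n\<ge>N. norm (y m - y n) < e" by blast
    qed
    then obtain z where z: "y \<longlonglongrightarrow> z"
      using Cauchy_convergent unfolding convergent_def by blast
    have "z \<in> M"
      by (rule closed_sequentially[OF \<open>closed M\<close> _ z]) (simp add: y)
    moreover have "norm z = 1"
      using tendsto_norm[OF z] by (simp add: y LIMSEQ_const_iff)
    moreover have "norm (L z) = s"
      using LIMSEQ_unique[OF tendsto_norm[OF L.tendsto[OF z]] lim_s'] .
    ultimately show ?thesis by (auto simp: X_def)
  qed
  then obtain x where x: "x \<in> X" "norm (L x) = s" by blast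
  have "norm (T x) \<le> norm (T z)" if "z \<in> X" for z
  proof -
    have "(norm (T x))\<^sup>2 \<le> (norm (T z))\<^sup>2"
      using that x(1) power_mono[OF le_s[OF that] norm_ge_zero, of 2]
      by (simp add: defect x(2) X_def)
    then show ?thesis by (rule power2_le_imp_le) simp
  qed
  then have "norm (T x) = min_modulus M T"
    unfolding min_modulus_def X_def[symmetric]
    by (intro antisym cINF_greatest \<open>X \<noteq> {}\<close> cINF_lower[OF _ x(1)]) (auto intro!: bdd_belowI[of _ 0])
  then show "minimum_attaining M T"
    unfolding minimum_attaining_def using x(1) by (auto simp: X_def)
qed

section \<open>Compactness criteria, and compact operators that fail to be Fredholm\<close>

lemma compact_closure_if_approx:
  fixes A :: "'a::complete_space set"
  assumes "\<And>e. e > 0 \<Longrightarrow> \<exists>K. compact K \<and> A \<subseteq> (\<Union>x\<in>K. ball x e)"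
  shows "compact (closure A)"
  unfolding compact_eq_totally_bounded
proof (intro conjI allI impI)
  show "uniform_space_class.complete (closure A)"
    by (simp add: complete_eq_closed)
  fix e :: real assume "e > 0"
  then obtain K where K: "compact K" "A \<subseteq> (\<Union>x\<in>K. ball x (e / 3))"
    using assms[of "e / 3"] by auto
  have "\<exists>k. finite k \<and> K \<subseteq> (\<Union>x\<in>k. ball x (e / 3))"
    using K(1) \<open>e > 0\<close> unfolding compact_eq_totally_bounded by simp
  then obtain k where k: "finite k" "K \<subseteq> (\<Union>x\<in>k. ball x (e / 3))" by blast
  \<comment> \<open>Closed balls of radius \<open>2 * e / 3\<close> have a closed finite union,
    which therefore contains the closure and still fits into open balls of radius
    \<open>e\<close>.\<close>
  have "A \<subseteq> (\<Union>x\<in>k. cball x (2 * e / 3))"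
  proof
    fix a assume "a \<in> A"
    then obtain x where "x \<in> K" "dist x a < e / 3" using K(2) by auto
    moreover from this obtain y where "y \<in> k" "dist y x < e / 3" using k(2) by auto
    ultimately show "a \<in> (\<Union>x\<in>k. cball x (2 * e / 3))"
      using dist_triangle[of y a x] by (auto intro!: bexI[of _ y])
  qed
  then have "closure A \<subseteq> (\<Union>x\<in>k. cball x (2 * e / 3))"
    using k(1) by (intro closure_minimal closed_UN) auto
  also have "\<dots> \<subseteq> (\<Union>x\<in>k. ball x e)"
    using \<open>e > 0\<close> by (intro UN_mono) auto
  finally show "\<exists>k. finite k \<and> closure A \<subseteq> (\<Union>x\<in>k. ball x e)"
    using k(1) by blast
qed

text \<open>A Minkowski sum of images of closed discs: this is compactness in finite dimension
  without a choice of coordinates.\<close>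

lemma compact_bounded_combinations:
  fixes f :: "'i \<Rightarrow> 'a::complex_inner"
  assumes "finite B"
  shows "compact {\<Sum>b\<in>B. t b *\<^sub>C f b | t. \<forall>b\<in>B. cmod (t b) \<le> m}"
  using assms
proof (induction B rule: finite_induct)
  case (insert b B)
  have "compact ((\<lambda>t. t *\<^sub>C f b) ` cball 0 m)"
    by (intro compact_continuous_image scaleC.continuous_on continuous_intros compact_cball)
  then have "compact {x + y | x y. x \<in> {\<Sum>b\<in>B. t b *\<^sub>C f b | t. \<forall>b\<in>B. cmod (t b) \<le> m} \<and>
      y \<in> (\<lambda>t. t *\<^sub>C f b) ` cball 0 m}"
    by (intro compact_sums insert.IH)
  also have "\<dots> = {\<Sum>b\<in>insert b B. t b *\<^sub>C f b | t. \<forall>b\<in>insert b B. cmod (t b) \<le> m}" (is "?l = ?r")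
  proof (intro equalityI subsetI)
    fix z assume "z \<in> ?l"
    then obtain t c where t: "z = (\<Sum>b\<in>B. t b *\<^sub>C f b) + c *\<^sub>C f b" "\<forall>b\<in>B. cmod (t b) \<le> m" "cmod c \<le> m"
      by auto
    have "(\<Sum>k\<in>B. (t(b := c)) k *\<^sub>C f k) = (\<Sum>k\<in>B. t k *\<^sub>C f k)"
      using insert.hyps by (intro sum.cong) auto
    then have "z = (\<Sum>k\<in>insert b B. (t(b := c)) k *\<^sub>C f k)"
      using insert.hyps t by (simp add: add.commute del: fun_upd_apply) simp
    moreover have "\<forall>k\<in>insert b B. cmod ((t(b := c)) k) \<le> m"
      using t by auto
    ultimately show "z \<in> ?r" by blast
  next
    fix z assume "z \<in> ?r"
    then obtain t where t: "z = (\<Sum>k\<in>B. t k *\<^sub>C f k) + t b *\<^sub>C f b" "\<forall>k\<in>insert b B. cmod (t k) \<le> m"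
      using insert.hyps by (auto simp: add.commute)
    have "(\<Sum>k\<in>B. t k *\<^sub>C f k) \<in> {\<Sum>b\<in>B. t b *\<^sub>C f b | t. \<forall>b\<in>B. cmod (t b) \<le> m}"
      using t(2) by blast
    moreover have "t b *\<^sub>C f b \<in> (\<lambda>t. t *\<^sub>C f b) ` cball 0 m"
      using t(2) by (intro imageI) simp
    ultimately show "z \<in> ?l"
      unfolding t(1) by blast
  qed
  finally show ?case .
qed simp

text \<open>\<open>L\<close> has finite rank on the span of the first \<open>N\<close> vectors and
  is small on the orthogonal complement, so the image of a ball lies in arbitrarily thin
  neighbourhoods of compact sets. All radii are covered because the Baire argument below needs
  them.\<close>

lemma compact_closure_image_if_tail_small:
  fixes e :: "nat \<Rightarrow> 'a::complex_inner" and L :: "'a \<Rightarrow> 'b::chilbert_space"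
  assumes e: "orthonormal e" and L: "bounded_clinear L"
    and tail: "\<And>\<epsilon>. \<epsilon> > 0 \<Longrightarrow> \<exists>N. \<forall>x. (\<forall>j<N. cinner x (e j) = 0) \<longrightarrow> norm (L x) \<le> \<epsilon> * norm x"
  shows "compact (closure (L ` cball 0 m))"
proof (rule compact_closure_if_approx)
  interpret L: bounded_linear L
    using L by (rule bounded_clinear_imp_bounded_linear)
  fix \<epsilon> :: real assume "\<epsilon> > 0"
  define \<delta> where "\<delta> = \<epsilon> / (\<bar>m\<bar> + 1)"
  have "\<delta> > 0" using \<open>\<epsilon> > 0\<close> by (simp add: \<delta>_def)
  then obtain N where N: "\<And>x. (\<forall>j<N. cinner x (e j) = 0) \<Longrightarrow> norm (L x) \<le> \<delta> * norm x"
    using tail by blast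
  define K where "K = {\<Sum>j<N. t j *\<^sub>C L (e j) | t. \<forall>j\<in>{..<N}. cmod (t j) \<le> m}"
  have "L ` cball 0 m \<subseteq> (\<Union>x\<in>K. ball x \<epsilon>)"
  proof safe
    fix x :: 'a assume "x \<in> cball 0 m"
    then have x: "norm x \<le> m" by simp
    define y where "y = (\<Sum>j<N. cinner x (e j) *\<^sub>C e j)"
    have "L y = (\<Sum>j<N. cinner x (e j) *\<^sub>C L (e j))"
      by (simp add: y_def L.sum bounded_clinear_scaleC[OF L])
    moreover have "cmod (cinner x (e j)) \<le> m" for j
      using norm_cinner_le[of x "e j"] x by (simp add: orthonormal_norm[OF e])
    ultimately have "L y \<in> K" by (auto simp: K_def)
    have orth: "cinner (x - y) (e j) = 0" if "j < N" for j
      using that by (simp add: y_def cinner.diff_left cinner_orthonormal_sum[OF e])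
    have "cinner (x - y) (\<Sum>j<N. cinner x (e j) *\<^sub>C e j) = 0"
      unfolding cinner.sum_right using orth by (intro sum.neutral) (simp add: cinner_scaleC_right)
    then have "cinner (x - y) y = 0"
      by (simp only: y_def)
    then have "(norm x)\<^sup>2 = (norm (x - y))\<^sup>2 + (norm y)\<^sup>2"
      using pythagoras[of "x - y" y] by simp
    then have "(norm (x - y))\<^sup>2 \<le> (norm x)\<^sup>2" by simp
    then have "norm (x - y) \<le> norm x" by (rule power2_le_imp_le) simp
    then have "norm (x - y) \<le> \<bar>m\<bar>" using x by linarith
    have "norm (L (x - y)) \<le> \<delta> * norm (x - y)"
      using orth by (intro N) simp
    also have "\<dots> \<le> \<delta> * \<bar>m\<bar>"
      using \<open>\<delta> > 0\<close> \<open>norm (x - y) \<le> \<bar>m\<bar>\<close> by (intro mult_left_mono) auto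
    also have "\<dots> < \<epsilon>"
      using \<open>\<epsilon> > 0\<close> by (simp add: \<delta>_def field_simps)
    finally have "dist (L y) (L x) < \<epsilon>"
      by (simp add: dist_commute dist_norm L.diff[symmetric])
    with \<open>L y \<in> K\<close> show "L x \<in> (\<Union>x\<in>K. ball x \<epsilon>)" by auto
  qed
  moreover have "compact K"
    unfolding K_def by (rule compact_bounded_combinations) simp
  ultimately show "\<exists>K. compact K \<and> L ` cball 0 m \<subseteq> (\<Union>x\<in>K. ball x \<epsilon>)" by blast
qed

text \<open>If the range had finite codimension, the space would be a countable union of compact
  sets, and by Baire's theorem one of them would contain a ball. A ball of radius \<open>r\<close>
  contains a sequence with mutual distances \<open>r * sqrt 2\<close>, which has no convergent
  subsequence.\<close>

lemma not_fredholm_if_compact: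
  fixes e :: "nat \<Rightarrow> 'a::chilbert_space" and L :: "'a \<Rightarrow> 'a"
  assumes e: "orthonormal e" and L: "bounded_clinear L"
    and cpt: "\<And>m. compact (closure (L ` cball 0 m))"
  shows "\<not> fredholm L"
proof
  assume "fredholm L"
  then obtain B where B: "finite B" "complex_vector.span (range L \<union> B) = UNIV"
    unfolding fredholm_def by blast
  interpret L: bounded_linear L
    using L by (rule bounded_clinear_imp_bounded_linear)
  have range: "complex_vector.span (range L) = range L"
    unfolding complex_vector.span_eq_iff
  proof (rule complex_vector.subspaceI)
    show "0 \<in> range L"
      using L.zero by (metis rangeI)
  qed (auto simp: L.add[symmetric] bounded_clinear_scaleC[OF L, symmetric])
  define K where "K m = {x + y | x y. x \<in> closure (L ` cball 0 m) \<and>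
      y \<in> {\<Sum>b\<in>B. t b *\<^sub>C b | t. \<forall>b\<in>B. cmod (t b) \<le> m}}" for m
  have K: "compact (K m)" for m
    unfolding K_def by (intro compact_sums cpt compact_bounded_combinations B)
  have cover: "(\<Union>m. K (real m)) = UNIV"
  proof (intro equalityI subsetI UNIV_I)
    fix z :: 'a
    have "z \<in> complex_vector.span (range L \<union> B)"
      by (simp add: B)
    then obtain x t where z: "z = L x + (\<Sum>b\<in>B. t b *\<^sub>C b)"
      unfolding complex_vector.span_Un range complex_vector.span_finite[OF B(1)] by auto
    obtain m where m: "real m \<ge> Max (insert (norm x) ((\<lambda>b. cmod (t b)) ` B))"
      using real_arch_simple by blast
    then have m': "norm x \<le> real m" "\<forall>b\<in>B. cmod (t b) \<le> real m"
      using B(1) by (auto simp: Max_le_iff)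
    then have "L x \<in> closure (L ` cball 0 (real m))"
      by (intro subsetD[OF closure_subset] imageI) simp
    with m' have "z \<in> K (real m)"
      unfolding K_def z by blast
    then show "z \<in> (\<Union>m. K (real m))" by blast
  qed
  have "\<exists>m. interior (K (real m)) \<noteq> {}"
  proof (rule ccontr)
    assume "\<not> ?thesis"
    then have "euclidean interior_of \<Union>(range (\<lambda>m. K (real m))) = {}"
      using K
      by (intro Met_TC.metric_Baire_category_alt[unfolded mtopology_is_euclidean])
        (auto simp: compact_imp_closed mcomplete_iff_complete complete_eq_closed)
    then show False by (simp add: cover)
  qed
  then obtain m x where "x \<in> interior (K (real m))" by blast
  then obtain r where r: "r > 0" "cball x r \<subseteq> K (real m)"
    by (meson mem_interior_cball)
  define f where "f n = x + r *\<^sub>R e n" for n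
  have "f n \<in> K (real m)" for n
    using r by (intro subsetD[OF r(2)]) (simp add: f_def dist_norm orthonormal_norm[OF e])
  then obtain l s where "strict_mono s" "(f \<circ> s) \<longlonglongrightarrow> l"
    using K[of "real m", unfolded compact_def, rule_format, of f] by auto
  then have "Cauchy (f \<circ> s)"
    using LIMSEQ_imp_Cauchy by blast
  then obtain N where N: "\<And>i j. i \<ge> N \<Longrightarrow> j \<ge> N \<Longrightarrow> dist (f (s i)) (f (s j)) < r"
    using r(1) unfolding Cauchy_def o_def by blast
  have "dist (f (s N)) (f (s (Suc N))) = r * dist (e (s N)) (e (s (Suc N)))"
    using r(1) by (simp add: f_def dist_norm flip: scaleR_diff_right)
  also have "dist (e (s N)) (e (s (Suc N))) = sqrt 2"
    using \<open>strict_mono s\<close> by (intro orthonormal_dist e) (simp add: strict_mono_eq)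
  finally have "r * sqrt 2 < r"
    using N[of N "Suc N"] by simp
  then show False
    using r(1) by simp
qed

section \<open>Square roots of positive operators\<close>

definition selfadjoint :: "('a::complex_inner \<Rightarrow> 'a) \<Rightarrow> bool" where
  "selfadjoint A \<longleftrightarrow> (\<forall>x y. cinner (A x) y = cinner x (A y))"

lemma selfadjointD: "selfadjoint A \<Longrightarrow> cinner (A x) y = cinner x (A y)"
  by (simp add: selfadjoint_def)

lemma selfadjoint_real:
  assumes "selfadjoint A"
  shows "cinner (A x) x = of_real (Re (cinner (A x) x))"
proof -
  have "cnj (cinner (A x) x) = cinner (A x) x"
    using selfadjointD[OF assms, of x x] by (metis cinner_commute)
  then have "Im (cinner (A x) x) = 0"
    by (simp add: complex_eq_iff)
  then show ?thesis
    by (simp add: complex_eq_iff)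
qed

text \<open>Polarisation: reality of the quadratic form at \<open>x + y\<close> settles the
  imaginary part of the identity, reality at \<open>x + i y\<close> the real part.\<close>

lemma positive_operator_selfadjoint:
  assumes "positive_operator A"
  shows "selfadjoint A"
proof -
  have A: "bounded_clinear A" and r: "Im (cinner (A x) x) = 0" for x
    using assms by (auto simp: positive_operator_def complex_nonneg_Reals_iff)
  have "cinner (A x) y = cinner x (A y)" for x y
  proof -
    have "Im (cinner (A (x + y)) (x + y)) = 0" "Im (cinner (A (x + \<i> *\<^sub>C y)) (x + \<i> *\<^sub>C y)) = 0"
      by (rule r)+
    then have "Im (cinner (A x) y) = - Im (cinner (A y) x)" "Re (cinner (A x) y) = Re (cinner (A y) x)"
      using r[of x] r[of y]
      by (simp_all add: bounded_clinear_add[OF A] bounded_clinear_scaleC[OF A] cinner_add_left cinner_add_right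
          cinner_scaleC_left cinner_scaleC_right)
    then have "cinner (A x) y = cnj (cinner (A y) x)"
      by (simp add: complex_eq_iff)
    then show ?thesis
      by (metis cinner_commute)
  qed
  then show ?thesis
    by (simp add: selfadjoint_def)
qed

lemma positive_operator_Re_nonneg: "positive_operator A \<Longrightarrow> 0 \<le> Re (cinner (A x) x)"
  by (auto simp: positive_operator_def complex_nonneg_Reals_iff)

lemma positive_operatorI:
  assumes "bounded_clinear A" "selfadjoint A" "\<And>x. 0 \<le> Re (cinner (A x) x)"
  shows "positive_operator A"
  unfolding positive_operator_def
proof (intro conjI allI assms(1))
  fix x
  show "cinner (A x) x \<in> \<real>\<^sub>\<ge>\<^sub>0"
    using assms(3)[of x] by (subst selfadjoint_real[OF assms(2)]) simp
qed

text \<open>This is \<open>A^2 <= k A\<close> for \<open>0 <= A <= k\<close> in the sense of forms.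
  It is positivity of the form at \<open>x - t A x\<close>, where \<open>t = 1 / k\<close> is the
  best parameter.\<close>

lemma positive_operator_norm_square_le:
  assumes A: "bounded_clinear A" "selfadjoint A" and pos: "\<And>x. 0 \<le> Re (cinner (A x) x)"
    and k: "k > 0" "\<And>x. Re (cinner (A x) x) \<le> k * (norm x)\<^sup>2"
  shows "(norm (A x))\<^sup>2 \<le> k * Re (cinner (A x) x)"
proof -
  interpret A: bounded_linear A
    using A(1) by (rule bounded_clinear_imp_bounded_linear)
  define t where "t = 1 / k"
  have "t > 0" using k(1) by (simp add: t_def)
  have "0 \<le> Re (cinner (A (x - t *\<^sub>R A x)) (x - t *\<^sub>R A x))"
    by (rule pos)
  also have "\<dots> = Re (cinner (A x) x) - t * Re (cinner (A (A x)) x) - t * Re (cinner (A x) (A x))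
      + t * t * Re (cinner (A (A x)) (A x))"
    by (simp add: A.diff A.scaleR cinner.diff_left cinner.diff_right cinner.scaleR_left cinner.scaleR_right
        algebra_simps)
  also have "\<dots> = Re (cinner (A x) x) - 2 * t * (norm (A x))\<^sup>2 + t * t * Re (cinner (A (A x)) (A x))"
    by (simp add: selfadjointD[OF A(2), of "A x" x] cinner_self)
  also have "\<dots> \<le> Re (cinner (A x) x) - 2 * t * (norm (A x))\<^sup>2 + t * t * (k * (norm (A x))\<^sup>2)"
    using k(2)[of "A x"] \<open>t > 0\<close> by (intro add_left_mono mult_left_mono) auto
  also have "t * t * (k * (norm (A x))\<^sup>2) = t * (norm (A x))\<^sup>2"
    using k(1) by (simp add: t_def)
  finally have "t * (norm (A x))\<^sup>2 \<le> Re (cinner (A x) x)"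
    by simp
  then show ?thesis
    using k(1) by (simp add: t_def field_simps)
qed

text \<open>The iteration \<open>Y \<mapsto> (B + Y\<^sup>2) / 2\<close> started at \<open>0\<close> has limit \<open>1 - sqrt (1 - B)\<close> for a self-adjoint
  contraction \<open>B\<close>. The scalar iteration with \<open>B = 1\<close> dominates it and bounds the increments in norm.\<close>

primrec sqrt_iter :: "('a::complex_inner \<Rightarrow> 'a) \<Rightarrow> nat \<Rightarrow> 'a \<Rightarrow> 'a" where
  "sqrt_iter B 0 = (\<lambda>x. 0)"
| "sqrt_iter B (Suc n) = (\<lambda>x. (1/2) *\<^sub>R (B x + sqrt_iter B n (sqrt_iter B n x)))"

primrec sqrt_iter_bound :: "nat \<Rightarrow> real" where
  "sqrt_iter_bound 0 = 0"
| "sqrt_iter_bound (Suc n) = (1 + (sqrt_iter_bound n)\<^sup>2) / 2"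

lemma sqrt_iter_bound_le: "0 \<le> sqrt_iter_bound n \<and> sqrt_iter_bound n \<le> 1"
  by (induction n) (auto simp: power_le_one)

lemma sqrt_iter_bound_mono: "sqrt_iter_bound n \<le> sqrt_iter_bound (Suc n)"
proof (induction n)
  case (Suc n)
  then have "(sqrt_iter_bound n)\<^sup>2 \<le> (sqrt_iter_bound (Suc n))\<^sup>2"
    using sqrt_iter_bound_le by (intro power_mono) auto
  then show ?case by simp
qed simp

lemma summable_sqrt_iter_bound: "summable (\<lambda>n. sqrt_iter_bound (Suc n) - sqrt_iter_bound n)"
proof -
  have "incseq sqrt_iter_bound"
    using sqrt_iter_bound_mono by (rule incseq_SucI)
  then obtain l where "sqrt_iter_bound \<longlonglongrightarrow> l"
    using incseq_convergent[of sqrt_iter_bound 1] sqrt_iter_bound_le by blast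
  then show ?thesis by (rule telescope_summable)
qed

context
  fixes B :: "'a::chilbert_space \<Rightarrow> 'a"
  assumes B: "bounded_clinear B" "selfadjoint B" and contraction: "\<And>x. norm (B x) \<le> norm x"
begin

lemma sqrt_iter_add: "sqrt_iter B n (x + y) = sqrt_iter B n x + sqrt_iter B n y"
  by (induction n arbitrary: x y) (simp_all add: bounded_clinear_add[OF B(1)] algebra_simps)

lemma sqrt_iter_scaleC: "sqrt_iter B n (c *\<^sub>C x) = c *\<^sub>C sqrt_iter B n x"
  by (induction n arbitrary: x)
    (simp_all add: scaleC.zero_right bounded_clinear_scaleC[OF B(1)] scaleC_add_right scaleC.scaleR_right)

lemma sqrt_iter_diff: "sqrt_iter B n (x - y) = sqrt_iter B n x - sqrt_iter B n y"
  using sqrt_iter_add[of n "x - y" y] by (simp add: algebra_simps)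

lemma sqrt_iter_norm: "norm (sqrt_iter B n x) \<le> sqrt_iter_bound n * norm x"
proof (induction n arbitrary: x)
  case (Suc n)
  have "norm (B x + sqrt_iter B n (sqrt_iter B n x)) \<le> norm x + sqrt_iter_bound n * (sqrt_iter_bound n * norm x)"
    using Suc[of "sqrt_iter B n x"] mult_left_mono[OF Suc[of x], of "sqrt_iter_bound n"] contraction[of x]
      sqrt_iter_bound_le[of n]
    by (intro order_trans[OF norm_triangle_ineq] add_mono) auto
  then show ?case
    by (simp only: sqrt_iter.simps norm_scaleR sqrt_iter_bound.simps) (simp add: power2_eq_square algebra_simps)
qed simp

lemma sqrt_iter_selfadjoint: "cinner (sqrt_iter B n x) y = cinner x (sqrt_iter B n y)"
  by (induction n arbitrary: x y)
    (simp_all add: cinner.zero_left cinner.zero_right cinner_add_left cinner_add_right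
      cinner.scaleR_left cinner.scaleR_right selfadjointD[OF B(2)])

text \<open>Iterates are polynomials in \<open>B\<close>, so they commute with all that commutes
  with \<open>B\<close>. This serves twice: for the iterates among themselves, and in the limit for
  the uniqueness of square roots.\<close>

lemma sqrt_iter_commute:
  assumes "bounded_linear C" "\<And>x. C (B x) = B (C x)"
  shows "C (sqrt_iter B n x) = sqrt_iter B n (C x)"
proof -
  interpret C: bounded_linear C by fact
  show ?thesis
    by (induction n arbitrary: x) (simp_all add: C.zero C.add C.scaleR assms(2))
qed

lemma sqrt_iter_bounded_clinear: "bounded_clinear (sqrt_iter B n)"
  by (rule bounded_clinearI[where K = "sqrt_iter_bound n"])
    (use sqrt_iter_norm in \<open>auto simp: sqrt_iter_add sqrt_iter_scaleC mult.commute\<close>)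

lemma sqrt_iter_commute_iter: "sqrt_iter B m (sqrt_iter B n x) = sqrt_iter B n (sqrt_iter B m x)"
proof -
  have "bounded_linear (sqrt_iter B k)" for k
    using sqrt_iter_bounded_clinear by (rule bounded_clinear_imp_bounded_linear)
  then show ?thesis
    by (rule sqrt_iter_commute)
      (rule sqrt_iter_commute[symmetric, OF bounded_clinear_imp_bounded_linear[OF B(1)] refl])
qed

text \<open>As iterates commute, the difference of two squares factors into sum and difference. The
  scalar sequence obeys the same recursion, so its increments dominate, and those telescope.\<close>

lemma sqrt_iter_increment:
  "norm (sqrt_iter B (Suc n) x - sqrt_iter B n x) \<le> (sqrt_iter_bound (Suc n) - sqrt_iter_bound n) * norm x"
proof (induction n)
  case 0
  show ?case using contraction[of x] by simp
next
  case (Suc n)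
  define d where "d = sqrt_iter B (Suc n) x - sqrt_iter B n x"
  define b where "b = sqrt_iter_bound"
  have "sqrt_iter B (Suc (Suc n)) x - sqrt_iter B (Suc n) x
      = (1/2) *\<^sub>R (sqrt_iter B (Suc n) (sqrt_iter B (Suc n) x) - sqrt_iter B n (sqrt_iter B n x))"
    by (subst (2) sqrt_iter.simps(2), subst sqrt_iter.simps(2))
      (simp add: algebra_simps del: sqrt_iter.simps)
  also have "sqrt_iter B (Suc n) (sqrt_iter B (Suc n) x) - sqrt_iter B n (sqrt_iter B n x)
      = sqrt_iter B (Suc n) d + sqrt_iter B n d"
    by (simp add: d_def sqrt_iter_diff sqrt_iter_commute_iter[of n "Suc n"] del: sqrt_iter.simps)
  also have "norm ((1/2) *\<^sub>R \<dots>) \<le> (1/2) * (b (Suc n) * norm d + b n * norm d)"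
    unfolding norm_scaleR b_def
    by (intro mult_mono order_trans[OF norm_triangle_ineq add_mono] sqrt_iter_norm) auto
  also have "\<dots> = (1/2) * (b (Suc n) + b n) * norm d"
    by (simp add: algebra_simps)
  also have "\<dots> \<le> (1/2) * (b (Suc n) + b n) * ((b (Suc n) - b n) * norm x)"
    using Suc sqrt_iter_bound_le[of n] sqrt_iter_bound_le[of "Suc n"]
    by (intro mult_left_mono) (auto simp: d_def b_def simp del: sqrt_iter.simps sqrt_iter_bound.simps)
  also have "\<dots> = (b (Suc (Suc n)) - b (Suc n)) * norm x"
  proof -
    have "b (Suc (Suc n)) - b (Suc n) = (1/2) * ((b (Suc n))\<^sup>2 - (b n)\<^sup>2)"
      by (simp only: b_def sqrt_iter_bound.simps(2)) (simp add: field_simps)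
    then show ?thesis by (simp only: power2_eq_square) (simp add: algebra_simps)
  qed
  finally show ?case by (simp only: b_def)
qed

lemma sqrt_iter_limit:
  obtains Y where "\<And>x. (\<lambda>n. sqrt_iter B n x) \<longlonglongrightarrow> Y x"
proof -
  have "\<exists>y. (\<lambda>n. sqrt_iter B n x) \<longlonglongrightarrow> y" for x
  proof -
    have "summable (\<lambda>n. sqrt_iter B (Suc n) x - sqrt_iter B n x)"
      by (rule summable_comparison_test'[OF summable_mult2[OF summable_sqrt_iter_bound, of "norm x"], of 0])
        (rule sqrt_iter_increment)
    then have "convergent (\<lambda>n. \<Sum>k<n. sqrt_iter B (Suc k) x - sqrt_iter B k x)"
      by (simp only: summable_iff_convergent)
    then have "convergent (\<lambda>n. sqrt_iter B n x - sqrt_iter B 0 x)"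
      by (simp only: sum_lessThan_telescope[of "\<lambda>k. sqrt_iter B k x"])
    then show ?thesis
      by (simp add: convergent_def)
  qed
  then show ?thesis
    using that by metis
qed

text \<open>The quadratic identity says \<open>(1 - Y)^2 = 1 - B\<close>, so \<open>1 - Y\<close> is
  the root of \<open>1 - B\<close>.\<close>

lemma contraction_sqrt_exists:
  obtains Y where "bounded_clinear Y" "selfadjoint Y" "\<And>x. norm (Y x) \<le> norm x"
    "\<And>x. Y (Y x) = 2 *\<^sub>R Y x - B x"
    "\<And>C x. bounded_linear C \<Longrightarrow> (\<And>x. C (B x) = B (C x)) \<Longrightarrow> C (Y x) = Y (C x)"
proof -
  obtain Y where Y: "\<And>x. (\<lambda>n. sqrt_iter B n x) \<longlonglongrightarrow> Y x"
    using sqrt_iter_limit by blast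
  have Yn: "norm (Y x) \<le> norm x" for x
  proof (rule LIMSEQ_le_const2[OF tendsto_norm[OF Y]], intro exI[of _ 0] allI impI)
    fix n
    show "norm (sqrt_iter B n x) \<le> norm x"
      using sqrt_iter_norm[of n x] sqrt_iter_bound_le[of n] mult_right_mono[of "sqrt_iter_bound n" 1 "norm x"]
      by simp
  qed
  have add: "Y (x + y) = Y x + Y y" for x y
    by (rule LIMSEQ_unique[OF Y]) (simp add: sqrt_iter_add tendsto_add Y)
  have scale: "Y (c *\<^sub>C x) = c *\<^sub>C Y x" for c x
    by (rule LIMSEQ_unique[OF Y]) (simp add: sqrt_iter_scaleC scaleC.tendsto Y)
  have "bounded_clinear Y"
    by (rule bounded_clinearI[where K = 1]) (simp_all add: add scale Yn)
  moreover have "selfadjoint Y"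
    unfolding selfadjoint_def
  proof (intro allI)
    fix x y
    have "(\<lambda>n. cinner (sqrt_iter B n x) y) \<longlonglongrightarrow> cinner (Y x) y"
      by (intro cinner.tendsto Y tendsto_const)
    moreover have "(\<lambda>n. cinner (sqrt_iter B n x) y) \<longlonglongrightarrow> cinner x (Y y)"
      unfolding sqrt_iter_selfadjoint by (intro cinner.tendsto Y tendsto_const)
    ultimately show "cinner (Y x) y = cinner x (Y y)"
      by (rule LIMSEQ_unique)
  qed
  moreover have "Y (Y x) = 2 *\<^sub>R Y x - B x" for x
  proof -
    \<comment> \<open>Passing to the limit in a product of strongly convergent operators: the outer
      factors are contractions, so the inner error is not amplified.\<close>
    have "(\<lambda>n. sqrt_iter B n (sqrt_iter B n x - Y x)) \<longlonglongrightarrow> 0"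
    proof (rule Lim_null_comparison[OF always_eventually])
      show "\<forall>n. norm (sqrt_iter B n (sqrt_iter B n x - Y x)) \<le> norm (sqrt_iter B n x - Y x)"
      proof
        fix n
        show "norm (sqrt_iter B n (sqrt_iter B n x - Y x)) \<le> norm (sqrt_iter B n x - Y x)"
          using sqrt_iter_norm[of n "sqrt_iter B n x - Y x"] sqrt_iter_bound_le[of n]
            mult_right_mono[of "sqrt_iter_bound n" 1 "norm (sqrt_iter B n x - Y x)"]
          by simp
      qed
      have "(\<lambda>n. norm (sqrt_iter B n x - Y x)) \<longlonglongrightarrow> norm (Y x - Y x)"
        by (intro tendsto_intros Y)
      then show "(\<lambda>n. norm (sqrt_iter B n x - Y x)) \<longlonglongrightarrow> 0" by simp
    qed
    then have "(\<lambda>n. sqrt_iter B n (sqrt_iter B n x - Y x) + sqrt_iter B n (Y x)) \<longlonglongrightarrow> 0 + Y (Y x)"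
      by (intro tendsto_add Y)
    then have "(\<lambda>n. sqrt_iter B n (sqrt_iter B n x)) \<longlonglongrightarrow> Y (Y x)"
      by (simp add: sqrt_iter_diff)
    then have "(\<lambda>n. (1/2) *\<^sub>R (B x + sqrt_iter B n (sqrt_iter B n x))) \<longlonglongrightarrow> (1/2) *\<^sub>R (B x + Y (Y x))"
      by (intro tendsto_intros)
    moreover have "(\<lambda>n. (1/2) *\<^sub>R (B x + sqrt_iter B n (sqrt_iter B n x))) \<longlonglongrightarrow> Y x"
      using LIMSEQ_Suc[OF Y[of x]] by simp
    ultimately have "Y x = (1/2) *\<^sub>R (B x + Y (Y x))"
      using LIMSEQ_unique by blast
    then have "2 *\<^sub>R Y x = B x + Y (Y x)"
      by (metis scaleR_half_double scaleR_right.add scaleR_left_distrib one_add_one scaleR_one)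
    then show ?thesis by simp
  qed
  moreover have "C (Y x) = Y (C x)" if C: "bounded_linear C" "\<And>x. C (B x) = B (C x)" for C x
  proof (rule LIMSEQ_unique)
    interpret C: bounded_linear C by fact
    show "(\<lambda>n. C (sqrt_iter B n x)) \<longlonglongrightarrow> C (Y x)"
      by (intro C.tendsto Y)
    show "(\<lambda>n. C (sqrt_iter B n x)) \<longlonglongrightarrow> Y (C x)"
      by (simp add: sqrt_iter_commute[OF C] Y)
  qed
  ultimately show ?thesis
    using that Yn by blast
qed

end

lemma positive_sqrt_exists:
  fixes A :: "'a::chilbert_space \<Rightarrow> 'a"
  assumes A: "positive_operator A"
  obtains R where "positive_operator R" "\<And>x. R (R x) = A x"
    "\<And>C x. bounded_linear C \<Longrightarrow> (\<And>x. C (A x) = A (C x)) \<Longrightarrow> C (R x) = R (C x)"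
proof -
  have bA: "bounded_clinear A" using A by (simp add: positive_operator_def)
  interpret A: bounded_linear A
    using bA by (rule bounded_clinear_imp_bounded_linear)
  note sA = positive_operator_selfadjoint[OF A]
  obtain k where k: "k > 0" "\<And>x. norm (A x) \<le> norm x * k"
    using A.pos_bounded by blast
  \<comment> \<open>Normalised so that \<open>0 <= B <= 1\<close>, which makes \<open>B\<close> a
    contraction. From \<open>k (1 - B) = A\<close> the root of \<open>A\<close> is
    \<open>sqrt k\<close> times \<open>1 - Y\<close>.\<close>
  define B where "B x = x - (1 / k) *\<^sub>R A x" for x
  have bB: "bounded_clinear B"
  proof (rule bounded_clinearI[where K = 2])
    fix x
    have "norm (B x) \<le> norm x + (1 / k) * norm (A x)"
      unfolding B_def using norm_triangle_ineq4[of x "(1 / k) *\<^sub>R A x"] k(1) by simp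
    also have "(1 / k) * norm (A x) \<le> (1 / k) * (norm x * k)"
      using k by (intro mult_left_mono) auto
    finally show "norm (B x) \<le> norm x * 2" using k(1) by simp
  qed (simp_all add: B_def A.add bounded_clinear_scaleC[OF bA] algebra_simps scaleC.diff_right scaleC.scaleR_right)
  have sB: "selfadjoint B"
    unfolding selfadjoint_def B_def
    by (simp add: cinner.diff_left cinner.diff_right cinner.scaleR_left cinner.scaleR_right selfadjointD[OF sA])
  have ReB: "Re (cinner (B x) x) = (norm x)\<^sup>2 - Re (cinner (A x) x) / k" for x
    by (simp add: B_def cinner.diff_left cinner.scaleR_left cinner_self)
  have ReB_le: "Re (cinner (B x) x) \<le> 1 * (norm x)\<^sup>2" for x
    using positive_operator_Re_nonneg[OF A, of x] k(1) by (simp add: ReB)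
  have ReB_ge: "0 \<le> Re (cinner (B x) x)" for x
  proof -
    have "Re (cinner (A x) x) \<le> k * (norm x)\<^sup>2"
      using k(2)[of x] by (intro Re_cinner_le) (simp add: mult.commute)
    then show ?thesis
      using k(1) by (simp add: ReB field_simps)
  qed
  have contr: "norm (B x) \<le> norm x" for x
  proof -
    have "(norm (B x))\<^sup>2 \<le> 1 * Re (cinner (B x) x)"
      by (rule positive_operator_norm_square_le[OF bB sB ReB_ge _ ReB_le]) simp
    also have "\<dots> \<le> (norm x)\<^sup>2"
      using ReB_le[of x] by simp
    finally show ?thesis by (rule power2_le_imp_le) simp
  qed
  obtain Y where Y: "bounded_clinear Y" "selfadjoint Y" "\<And>x. norm (Y x) \<le> norm x"
    "\<And>x. Y (Y x) = 2 *\<^sub>R Y x - B x"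
    "\<And>C x. bounded_linear C \<Longrightarrow> (\<And>x. C (B x) = B (C x)) \<Longrightarrow> C (Y x) = Y (C x)"
    using contraction_sqrt_exists[OF bB sB contr] by metis
  interpret Y: bounded_linear Y
    using Y(1) by (rule bounded_clinear_imp_bounded_linear)
  define R where "R x = sqrt k *\<^sub>R (x - Y x)" for x
  have "positive_operator R"
  proof (rule positive_operatorI)
    show "bounded_clinear R"
    proof (rule bounded_clinearI[where K = "2 * sqrt k"])
      fix x
      have "norm (x - Y x) \<le> 2 * norm x"
        using norm_triangle_ineq4[of x "Y x"] Y(3)[of x] by linarith
      from mult_left_mono[OF this, of "sqrt k"] show "norm (R x) \<le> norm x * (2 * sqrt k)"
        using k(1) by (simp add: R_def mult_ac)
    qed (simp_all add: R_def Y.add bounded_clinear_scaleC[OF Y(1)] algebra_simps scaleC.diff_right scaleC.scaleR_right)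
    show "selfadjoint R"
      unfolding selfadjoint_def R_def
      by (simp add: cinner.diff_left cinner.diff_right cinner.scaleR_left cinner.scaleR_right selfadjointD[OF Y(2)])
    fix x
    show "0 \<le> Re (cinner (R x) x)"
      using k(1) Re_cinner_le[of "Y x" 1 x] Y(3)[of x]
      by (simp add: R_def cinner.scaleR_left cinner.diff_left cinner_self)
  qed
  moreover have "R (R x) = A x" for x
  proof -
    have "R (R x) = k *\<^sub>R ((x - Y x) - Y (x - Y x))"
      using k(1) by (simp add: R_def Y.scaleR scaleR_diff_right[symmetric])
    also have "(x - Y x) - Y (x - Y x) = x - B x"
      by (simp add: Y.diff Y(4) scaleR_2)
    finally show ?thesis
      using k(1) by (simp add: B_def)
  qed
  moreover have "C (R x) = R (C x)" if C: "bounded_linear C" "\<And>x. C (A x) = A (C x)" for C x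
  proof -
    interpret C: bounded_linear C by fact
    have "C (Y x) = Y (C x)"
      by (rule Y(5)[OF C(1)]) (simp add: B_def C.diff C.scaleR C(2))
    then show ?thesis
      by (simp add: R_def C.diff C.scaleR)
  qed
  ultimately show ?thesis
    using that by blast
qed

lemma positive_operator_eq_0:
  assumes A: "positive_operator A" and "Re (cinner (A x) x) = 0"
  shows "A x = 0"
proof -
  have bA: "bounded_clinear A" using A by (simp add: positive_operator_def)
  obtain k where k: "k > 0" "\<And>x. norm (A x) \<le> norm x * k"
    using bounded_linear.pos_bounded[OF bounded_clinear_imp_bounded_linear[OF bA]] by blast
  have "Re (cinner (A y) y) \<le> k * (norm y)\<^sup>2" for y
    using k(2)[of y] by (intro Re_cinner_le) (simp add: mult.commute)
  from positive_operator_norm_square_le[OF bA positive_operator_selfadjoint[OF A]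
      positive_operator_Re_nonneg[OF A] k(1) this, of x]
  show ?thesis using assms(2) by simp
qed

text \<open>For uniqueness, a positive root \<open>S\<close> commutes with \<open>A = S^2\<close>,
  hence with \<open>R\<close>, and so \<open>(R + S) (R - S) = 0\<close>. With
  \<open>y = (R - S) x\<close> the two nonnegative forms at \<open>y\<close> add up to 0, which
  gives \<open>R y = S y = 0\<close> and then \<open>cinner y y = 0\<close>.\<close>

lemma sqrt_operator_eq:
  fixes A :: "'a::chilbert_space \<Rightarrow> 'a"
  assumes A: "positive_operator A"
  shows "positive_operator (sqrt_operator A)" "sqrt_operator A (sqrt_operator A x) = A x"
proof -
  obtain R where R: "positive_operator R" "\<And>x. R (R x) = A x"
    "\<And>C x. bounded_linear C \<Longrightarrow> (\<And>x. C (A x) = A (C x)) \<Longrightarrow> C (R x) = R (C x)"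
    using positive_sqrt_exists[OF A] by blast
  have "S = R" if S: "positive_operator S" "S \<circ> S = A" for S
  proof
    fix x
    have SS: "S (S z) = A z" for z
      using S(2) by (metis comp_apply)
    have bl: "bounded_linear S" "bounded_linear R"
      using S(1) R(1) by (simp_all add: positive_operator_def bounded_clinear_imp_bounded_linear)
    interpret S: bounded_linear S by (rule bl)
    interpret R: bounded_linear R by (rule bl)
    have SR: "S (R z) = R (S z)" for z
      by (rule R(3)[OF bl(1)]) (simp only: SS[symmetric])
    define y where "y = R x - S x"
    have "R y + S y = 0"
      by (simp add: y_def R.diff S.diff R(2) SS SR)
    then have "Re (cinner (R y) y) + Re (cinner (S y) y) = 0"
      by (metis cinner_add_left cinner.zero_left plus_complex.simps(1) zero_complex.simps(1))
    then have re: "Re (cinner (R y) y) = 0" "Re (cinner (S y) y) = 0"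
      using positive_operator_Re_nonneg[OF R(1), of y] positive_operator_Re_nonneg[OF S(1), of y]
      by auto
    note Ry = positive_operator_eq_0[OF R(1) re(1)] and Sy = positive_operator_eq_0[OF S(1) re(2)]
    have "cinner y y = cinner (R x) y - cinner (S x) y"
      by (simp add: y_def cinner.diff_left)
    also have "\<dots> = cinner x (R y) - cinner x (S y)"
      by (simp add: selfadjointD positive_operator_selfadjoint R(1) S(1))
    also have "\<dots> = 0"
      by (simp add: Ry Sy cinner.zero_right)
    finally have "y = 0" by (simp add: cinner_self)
    then show "S x = R x" by (simp add: y_def)
  qed
  note uniq = this
  have "sqrt_operator A = R"
    unfolding sqrt_operator_def
  proof (rule the_equality)
    show "positive_operator R \<and> R \<circ> R = A"
      using R(1,2) by (simp add: fun_eq_iff)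
    show "S = R" if "positive_operator S \<and> S \<circ> S = A" for S
      using that by (intro uniq) auto
  qed
  then show "positive_operator (sqrt_operator A)" "sqrt_operator A (sqrt_operator A x) = A x"
    by (simp_all add: R)
qed

section \<open>The adjoint and the modulus of an operator\<close>

lemma cadjoint_eq:
  assumes "\<And>x y. cinner (T x) y = cinner x (S y)"
  shows "cadjoint T = S"
  unfolding cadjoint_def
proof (rule the_equality)
  show "S' = S" if "\<forall>x y. cinner (T x) y = cinner x (S' y)" for S'
  proof
    fix y
    show "S' y = S y"
      by (rule eq_if_cinner_eq) (metis assms cinner_commute that)
  qed
qed (simp add: assms)

lemma
  fixes T :: "'a::chilbert_space \<Rightarrow> 'b::chilbert_space"
  assumes T: "bounded_clinear T" and S: "bounded_clinear S" and adj: "\<And>x y. cinner (T x) y = cinner x (S y)"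
  shows positive_abs_operator: "positive_operator (abs_operator T)"
    and norm_abs_operator: "norm (abs_operator T x) = norm (T x)"
proof -
  have adj': "cinner (S y) x = cinner y (T x)" for x y
    by (metis adj cinner_commute)
  have "bounded_clinear (S \<circ> T)"
    using S T unfolding bounded_clinear_def
    by (auto simp: o_def intro: bounded_linear_compose Vector_Spaces.linear_compose[unfolded o_def])
  then have pos: "positive_operator (S \<circ> T)"
    by (rule positive_operatorI) (simp_all add: selfadjoint_def adj' adj[symmetric] cinner_self)
  have abs: "abs_operator T = sqrt_operator (S \<circ> T)"
    by (simp add: abs_operator_def cadjoint_eq[OF adj])
  show p: "positive_operator (abs_operator T)"
    unfolding abs by (rule sqrt_operator_eq[OF pos])
  have "complex_of_real ((norm (abs_operator T x))\<^sup>2) = cinner (abs_operator T (abs_operator T x)) x"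
    by (simp only: cinner_self[symmetric] selfadjointD[OF positive_operator_selfadjoint[OF p]])
  also have "\<dots> = of_real ((norm (T x))\<^sup>2)"
    unfolding abs sqrt_operator_eq(2)[OF pos] by (simp only: o_apply adj' cinner_self)
  finally have "(norm (abs_operator T x))\<^sup>2 = (norm (T x))\<^sup>2"
    by (simp only: of_real_eq_iff)
  then show "norm (abs_operator T x) = norm (T x)"
    by (rule power2_eq_imp_eq) auto
qed

text \<open>With \<open>R = |T|\<close> one has \<open>0 <= R <= \<alpha>\<close>, hence
  \<open>R^2 <= \<alpha> R\<close>. This bounds the cross term when the square of
  \<open>norm (R x - \<alpha> x)\<close> is expanded, leaving
  \<open>\<alpha>^2 |x|^2 - |R x|^2\<close>, the square of \<open>norm (L x)\<close>.\<close>

lemma norm_abs_operator_diff_le: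
  fixes T :: "'a::chilbert_space \<Rightarrow> 'b::chilbert_space"
  assumes T: "bounded_clinear T" and S: "bounded_clinear S" and adj: "\<And>x y. cinner (T x) y = cinner x (S y)"
    and "\<alpha> \<ge> 0" and defect: "\<And>x. (norm (T x))\<^sup>2 = \<alpha>\<^sup>2 * (norm x)\<^sup>2 - (norm (L x))\<^sup>2"
  shows "norm (abs_operator T x - \<alpha> *\<^sub>R x) \<le> norm (L x)"
proof -
  define R where "R = abs_operator T"
  have pos: "positive_operator R" and nR: "\<And>x. norm (R x) = norm (T x)"
    unfolding R_def using positive_abs_operator[OF T S adj] norm_abs_operator[OF T S adj] by auto
  have R: "bounded_clinear R"
    using pos by (simp add: positive_operator_def)
  have le: "norm (R x) \<le> \<alpha> * norm x" for x
    by (rule power2_le_imp_le) (use \<open>\<alpha> \<ge> 0\<close> in \<open>simp_all add: nR defect power_mult_distrib\<close>)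
  have main: "(norm (R x))\<^sup>2 \<le> \<alpha> * Re (cinner (R x) x)"
  proof (cases "\<alpha> = 0")
    case True
    then show ?thesis using le[of x] by simp
  next
    case False
    then show ?thesis
      using \<open>\<alpha> \<ge> 0\<close>
      by (intro positive_operator_norm_square_le[OF R positive_operator_selfadjoint[OF pos]]
          positive_operator_Re_nonneg[OF pos] Re_cinner_le le) simp
  qed
  have "(norm (R x - \<alpha> *\<^sub>R x))\<^sup>2 = (norm (R x))\<^sup>2 - 2 * \<alpha> * Re (cinner (R x) x) + \<alpha>\<^sup>2 * (norm x)\<^sup>2"
    unfolding norm_diff_square by (simp add: cinner.scaleR_right power_mult_distrib)
  also have "\<dots> \<le> (norm (L x))\<^sup>2"
    using main defect[of x] by (simp add: nR)
  finally show ?thesis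
    unfolding R_def by (rule power2_le_imp_le) simp
qed

section \<open>A scalar form of Parrott's lemma\<close>

text \<open>\<open>c\<close> is the limit of \<open>L\<close> along a minimising sequence of \<open>F\<close>.\<close>

lemma parrott:
  fixes L :: "'a::real_vector \<Rightarrow> 'b::banach"
  assumes C: "convex C" "C \<noteq> {}" and L: "linear L"
    and nonneg: "\<And>f. f \<in> C \<Longrightarrow> 0 \<le> F f"
    and quad: "\<And>t f g. F ((1 - t) *\<^sub>R f + t *\<^sub>R g) = (1 - t) * F f + t * F g - t * (1 - t) * F (f - g)"
    and dom: "\<And>f g. f \<in> C \<Longrightarrow> g \<in> C \<Longrightarrow> (norm (L (f - g)))\<^sup>2 \<le> F (f - g)"
  obtains c where "\<And>f. f \<in> C \<Longrightarrow> (norm (L f - c))\<^sup>2 \<le> F f"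
proof -
  define m where "m = (INF f\<in>C. F f)"
  have bdd: "bdd_below (F ` C)"
    using nonneg by (auto intro!: bdd_belowI[of _ 0])
  have m_le: "m \<le> F f" if "f \<in> C" for f
    unfolding m_def by (rule cINF_lower[OF bdd that])
  have m0: "m \<ge> 0"
    unfolding m_def using C(2) nonneg by (intro cINF_greatest) auto
  \<comment> \<open>The infimum \<open>m\<close> bounds \<open>F\<close> at the convex combination
    from below; \<open>quad\<close> turns this into a bound for the defect term, and
    \<open>dom\<close> compares that term with \<open>L\<close>.\<close>
  have comb: "t * (1 - t) * (norm (L f - L g))\<^sup>2 \<le> (1 - t) * F f + t * F g - m"
    if "f \<in> C" "g \<in> C" "0 \<le> t" "t \<le> 1" for f g t
  proof -
    have "(1 - t) *\<^sub>R f + t *\<^sub>R g \<in> C"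
      using C(1) that by (intro convexD) auto
    from m_le[OF this] have "t * (1 - t) * F (f - g) \<le> (1 - t) * F f + t * F g - m"
      by (simp add: quad)
    moreover have "t * (1 - t) * (norm (L f - L g))\<^sup>2 \<le> t * (1 - t) * F (f - g)"
      using dom[OF that(1,2)] that by (intro mult_left_mono) (auto simp: linear_diff[OF L])
    ultimately show ?thesis by linarith
  qed
  have "\<exists>f\<in>C. F f < m + 1 / real (Suc n)" for n
    using cINF_less_iff[OF C(2) bdd, of "m + 1 / real (Suc n)"] by (simp add: m_def)
  then obtain f where f: "\<And>n. f n \<in> C" "\<And>n. F (f n) < m + 1 / real (Suc n)"
    by metis
  have Ff: "(\<lambda>n. F (f n)) \<longlonglongrightarrow> m"
  proof (rule tendsto_sandwich[OF _ _ tendsto_const])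
    have "(\<lambda>n. m + 1 / real (Suc n)) \<longlonglongrightarrow> m + 0"
      by (intro tendsto_intros LIMSEQ_Suc[OF lim_1_over_n])
    then show "(\<lambda>n. m + 1 / real (Suc n)) \<longlonglongrightarrow> m" by simp
    show "\<forall>\<^sub>F n in sequentially. m \<le> F (f n)"
      by (intro always_eventually allI m_le f)
    show "\<forall>\<^sub>F n in sequentially. F (f n) \<le> m + 1 / real (Suc n)"
      by (intro always_eventually allI less_imp_le f)
  qed
  have "Cauchy (\<lambda>n. L (f n))"
  proof (rule CauchyI)
    fix e :: real assume "e > 0"
    then have "m < m + e\<^sup>2 / 4" by simp
    with Ff have "\<forall>\<^sub>F n in sequentially. F (f n) < m + e\<^sup>2 / 4"
      by (rule order_tendstoD)
    then obtain N where N: "\<And>n. n \<ge> N \<Longrightarrow> F (f n) < m + e\<^sup>2 / 4"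
      unfolding eventually_sequentially by blast
    have "norm (L (f i) - L (f j)) < e" if "i \<ge> N" "j \<ge> N" for i j
    proof (rule power2_less_imp_less)
      \<comment> \<open>At \<open>t = 1/2\<close> the factor \<open>t * (1 - t)\<close> is
        \<open>1/4\<close>, which matches the tolerance \<open>e^2 / 4\<close> for
        \<open>F\<close>.\<close>
      show "(norm (L (f i) - L (f j)))\<^sup>2 < e\<^sup>2"
        using comb[OF f(1)[of i] f(1)[of j], of "1/2"] N[OF that(1)] N[OF that(2)] by simp
    qed (use \<open>e > 0\<close> in simp)
    then show "\<exists>N. \<forall>i\<ge>N. \<forall>j\<ge>N. norm (L (f i) - L (f j)) < e" by blast
  qed
  then obtain c where c: "(\<lambda>n. L (f n)) \<longlonglongrightarrow> c"
    using Cauchy_convergent unfolding convergent_def by blast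
  have "(norm (L g - c))\<^sup>2 \<le> F g" if "g \<in> C" for g
  proof -
    have le: "t * (1 - t) * (norm (c - L g))\<^sup>2 \<le> (1 - t) * m + t * F g - m" if t: "0 \<le> t" "t \<le> 1" for t
    proof (rule LIMSEQ_le)
      show "(\<lambda>n. t * (1 - t) * (norm (L (f n) - L g))\<^sup>2) \<longlonglongrightarrow> t * (1 - t) * (norm (c - L g))\<^sup>2"
        by (intro tendsto_intros c)
      show "(\<lambda>n. (1 - t) * F (f n) + t * F g - m) \<longlonglongrightarrow> (1 - t) * m + t * F g - m"
        by (intro tendsto_intros Ff)
      show "\<exists>N. \<forall>n\<ge>N. t * (1 - t) * (norm (L (f n) - L g))\<^sup>2 \<le> (1 - t) * F (f n) + t * F g - m"
        using comb[OF f(1) \<open>g \<in> C\<close> t] by blast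
    qed
    \<comment> \<open>Both sides of \<open>le\<close> vanish at \<open>t = 0\<close>, so it can be
      divided by \<open>t\<close>; the factor \<open>1 - t\<close> disappears afterwards along
      \<open>t = 1 / Suc n\<close>.\<close>
    have le': "(1 - t) * (norm (c - L g))\<^sup>2 \<le> F g" if t: "0 < t" "t \<le> 1" for t
    proof -
      have "t * ((1 - t) * (norm (c - L g))\<^sup>2) \<le> t * (F g - m)"
        using le[of t] t by (simp add: algebra_simps)
      then have "(1 - t) * (norm (c - L g))\<^sup>2 \<le> F g - m"
        using t by simp
      then show ?thesis using m0 by linarith
    qed
    have "(\<lambda>n. (1 - 1 / real (Suc n)) * (norm (c - L g))\<^sup>2) \<longlonglongrightarrow> (1 - 0) * (norm (c - L g))\<^sup>2"
      by (intro tendsto_intros LIMSEQ_Suc[OF lim_1_over_n])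
    then have "(1 - 0) * (norm (c - L g))\<^sup>2 \<le> F g"
      by (rule LIMSEQ_le_const2) (intro exI[of _ 0] allI impI le', auto)
    then show ?thesis
      by (simp add: norm_minus_commute)
  qed
  then show ?thesis
    using that by blast
qed

section \<open>Trigonometric polynomials on the circle\<close>

interpretation circle: prob_space circle
  by (rule prob_space_circle)

lemma borel_measurable_circle:
  "f \<in> borel_measurable (restrict_space borel (sphere 0 1)) \<Longrightarrow> f \<in> borel_measurable circle"
  unfolding circle_def by (intro measurable_completion) simp

lemma continuous_on_measurable_circle:
  fixes g :: "complex \<Rightarrow> 'b::topological_space"
  shows "continuous_on (sphere 0 1) g \<Longrightarrow> g \<in> borel_measurable circle"
  by (intro borel_measurable_circle borel_measurable_continuous_on_restrict)

lemma measurable_cis: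
  "cis \<in> uniform_measure lborel {0..2 * pi} \<rightarrow>\<^sub>M restrict_space borel (sphere 0 1)"
proof -
  have "cis \<in> borel_measurable borel"
    by (intro borel_measurable_continuous_onI continuous_intros)
  then show ?thesis
    by (intro measurable_restrict_space2) auto
qed

lemma integral_circle:
  fixes g :: "complex \<Rightarrow> complex"
  assumes g: "continuous_on (sphere 0 1) g"
  shows "(\<integral>z. g z \<partial>circle) = (\<integral>t. indicator {0..2 * pi} t *\<^sub>R g (cis t) \<partial>lborel) / (2 * pi)"
proof -
  have m: "g \<in> borel_measurable (restrict_space borel (sphere 0 1))"
    by (rule borel_measurable_continuous_on_restrict[OF g])
  have "(\<lambda>t. g (cis t)) \<in> borel_measurable (uniform_measure lborel {0..2 * pi})"
    using measurable_compose[OF measurable_cis m] .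
  then have gm: "(\<lambda>t. g (cis t)) \<in> borel_measurable lborel"
    by (subst (asm) measurable_cong_sets[OF sets_uniform_measure refl])
  have "(\<integral>z. g z \<partial>circle) = (\<integral>z. g z \<partial>distr (uniform_measure lborel {0..2 * pi})
                              (restrict_space borel (sphere 0 1)) cis)"
    unfolding circle_def using m by (intro integral_completion) simp
  also have "\<dots> = (\<integral>t. g (cis t) \<partial>uniform_measure lborel {0..2 * pi})"
    by (rule integral_distr[OF measurable_cis m])
  also have "uniform_measure lborel {0..2 * pi} =
      density lborel (\<lambda>t. ennreal (indicator {0..2 * pi} t / (2 * pi)))"
    unfolding uniform_measure_def
    by (intro density_cong) (auto simp: divide_ennreal[symmetric] indicator_def ennreal_indicator[symmetric])
  also have "(\<integral>t. g (cis t) \<partial>\<dots>) = (\<integral>t. (indicator {0..2 * pi} t / (2 * pi)) *\<^sub>R g (cis t) \<partial>lborel)"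
    by (rule integral_density[OF gm]) auto
  also have "\<dots> = (\<integral>t. (1 / (2 * pi)) *\<^sub>R (indicator {0..2 * pi} t *\<^sub>R g (cis t)) \<partial>lborel)"
    by (intro Bochner_Integration.integral_cong) auto
  also have "\<dots> = (\<integral>t. indicator {0..2 * pi} t *\<^sub>R g (cis t) \<partial>lborel) / (2 * pi)"
    by (simp add: scaleR_conv_of_real)
  finally show ?thesis .
qed

lemma integral_powi: "(\<integral>z. z powi n \<partial>circle) = (if n = 0 then 1 else 0)"
proof (cases "n = 0")
  case True
  then show ?thesis
    by (simp add: circle.prob_space)
next
  case False
  have eq: "cis t powi n = exp (\<i> * (of_int n * complex_of_real t))" for t
    by (simp only: cis_power_int) (simp add: cis_conv_exp)
  have "(\<integral>t. indicator {0..2 * pi} t *\<^sub>R (cis t powi n) \<partial>lborel)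
      = exp (\<i> * (of_int n * complex_of_real (2 * pi))) / (\<i> * of_int n)
        - exp (\<i> * (of_int n * complex_of_real 0)) / (\<i> * of_int n)"
    unfolding eq
  proof (rule integral_FTC_Icc)
    fix t :: real
    have "((\<lambda>z. exp (\<i> * (of_int n * z)) / (\<i> * of_int n)) has_field_derivative
        exp (\<i> * (of_int n * complex_of_real t))) (at (complex_of_real t))"
      using False by (auto intro!: derivative_eq_intros simp: mult.commute[of _ \<i>])
    then have "((\<lambda>t. exp (\<i> * (of_int n * complex_of_real t)) / (\<i> * of_int n)) has_vector_derivative
        exp (\<i> * (of_int n * complex_of_real t))) (at t)"
      by (rule has_vector_derivative_real_field)
    then show "((\<lambda>t. exp (\<i> * (of_int n * complex_of_real t)) / (\<i> * of_int n)) has_vector_derivative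
        exp (\<i> * (of_int n * complex_of_real t))) (at t within {0..2 * pi})"
      by (rule has_vector_derivative_at_within)
  qed (auto intro!: continuous_intros)
  also have "exp (\<i> * (of_int n * complex_of_real (2 * pi))) = 1"
    by (auto simp: exp_eq_1)
  finally have "(\<integral>t. indicator {0..2 * pi} t *\<^sub>R (cis t powi n) \<partial>lborel) = 0"
    by simp
  moreover have "continuous_on (sphere 0 1) (\<lambda>z::complex. z powi n)"
    by (auto intro!: continuous_intros)
  ultimately show ?thesis
    using False integral_circle[of "\<lambda>z. z powi n"] by simp
qed

text \<open>Rule induction replaces the bookkeeping of coefficients. These are functions on the
  whole plane, of which only the values on the circle matter.\<close>

inductive trig_poly :: "(complex \<Rightarrow> complex) \<Rightarrow> bool" where
  monom: "trig_poly (\<lambda>z. c * z powi n)"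
| add: "trig_poly p \<Longrightarrow> trig_poly q \<Longrightarrow> trig_poly (\<lambda>z. p z + q z)"

lemma trig_poly_const: "trig_poly (\<lambda>z. c)"
  using trig_poly.monom[of c 0] by simp

lemma trig_poly_powi: "trig_poly (\<lambda>z. z powi n)"
  using trig_poly.monom[of 1 n] by simp

lemma trig_poly_sum: "(\<And>i. i \<in> I \<Longrightarrow> trig_poly (p i)) \<Longrightarrow> trig_poly (\<lambda>z. \<Sum>i\<in>I. p i z)"
  by (induction I rule: infinite_finite_induct) (auto intro: trig_poly.add trig_poly_const)

lemma trig_poly_scale: "trig_poly p \<Longrightarrow> trig_poly (\<lambda>z. c * p z)"
proof (induction rule: trig_poly.induct)
  case (monom d n)
  then show ?case using trig_poly.monom[of "c * d" n] by (simp add: mult.assoc)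
next
  case (add p q)
  then show ?case using trig_poly.add by (simp add: distrib_left)
qed

lemma trig_poly_continuous_on: "trig_poly p \<Longrightarrow> continuous_on (sphere 0 1) p"
proof (induction rule: trig_poly.induct)
  case (monom c n)
  then show ?case by (auto intro!: continuous_intros)
qed (auto intro: continuous_on_add)

text \<open>Products and conjugates of trigonometric polynomials agree with trigonometric polynomials only on
  the circle, because of the value at \<open>0\<close> and the identity \<open>cnj z = inverse z\<close>.\<close>

lemma trig_poly_mult:
  assumes "trig_poly p" "trig_poly q"
  shows "\<exists>r. trig_poly r \<and> (\<forall>z\<in>sphere 0 1. r z = p z * q z)"
  using assms(1)
proof (induction rule: trig_poly.induct)
  case (monom c n)
  show ?case
    using assms(2)
  proof (induction rule: trig_poly.induct)
    case (monom d m)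
    show ?case
    proof (intro exI conjI ballI)
      fix z :: complex assume "z \<in> sphere 0 1"
      then have "z \<noteq> 0" by auto
      then show "(c * d) * z powi (n + m) = c * z powi n * (d * z powi m)"
        by (simp add: power_int_add)
    qed (rule trig_poly.monom)
  next
    case (add p q)
    then obtain r s where "trig_poly r" "\<forall>z\<in>sphere 0 1. r z = c * z powi n * p z"
      "trig_poly s" "\<forall>z\<in>sphere 0 1. s z = c * z powi n * q z" by blast
    then show ?case
      by (intro exI[of _ "\<lambda>z. r z + s z"]) (auto intro: trig_poly.add simp: distrib_left)
  qed
next
  case (add p p')
  then obtain r s where "trig_poly r" "\<forall>z\<in>sphere 0 1. r z = p z * q z"
    "trig_poly s" "\<forall>z\<in>sphere 0 1. s z = p' z * q z" by blast
  then show ?case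
    by (intro exI[of _ "\<lambda>z. r z + s z"]) (auto intro: trig_poly.add simp: distrib_right)
qed

lemma cnj_powi_sphere:
  assumes "z \<in> sphere 0 (1::real)"
  shows "cnj (z powi n) = z powi (- n)"
proof -
  have "cnj z = inverse z"
    using assms by (simp add: inverse_complex_def complex_eq_iff) (simp add: cmod_power2[symmetric])
  then show ?thesis
    by (simp add: power_int_minus power_int_inverse)
qed

lemma trig_poly_cnj:
  assumes "trig_poly p"
  shows "\<exists>r. trig_poly r \<and> (\<forall>z\<in>sphere 0 1. r z = cnj (p z))"
  using assms
proof (induction rule: trig_poly.induct)
  case (monom c n)
  show ?case
    by (intro exI[of _ "\<lambda>z. cnj c * z powi (- n)"] conjI trig_poly.monom ballI)
      (simp only: complex_cnj_mult cnj_powi_sphere)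
next
  case (add p q)
  then obtain r s where "trig_poly r" "\<forall>z\<in>sphere 0 1. r z = cnj (p z)"
    "trig_poly s" "\<forall>z\<in>sphere 0 1. s z = cnj (q z)" by blast
  then show ?case
    by (intro exI[of _ "\<lambda>z. r z + s z"]) (auto intro: trig_poly.add)
qed

text \<open>Stone-Weierstrass for the real algebra \<open>P\<close> of functions that agree on the
  circle with some trigonometric polynomial.\<close>

lemma trig_poly_real_approx:
  fixes f :: "complex \<Rightarrow> real"
  assumes f: "continuous_on (sphere 0 1) f" and "e > 0"
  shows "\<exists>p. trig_poly p \<and> (\<forall>z\<in>sphere 0 1. cmod (of_real (f z) - p z) < e)"
proof -
  define P where "P f \<longleftrightarrow> (\<exists>p. trig_poly p \<and> (\<forall>z\<in>sphere 0 1. p z = complex_of_real (f z)))" for f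
  have P_Re: "P (\<lambda>z. Re (p z))" if p: "trig_poly p" for p
  proof -
    obtain q where q: "trig_poly q" "\<forall>z\<in>sphere 0 1. q z = cnj (p z)"
      using trig_poly_cnj[OF p] by blast
    show ?thesis
      unfolding P_def using q(2)
      by (intro exI[of _ "\<lambda>z. (1/2) * p z + (1/2) * q z"] conjI trig_poly.add trig_poly_scale p q(1))
        (simp add: complex_eq_iff)
  qed
  have "\<exists>g. P g \<and> (\<forall>x\<in>sphere 0 1. \<bar>f x - g x\<bar> < e)"
  proof (rule Stone_Weierstrass_HOL[OF _ _ _ _ _ _ f \<open>e > 0\<close>])
    show "P (\<lambda>x. c)" for c
      using P_Re[OF trig_poly_const[of "of_real c"]] by simp
    show "continuous_on (sphere 0 1) f" if Pf: "P f" for f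
    proof -
      obtain p where p: "trig_poly p" "\<forall>z\<in>sphere 0 1. p z = complex_of_real (f z)"
        using Pf unfolding P_def by blast
      have "continuous_on (sphere 0 1) (\<lambda>z. Re (p z))"
        by (intro continuous_intros trig_poly_continuous_on p)
      then show ?thesis
        by (rule continuous_on_eq) (use p in auto)
    qed
    show "P (\<lambda>x. f x + g x)" "P (\<lambda>x. f x * g x)" if fg: "P f \<and> P g" for f g
    proof -
      obtain p q where p: "trig_poly p" "\<forall>z\<in>sphere 0 1. p z = complex_of_real (f z)"
        and q: "trig_poly q" "\<forall>z\<in>sphere 0 1. q z = complex_of_real (g z)"
        using fg unfolding P_def by blast
      then show "P (\<lambda>x. f x + g x)"
        unfolding P_def by (intro exI[of _ "\<lambda>z. p z + q z"]) (auto intro: trig_poly.add)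
      obtain r where "trig_poly r" "\<forall>z\<in>sphere 0 1. r z = p z * q z"
        using trig_poly_mult[OF p(1) q(1)] by blast
      with p q show "P (\<lambda>x. f x * g x)"
        unfolding P_def by (intro exI[of _ r]) auto
    qed
    \<comment> \<open>The imaginary part of \<open>z\<close> is the real part of
      \<open>- \<i> * z\<close>; the two coordinates separate points.\<close>
    have "P Re" "P Im"
      using P_Re[OF trig_poly.monom[of 1 1]] P_Re[OF trig_poly.monom[of "- \<i>" 1]] by simp_all
    then show "\<exists>f. P f \<and> f x \<noteq> f y" if "x \<in> sphere 0 1 \<and> y \<in> sphere 0 1 \<and> x \<noteq> y" for x y
      using that by (metis complex_eq_iff)
  qed simp
  then obtain g p where g: "\<forall>x\<in>sphere 0 1. \<bar>f x - g x\<bar> < e"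
    and p: "trig_poly p" "\<forall>z\<in>sphere 0 1. p z = complex_of_real (g z)"
    unfolding P_def by blast
  show ?thesis
    using g p by (intro exI[of _ p]) (simp flip: of_real_diff)
qed

lemma trig_poly_approx:
  fixes g :: "complex \<Rightarrow> complex"
  assumes g: "continuous_on (sphere 0 1) g" and "e > 0"
  obtains p where "trig_poly p" "\<And>z. z \<in> sphere 0 1 \<Longrightarrow> cmod (g z - p z) < e"
proof -
  have "continuous_on (sphere 0 1) (\<lambda>z. Re (g z))" "continuous_on (sphere 0 1) (\<lambda>z. Im (g z))"
    by (intro continuous_intros g)+
  then obtain p q where p: "trig_poly p" "\<forall>z\<in>sphere 0 1. cmod (of_real (Re (g z)) - p z) < e / 2"
    and q: "trig_poly q" "\<forall>z\<in>sphere 0 1. cmod (of_real (Im (g z)) - q z) < e / 2"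
    using trig_poly_real_approx[of _ "e / 2"] \<open>e > 0\<close> by (metis half_gt_zero)
  show thesis
  proof
    show "trig_poly (\<lambda>z. p z + \<i> * q z)"
      by (intro trig_poly.add trig_poly_scale p q)
    fix z :: complex assume z: "z \<in> sphere 0 1"
    have "g z - (p z + \<i> * q z) = (of_real (Re (g z)) - p z) + \<i> * (of_real (Im (g z)) - q z)"
      by (subst complex_eq[of "g z"]) (simp add: algebra_simps)
    also have "cmod \<dots> \<le> cmod (of_real (Re (g z)) - p z) + cmod (\<i> * (of_real (Im (g z)) - q z))"
      by (rule norm_triangle_ineq)
    also have "\<dots> < e"
      using bspec[OF p(2) z] bspec[OF q(2) z] unfolding norm_mult norm_ii by linarith
    finally show "cmod (g z - (p z + \<i> * q z)) < e" .
  qed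
qed

lemma continuous_on_sphere_bounded:
  fixes g :: "complex \<Rightarrow> complex"
  assumes "continuous_on (sphere 0 1) g"
  obtains K where "K \<ge> 0" "\<And>z. z \<in> sphere 0 1 \<Longrightarrow> cmod (g z) \<le> K"
proof -
  have "bounded (g ` sphere 0 1)"
    by (intro compact_imp_bounded compact_continuous_image assms compact_sphere)
  then obtain K where K: "\<And>z. z \<in> sphere 0 1 \<Longrightarrow> cmod (g z) \<le> K"
    unfolding bounded_iff by blast
  have "0 \<le> K"
    using K[of 1] by (rule order_trans[rotated]) auto
  with K show thesis using that by blast
qed

lemma AE_circleI: "(\<And>z. z \<in> sphere 0 1 \<Longrightarrow> P z) \<Longrightarrow> AE z in circle. P z"
  by (rule AE_I2) (simp add: space_circle)

text \<open>Indicators of compact sets are bounded pointwise limits of functions \<open>\<bar>p\<bar>\<^sup>2\<close>. Inner regularity then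
  handles the set where \<open>w\<close> is negative.\<close>

lemma AE_nonneg_if_trig_poly:
  fixes w :: "complex \<Rightarrow> real"
  assumes w: "integrable circle w"
    and nonneg: "\<And>p. trig_poly p \<Longrightarrow> 0 \<le> (\<integral>z. w z * (cmod (p z))\<^sup>2 \<partial>circle)"
  shows "AE z in circle. 0 \<le> w z"
proof -
  have [measurable]: "w \<in> borel_measurable circle"
    using w by (rule borel_measurable_integrable)
  have cpt: "0 \<le> (\<integral>z. w z * indicator F z \<partial>circle)" if F: "compact F" for F
  proof (cases "F = {}")
    case False
    \<comment> \<open>Continuous cutoffs that tend to the indicator of \<open>F\<close>. By
      convention \<open>infdist\<close> to the empty set is 0, so that case was split off.\<close>
    define g where "g n z = max 0 (1 - real n * infdist z F)" for n and z :: complex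
    have g01: "0 \<le> g n z" "g n z \<le> 1" for n z
      using infdist_nonneg[of z F] by (auto simp: g_def)
    have g: "continuous_on (sphere 0 1) (g n)" for n
      unfolding g_def by (intro continuous_intros)
    have "\<exists>p. trig_poly p \<and> (\<forall>z\<in>sphere 0 1. cmod (complex_of_real (g n z) - p z) < 1 / real (Suc n))" for n
      by (intro trig_poly_real_approx g) simp
    then obtain p where p: "\<And>n. trig_poly (p n)"
      "\<And>n z. z \<in> sphere 0 1 \<Longrightarrow> cmod (complex_of_real (g n z) - p n z) < 1 / real (Suc n)"
      by metis
    have [measurable]: "p n \<in> borel_measurable circle" for n
      by (intro continuous_on_measurable_circle trig_poly_continuous_on p)
    have "(\<lambda>z. indicator F z :: real) \<in> borel_measurable (restrict_space borel (sphere 0 1))"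
      using F by (intro measurable_restrict_space1 borel_measurable_indicator) (simp add: borel_compact)
    then have [measurable]: "(\<lambda>z. indicator F z :: real) \<in> borel_measurable circle"
      by (rule borel_measurable_circle)
    have "(\<lambda>n. \<integral>z. w z * (cmod (p n z))\<^sup>2 \<partial>circle) \<longlonglongrightarrow> (\<integral>z. w z * indicator F z \<partial>circle)"
    proof (rule integral_dominated_convergence)
      \<comment> \<open>On the circle \<open>cmod (p n z)\<close> is at most
        \<open>g n z + 1 / Suc n\<close>, hence at most 2.\<close>
      show "integrable circle (\<lambda>z. \<bar>w z\<bar> * 2\<^sup>2)"
        using w by simp
      show "AE z in circle. norm (w z * (cmod (p n z))\<^sup>2) \<le> \<bar>w z\<bar> * 2\<^sup>2" for n
      proof (rule AE_circleI)
        fix z :: complex assume z: "z \<in> sphere 0 1"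
        have "1 / real (Suc n) \<le> 1" by simp
        moreover have "cmod (p n z) - cmod (complex_of_real (g n z)) \<le> cmod (complex_of_real (g n z) - p n z)"
          by (subst norm_minus_commute) (rule norm_triangle_ineq2)
        moreover have "cmod (complex_of_real (g n z)) \<le> 1"
          using g01[of n z] by simp
        ultimately have "cmod (p n z) \<le> 2"
          using p(2)[OF z, of n] by linarith
        then show "norm (w z * (cmod (p n z))\<^sup>2) \<le> \<bar>w z\<bar> * 2\<^sup>2"
          unfolding real_norm_def abs_mult abs_power2 by (intro mult_left_mono power_mono) auto
      qed
      show "AE z in circle. (\<lambda>n. w z * (cmod (p n z))\<^sup>2) \<longlonglongrightarrow> w z * indicator F z"
      proof (rule AE_circleI)
        fix z :: complex assume z: "z \<in> sphere 0 1"
        have lim: "(\<lambda>n. g n z) \<longlonglongrightarrow> indicator F z"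
        proof (cases "z \<in> F")
          case True
          then show ?thesis by (simp add: g_def)
        next
          case notF: False
          then have pos: "infdist z F > 0"
            using False F compact_imp_closed[OF F] infdist_pos_not_in_closed by blast
          obtain N where N: "1 < real N * infdist z F"
            using reals_Archimedean3[OF pos] by blast
          have "g n z = indicator F z" if "n \<ge> N" for n
          proof -
            have "real N * infdist z F \<le> real n * infdist z F"
              using that pos by (intro mult_right_mono) auto
            then show ?thesis
              using N notF by (simp add: g_def max_def)
          qed
          then show ?thesis
            by (intro tendsto_eventually eventually_sequentiallyI[of N])
        qed
        have "(\<lambda>n. complex_of_real (g n z) - p n z) \<longlonglongrightarrow> 0"
          by (rule Lim_null_comparison[OF always_eventually LIMSEQ_Suc[OF lim_1_over_n]])
            (use p(2)[OF z] in \<open>simp add: less_imp_le\<close>)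
        from tendsto_diff[OF tendsto_of_real[OF lim] this]
        have "(\<lambda>n. p n z) \<longlonglongrightarrow> complex_of_real (indicator F z)" by simp
        then have "(\<lambda>n. w z * (cmod (p n z))\<^sup>2) \<longlonglongrightarrow> w z * (cmod (complex_of_real (indicator F z)))\<^sup>2"
          by (intro tendsto_intros)
        then show "(\<lambda>n. w z * (cmod (p n z))\<^sup>2) \<longlonglongrightarrow> w z * indicator F z"
          by (cases "z \<in> F") simp_all
      qed
    qed measurable
    then show ?thesis
      by (rule LIMSEQ_le_const) (use nonneg p in blast)
  qed simp
  \<comment> \<open>\<open>circle\<close> is the completion of \<open>D\<close>, while inner
    regularity concerns measures on the Borel sets of the plane. Therefore \<open>w\<close> is
    replaced by a Borel version \<open>w'\<close>, and \<open>D\<close> is pushed forward to the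
    plane.\<close>
  define D where "D = distr (uniform_measure lborel {0..2 * pi}) (restrict_space borel (sphere 0 1)) cis"
  have circle_D: "circle = completion D"
    by (simp add: circle_def D_def)
  have setsD: "sets D = sets (restrict_space borel (sphere 0 1))" and spD: "space D = sphere 0 1"
    by (simp_all add: D_def space_restrict_space)
  have "w \<in> borel_measurable (completion D)"
    using circle_D \<open>w \<in> borel_measurable circle\<close> by simp
  then obtain w' where w'[measurable]: "w' \<in> borel_measurable D" and AEw: "AE z in D. w z = w' z"
    using completion_ex_borel_measurable_real by blast
  define A where "A = {z \<in> space D. w' z < 0}"
  have A: "A \<in> sets D"
    unfolding A_def by measurable
  have sphere_borel: "sphere 0 1 \<inter> space borel \<in> sets (borel :: complex measure)"
    by simp
  have A_borel: "A \<in> sets borel"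
    using A unfolding setsD sets_restrict_space_iff[OF sphere_borel] by simp
  have "A \<subseteq> sphere 0 1"
    by (auto simp: A_def spD)
  define M where "M = distr D borel (\<lambda>z. z)"
  have idm: "(\<lambda>z. z) \<in> D \<rightarrow>\<^sub>M borel"
    unfolding measurable_cong_sets[OF setsD refl] by (intro measurable_restrict_space1) simp
  have M: "emeasure M K = emeasure D K" if "K \<in> sets borel" "K \<subseteq> sphere 0 1" for K
    unfolding M_def using that by (subst emeasure_distr[OF idm]) (auto simp: spD Int_absorb2 intro: arg_cong)
  have "prob_space D"
    unfolding D_def by (intro prob_space.prob_space_distr measurable_cis prob_space_uniform_measure) auto
  then have "prob_space M"
    unfolding M_def by (intro prob_space.prob_space_distr idm)
  then have "emeasure M (space M) \<noteq> \<infinity>"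
    by (simp add: prob_space.emeasure_space_1)
  then have "emeasure M A = (SUP K\<in>{K. K \<subseteq> A \<and> compact K}. emeasure M K)"
    by (intro inner_regular A_borel) (simp_all add: M_def)
  also have "\<dots> = (SUP K\<in>{K. K \<subseteq> A \<and> compact K}. 0)"
  proof (intro SUP_cong refl)
    fix K assume "K \<in> {K. K \<subseteq> A \<and> compact K}"
    then have K: "K \<subseteq> A" "compact K" by auto
    then have Ks: "K \<subseteq> sphere 0 1" and Kb: "K \<in> sets borel"
      using \<open>A \<subseteq> sphere 0 1\<close> by (auto simp: borel_compact)
    have KD: "K \<in> sets D"
      unfolding setsD sets_restrict_space_iff[OF sphere_borel] using Ks Kb by simp
    then have [measurable]: "K \<in> sets circle"
      by (simp add: circle_D)
    have AEw': "AE z in circle. w z = w' z"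
      unfolding circle_D using AEw by (rule AE_completion)
    have int: "integrable circle (\<lambda>z. - (w z * indicator K z))"
      using w by (intro integrable_minus integrable_real_mult_indicator) auto
    have nn: "AE z in circle. 0 \<le> - (w z * indicator K z)"
      using AEw' by eventually_elim (use K in \<open>auto simp: indicator_def A_def less_imp_le\<close>)
    \<comment> \<open>\<open>w\<close> is negative almost everywhere on \<open>K\<close>, yet its
      integral over \<open>K\<close> is nonnegative by the compact case; hence \<open>K\<close> is a
      null set.\<close>
    have "(\<integral>z. - (w z * indicator K z) \<partial>circle) \<le> 0"
      using cpt[OF K(2)] by simp
    then have "(\<integral>z. - (w z * indicator K z) \<partial>circle) = 0"
      using integral_nonneg_AE[OF nn] by linarith
    then have "AE z in circle. - (w z * indicator K z) = 0"
      using integral_nonneg_eq_0_iff_AE[OF int nn] by simp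
    with AEw' have "AE z in circle. z \<notin> K"
      by eventually_elim (use K in \<open>auto simp: A_def\<close>)
    then have "AE z in D. z \<notin> K"
      unfolding circle_D AE_completion_iff .
    then show "emeasure M K = 0"
      using KD by (simp add: M[OF Kb Ks] AE_iff_null_sets null_setsD1)
  qed
  also have "\<dots> = 0" by (intro SUP_eq_const) auto
  finally have "emeasure D A = 0"
    by (simp add: M[OF A_borel \<open>A \<subseteq> sphere 0 1\<close>])
  then have "AE z in D. z \<notin> A"
    using A by (intro AE_not_in) (simp add: null_setsI)
  with AEw have "AE z in D. 0 \<le> w z"
    using AE_space[of D] by eventually_elim (auto simp: A_def)
  then show ?thesis
    unfolding circle_D by (rule AE_completion)
qed

section \<open>Multiplication operators on \<open>L\<^sup>2\<close>\<close>

lemma L2_eqI: "(AE z in circle. rep_L2 f z = rep_L2 g z) \<Longrightarrow> f = g"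
  using Quotient3_rel_rep[OF Quotient3_L2] rep_L2_square_integrable by metis

lemma abs_L2_cong:
  assumes "f \<in> square_integrable" "g \<in> square_integrable" "AE z in circle. f z = g z"
  shows "abs_L2 f = abs_L2 g"
  using assms Quotient3_rel[OF Quotient3_L2] by metis

lemma rep_L2_measurable [measurable]: "rep_L2 f \<in> borel_measurable circle"
  by (rule square_integrable_measurable[OF rep_L2_square_integrable])

lemma norm_L2_square: "(norm f)\<^sup>2 = (\<integral>z. (cmod (rep_L2 f z))\<^sup>2 \<partial>circle)"
proof -
  have "cinner f f = (\<integral>z. of_real ((cmod (rep_L2 f z))\<^sup>2) \<partial>circle)"
    unfolding cinner_L2.rep_eq complex_norm_square ..
  then show ?thesis
    by (simp add: cinner_self integral_complex_of_real del: of_real_power)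
qed

lemma integrable_L2_square: "integrable circle (\<lambda>z. (cmod (rep_L2 f z))\<^sup>2)"
  using rep_L2_square_integrable[of f] by (simp add: square_integrable_def)

lemma cinner_abs_L2:
  assumes "f \<in> square_integrable" "g \<in> square_integrable"
  shows "cinner (abs_L2 f) (abs_L2 g) = (\<integral>z. f z * cnj (g z) \<partial>circle)"
  using assms by (subst cinner_L2.abs_eq) auto

lemma rep_L2_add: "AE z in circle. rep_L2 (f + g) z = rep_L2 f z + rep_L2 g z"
proof -
  have "f + g = abs_L2 (\<lambda>z. rep_L2 f z + rep_L2 g z)"
    using plus_L2.abs_eq[of "rep_L2 f" "rep_L2 g"] rep_L2_square_integrable by (simp add: abs_rep_L2)
  then show ?thesis
    using rep_abs_L2 square_integrable_add rep_L2_square_integrable by metis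
qed

lemma rep_L2_scaleC: "AE z in circle. rep_L2 (c *\<^sub>C f) z = c * rep_L2 f z"
proof -
  have "c *\<^sub>C f = abs_L2 (\<lambda>z. c * rep_L2 f z)"
    using scaleC_L2.abs_eq[of "rep_L2 f" c] rep_L2_square_integrable by (simp add: abs_rep_L2)
  then show ?thesis
    using rep_abs_L2 square_integrable_scale rep_L2_square_integrable by metis
qed

lemma rep_L2_diff: "AE z in circle. rep_L2 (f - g) z = rep_L2 f z - rep_L2 g z"
proof -
  have "f - g = abs_L2 (\<lambda>z. rep_L2 f z - rep_L2 g z)"
    using abs_L2_diff[of "rep_L2 f" "rep_L2 g"] rep_L2_square_integrable by (simp add: abs_rep_L2)
  then show ?thesis
    using rep_abs_L2 square_integrable_diff rep_L2_square_integrable by metis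
qed

lemma abs_L2_add:
  "f \<in> square_integrable \<Longrightarrow> g \<in> square_integrable \<Longrightarrow> abs_L2 f + abs_L2 g = abs_L2 (\<lambda>z. f z + g z)"
  by (subst plus_L2.abs_eq) auto

lemma abs_L2_scaleC: "f \<in> square_integrable \<Longrightarrow> c *\<^sub>C abs_L2 f = abs_L2 (\<lambda>z. c * f z)"
  by (subst scaleC_L2.abs_eq) auto

lemma L_infinity_measurable: "\<phi> \<in> L_infinity \<Longrightarrow> \<phi> \<in> borel_measurable circle"
  by (simp add: L_infinity_def)

lemma L_infinityE:
  assumes "\<phi> \<in> L_infinity"
  obtains K where "K \<ge> 0" "AE z in circle. cmod (\<phi> z) \<le> K"
proof -
  obtain K where "AE z in circle. cmod (\<phi> z) \<le> K"
    using assms unfolding L_infinity_def by blast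
  then have "AE z in circle. cmod (\<phi> z) \<le> max 0 K"
    by eventually_elim auto
  then show thesis
    using that[of "max 0 K"] by simp
qed

lemma L_infinityI: "\<phi> \<in> borel_measurable circle \<Longrightarrow> AE z in circle. cmod (\<phi> z) \<le> K \<Longrightarrow> \<phi> \<in> L_infinity"
  unfolding L_infinity_def by blast

lemma L_infinity_mult:
  assumes "\<phi> \<in> L_infinity" "\<psi> \<in> L_infinity"
  shows "(\<lambda>z. \<phi> z * \<psi> z) \<in> L_infinity"
proof -
  obtain K L where K: "K \<ge> 0" "AE z in circle. cmod (\<phi> z) \<le> K" and L: "L \<ge> 0" "AE z in circle. cmod (\<psi> z) \<le> L"
    using assms by (metis L_infinityE)
  show ?thesis
  proof (rule L_infinityI[where K = "K * L"])
    show "AE z in circle. cmod (\<phi> z * \<psi> z) \<le> K * L"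
      using K(2) L(2) by eventually_elim (auto simp: norm_mult intro!: mult_mono K(1))
  qed (use assms in \<open>auto intro: borel_measurable_times L_infinity_measurable\<close>)
qed

lemma L_infinity_add:
  assumes "\<phi> \<in> L_infinity" "\<psi> \<in> L_infinity"
  shows "(\<lambda>z. \<phi> z + \<psi> z) \<in> L_infinity"
proof -
  obtain K L where K: "AE z in circle. cmod (\<phi> z) \<le> K" and L: "AE z in circle. cmod (\<psi> z) \<le> L"
    using assms by (metis L_infinityE)
  show ?thesis
  proof (rule L_infinityI[where K = "K + L"])
    show "AE z in circle. cmod (\<phi> z + \<psi> z) \<le> K + L"
      using K L by eventually_elim (use norm_triangle_mono in blast)
  qed (use assms in \<open>auto intro: borel_measurable_add L_infinity_measurable\<close>)
qed

lemma continuous_L_infinity: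
  assumes "continuous_on (sphere 0 1) g"
  shows "g \<in> L_infinity"
proof -
  obtain K where "\<And>z. z \<in> sphere 0 1 \<Longrightarrow> cmod (g z) \<le> K"
    using continuous_on_sphere_bounded[OF assms] by blast
  then show ?thesis
    using continuous_on_measurable_circle[OF assms] by (intro L_infinityI[where K = K] AE_circleI)
qed

lemma trig_poly_L_infinity: "trig_poly p \<Longrightarrow> p \<in> L_infinity"
  by (intro continuous_L_infinity trig_poly_continuous_on)

lemma powi_L_infinity: "(\<lambda>z. z powi n) \<in> L_infinity"
  by (intro trig_poly_L_infinity trig_poly_powi)

lemma const_L_infinity: "(\<lambda>z. c) \<in> L_infinity"
  by (intro trig_poly_L_infinity trig_poly_const)

lemma L_infinity_diff:
  assumes "\<phi> \<in> L_infinity" "\<psi> \<in> L_infinity"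
  shows "(\<lambda>z. \<phi> z - \<psi> z) \<in> L_infinity"
  using L_infinity_add[OF assms(1) L_infinity_mult[OF const_L_infinity[of "-1"] assms(2)]] by simp

lemma L_infinity_cnj:
  assumes "\<phi> \<in> L_infinity"
  shows "(\<lambda>z. cnj (\<phi> z)) \<in> L_infinity"
proof -
  obtain K where "AE z in circle. cmod (\<phi> z) \<le> K"
    using assms by (metis L_infinityE)
  moreover have "(\<lambda>z. cnj (\<phi> z)) \<in> borel_measurable circle"
    by (rule borel_measurable_continuous_on[OF continuous_on_cnj[OF continuous_on_id] L_infinity_measurable[OF assms]])
  ultimately show ?thesis
    by (intro L_infinityI[where K = K]) auto
qed

lemma square_integrable_mult:
  assumes \<phi>: "\<phi> \<in> L_infinity" and f: "f \<in> square_integrable"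
  shows "(\<lambda>z. \<phi> z * f z) \<in> square_integrable"
proof -
  obtain K where K: "K \<ge> 0" "AE z in circle. cmod (\<phi> z) \<le> K"
    using \<phi> by (rule L_infinityE)
  have [measurable]: "\<phi> \<in> borel_measurable circle" "f \<in> borel_measurable circle"
    using \<phi> f by (simp_all add: L_infinity_measurable square_integrable_measurable)
  have "integrable circle (\<lambda>z. K\<^sup>2 * (cmod (f z))\<^sup>2)"
    using f by (simp add: square_integrable_def)
  then have "integrable circle (\<lambda>z. (cmod (\<phi> z * f z))\<^sup>2)"
  proof (rule Bochner_Integration.integrable_bound)
    show "AE z in circle. norm ((cmod (\<phi> z * f z))\<^sup>2) \<le> norm (K\<^sup>2 * (cmod (f z))\<^sup>2)"
      using K(2) by eventually_elim (auto simp: norm_mult power_mult_distrib intro!: mult_right_mono power_mono)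
  qed measurable
  then show ?thesis
    by (simp add: square_integrable_def)
qed

lemma L_infinity_square_integrable:
  assumes "\<phi> \<in> L_infinity" shows "\<phi> \<in> square_integrable"
  using square_integrable_mult[OF assms square_integrable_powi[of 0]] by simp

lemma multiplication_abs_L2:
  assumes "\<phi> \<in> L_infinity" "g \<in> square_integrable"
  shows "multiplication \<phi> (abs_L2 g) = abs_L2 (\<lambda>z. \<phi> z * g z)"
  unfolding multiplication_def
proof (rule abs_L2_cong)
  show "AE z in circle. \<phi> z * rep_L2 (abs_L2 g) z = \<phi> z * g z"
    using rep_abs_L2[OF assms(2)] by eventually_elim simp
qed (intro square_integrable_mult assms rep_L2_square_integrable)+

lemma rep_multiplication:
  assumes "\<phi> \<in> L_infinity"
  shows "AE z in circle. rep_L2 (multiplication \<phi> f) z = \<phi> z * rep_L2 f z"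
  unfolding multiplication_def by (intro rep_abs_L2 square_integrable_mult assms rep_L2_square_integrable)

lemma multiplication_cong:
  assumes "\<phi> \<in> L_infinity" "\<psi> \<in> L_infinity" "AE z in circle. \<phi> z = \<psi> z"
  shows "multiplication \<phi> f = multiplication \<psi> f"
  unfolding multiplication_def
  by (intro abs_L2_cong square_integrable_mult assms rep_L2_square_integrable)
    (use assms(3) in \<open>eventually_elim, simp\<close>)

lemma multiplication_add:
  assumes "\<phi> \<in> L_infinity"
  shows "multiplication \<phi> (f + g) = multiplication \<phi> f + multiplication \<phi> g"
  by (rule L2_eqI) (use rep_multiplication[OF assms, of "f + g"] rep_multiplication[OF assms, of f]
    rep_multiplication[OF assms, of g] rep_L2_add[of f g] rep_L2_add[of "multiplication \<phi> f" "multiplication \<phi> g"]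
    in \<open>eventually_elim, simp add: distrib_left\<close>)

lemma multiplication_scaleC:
  assumes "\<phi> \<in> L_infinity"
  shows "multiplication \<phi> (c *\<^sub>C f) = c *\<^sub>C multiplication \<phi> f"
  by (rule L2_eqI) (use rep_multiplication[OF assms, of "c *\<^sub>C f"] rep_multiplication[OF assms, of f]
    rep_L2_scaleC[of c f] rep_L2_scaleC[of c "multiplication \<phi> f"]
    in \<open>eventually_elim, simp\<close>)

lemma multiplication_multiplication:
  assumes "\<phi> \<in> L_infinity" "\<psi> \<in> L_infinity"
  shows "multiplication \<phi> (multiplication \<psi> f) = multiplication (\<lambda>z. \<phi> z * \<psi> z) f"
  by (rule L2_eqI) (use rep_multiplication[OF assms(1), of "multiplication \<psi> f"] rep_multiplication[OF assms(2), of f]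
    rep_multiplication[OF L_infinity_mult[OF assms], of f]
    in \<open>eventually_elim, simp\<close>)

lemma multiplication_add_symbol:
  assumes "\<phi> \<in> L_infinity" "\<psi> \<in> L_infinity"
  shows "multiplication (\<lambda>z. \<phi> z + \<psi> z) f = multiplication \<phi> f + multiplication \<psi> f"
  by (rule L2_eqI) (use rep_multiplication[OF assms(1), of f] rep_multiplication[OF assms(2), of f]
    rep_multiplication[OF L_infinity_add[OF assms], of f] rep_L2_add[of "multiplication \<phi> f" "multiplication \<psi> f"]
    in \<open>eventually_elim, simp add: distrib_right\<close>)

lemma multiplication_const: "multiplication (\<lambda>z. c) f = c *\<^sub>C f"
  by (rule L2_eqI) (use rep_multiplication[OF const_L_infinity, of c f] rep_L2_scaleC[of c f]
    in \<open>eventually_elim, simp\<close>)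

lemma multiplication_norm_square:
  assumes "\<phi> \<in> L_infinity"
  shows "(norm (multiplication \<phi> f))\<^sup>2 = (\<integral>z. (cmod (\<phi> z))\<^sup>2 * (cmod (rep_L2 f z))\<^sup>2 \<partial>circle)"
proof -
  have [measurable]: "\<phi> \<in> borel_measurable circle"
    by (rule L_infinity_measurable[OF assms])
  show ?thesis
    unfolding norm_L2_square
    by (rule integral_cong_AE)
      (measurable, use rep_multiplication[OF assms, of f] in \<open>eventually_elim, simp add: norm_mult power_mult_distrib\<close>)
qed

lemma multiplication_norm_le:
  assumes \<phi>: "\<phi> \<in> L_infinity" and K: "K \<ge> 0" "AE z in circle. cmod (\<phi> z) \<le> K"
  shows "norm (multiplication \<phi> f) \<le> K * norm f"
proof (rule power2_le_imp_le)
  have [measurable]: "\<phi> \<in> borel_measurable circle"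
    by (rule L_infinity_measurable[OF \<phi>])
  have "integrable circle (\<lambda>z. (cmod (\<phi> z * rep_L2 f z))\<^sup>2)"
    using square_integrable_mult[OF \<phi> rep_L2_square_integrable[of f]] by (simp add: square_integrable_def)
  then have "(norm (multiplication \<phi> f))\<^sup>2 \<le> (\<integral>z. K\<^sup>2 * (cmod (rep_L2 f z))\<^sup>2 \<partial>circle)"
    unfolding multiplication_norm_square[OF \<phi>]
    by (intro integral_mono_AE)
      (use K integrable_L2_square[of f] in \<open>auto simp: norm_mult power_mult_distrib
        intro!: mult_right_mono power_mono elim!: eventually_mono\<close>)
  then show "(norm (multiplication \<phi> f))\<^sup>2 \<le> (K * norm f)\<^sup>2"
    by (simp add: power_mult_distrib norm_L2_square)
qed (use K in simp)

lemma multiplication_norm_eq: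
  assumes \<phi>: "\<phi> \<in> L_infinity" and "AE z in circle. cmod (\<phi> z) = K"
  shows "(norm (multiplication \<phi> f))\<^sup>2 = K\<^sup>2 * (norm f)\<^sup>2"
proof -
  have [measurable]: "\<phi> \<in> borel_measurable circle"
    by (rule L_infinity_measurable[OF \<phi>])
  have "(norm (multiplication \<phi> f))\<^sup>2 = (\<integral>z. K\<^sup>2 * (cmod (rep_L2 f z))\<^sup>2 \<partial>circle)"
    unfolding multiplication_norm_square[OF \<phi>]
    by (rule integral_cong_AE) (measurable, use assms(2) in \<open>eventually_elim, simp\<close>)
  then show ?thesis
    by (simp add: norm_L2_square)
qed

lemma bounded_clinear_multiplication:
  assumes "\<phi> \<in> L_infinity" shows "bounded_clinear (multiplication \<phi>)"
proof -
  obtain K where "K \<ge> 0" "AE z in circle. cmod (\<phi> z) \<le> K"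
    using assms by (rule L_infinityE)
  then show ?thesis
    using multiplication_norm_le[OF assms]
    by (intro bounded_clinearI[where K = K]) (simp_all add: multiplication_add multiplication_scaleC assms mult.commute)
qed

lemma bounded_linear_multiplication: "\<phi> \<in> L_infinity \<Longrightarrow> bounded_linear (multiplication \<phi>)"
  by (intro bounded_clinear_imp_bounded_linear bounded_clinear_multiplication)

lemma multiplication_adjoint:
  assumes "\<phi> \<in> L_infinity"
  shows "cinner (multiplication \<phi> f) g = cinner f (multiplication (\<lambda>z. cnj (\<phi> z)) g)"
proof -
  have "cinner (multiplication \<phi> f) g = cinner (multiplication \<phi> f) (abs_L2 (rep_L2 g))"
    by (simp add: abs_rep_L2)
  also have "\<dots> = (\<integral>z. (\<phi> z * rep_L2 f z) * cnj (rep_L2 g z) \<partial>circle)"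
    unfolding multiplication_def
    by (intro cinner_abs_L2 square_integrable_mult assms rep_L2_square_integrable)
  also have "\<dots> = (\<integral>z. rep_L2 f z * cnj (cnj (\<phi> z) * rep_L2 g z) \<partial>circle)"
    by (simp add: mult_ac)
  also have "\<dots> = cinner (abs_L2 (rep_L2 f)) (multiplication (\<lambda>z. cnj (\<phi> z)) g)"
    unfolding multiplication_def
    by (intro cinner_abs_L2[symmetric] square_integrable_mult L_infinity_cnj assms rep_L2_square_integrable)
  finally show ?thesis
    by (simp add: abs_rep_L2)
qed

section \<open>Fourier coefficients and the projection onto \<open>H\<^sup>2\<close>\<close>

definition zpow :: "int \<Rightarrow> L2" where
  "zpow n = abs_L2 (\<lambda>z. z powi n)"

abbreviation fcoeff :: "L2 \<Rightarrow> int \<Rightarrow> complex" where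
  "fcoeff f n \<equiv> cinner f (zpow n)"

definition shift :: "int \<Rightarrow> L2 \<Rightarrow> L2" where
  "shift n = multiplication (\<lambda>z. z powi n)"

lemma bounded_clinear_shift: "bounded_clinear (shift n)"
  unfolding shift_def by (rule bounded_clinear_multiplication[OF powi_L_infinity])

lemmas bounded_linear_shift = bounded_clinear_imp_bounded_linear[OF bounded_clinear_shift]
  and shift_add = bounded_clinear_add[OF bounded_clinear_shift]
  and shift_scaleC = bounded_clinear_scaleC[OF bounded_clinear_shift]

lemma shift_diff: "shift n (f - g) = shift n f - shift n g"
  by (rule linear_diff[OF bounded_linear.linear[OF bounded_linear_shift]])

lemma shift_zpow: "shift m (zpow n) = zpow (m + n)"
  unfolding shift_def zpow_def multiplication_abs_L2[OF powi_L_infinity square_integrable_powi]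
proof (rule abs_L2_cong[OF square_integrable_mult[OF powi_L_infinity square_integrable_powi]
      square_integrable_powi AE_circleI])
  fix z :: complex assume "z \<in> sphere 0 1"
  then have "z \<noteq> 0" by auto
  then show "z powi m * z powi n = z powi (m + n)"
    by (simp add: power_int_add)
qed

lemma shift_shift: "shift m (shift n f) = shift (m + n) f"
  unfolding shift_def multiplication_multiplication[OF powi_L_infinity powi_L_infinity]
proof (rule multiplication_cong[OF L_infinity_mult[OF powi_L_infinity powi_L_infinity]
      powi_L_infinity AE_circleI])
  fix z :: complex assume "z \<in> sphere 0 1"
  then have "z \<noteq> 0" by auto
  then show "z powi m * z powi n = z powi (m + n)"
    by (simp add: power_int_add)
qed

lemma shift_0: "shift 0 f = f"
  using multiplication_const[of 1 f] by (simp add: shift_def)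

lemma norm_shift: "norm (shift n f) = norm f"
proof -
  have "(norm (shift n f))\<^sup>2 = 1\<^sup>2 * (norm f)\<^sup>2"
    unfolding shift_def by (rule multiplication_norm_eq[OF powi_L_infinity]) (auto intro!: AE_circleI simp: norm_power_int)
  then show ?thesis by simp
qed

lemma cinner_shift: "cinner (shift n f) g = cinner f (shift (- n) g)"
proof -
  have "multiplication (\<lambda>z. cnj (z powi n)) g = shift (- n) g"
    unfolding shift_def
    by (rule multiplication_cong[OF L_infinity_cnj[OF powi_L_infinity] powi_L_infinity
        AE_circleI[OF cnj_powi_sphere]])
  then show ?thesis
    unfolding shift_def[of n] by (simp only: multiplication_adjoint[OF powi_L_infinity])
qed

lemma coeff_shift: "fcoeff (shift n f) k = fcoeff f (k - n)"
  by (simp add: cinner_shift shift_zpow)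

lemma coeff_zpow: "fcoeff (zpow m) n = (if m = n then 1 else 0)"
proof -
  have "fcoeff (zpow m) n = (\<integral>z. z powi m * cnj (z powi n) \<partial>circle)"
    unfolding zpow_def by (intro cinner_abs_L2 square_integrable_powi)
  also have "\<dots> = (\<integral>z. z powi (m - n) \<partial>circle)"
  proof (rule Bochner_Integration.integral_cong[OF refl])
    fix z assume "z \<in> space circle"
    then have z: "z \<in> sphere 0 1" by (simp add: space_circle)
    then have "z \<noteq> 0" by auto
    then show "z powi m * cnj (z powi n) = z powi (m - n)"
      unfolding cnj_powi_sphere[OF z] by (simp flip: power_int_add)
  qed
  finally show ?thesis
    by (simp add: integral_powi)
qed

lemma orthonormal_zpow: "inj e \<Longrightarrow> orthonormal (\<lambda>i. zpow (e i))"
  by (auto simp: orthonormal_def coeff_zpow dest: injD)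

lemma coeff_trig_poly_eq_0:
  assumes f: "\<And>n. fcoeff f n = 0" and "trig_poly p"
  shows "cinner f (abs_L2 p) = 0"
  using assms(2)
proof (induction rule: trig_poly.induct)
  case (monom c n)
  have "abs_L2 (\<lambda>z. c * z powi n) = c *\<^sub>C zpow n"
    unfolding zpow_def by (rule abs_L2_scaleC[symmetric, OF square_integrable_powi])
  then show ?case by (simp add: cinner_scaleC_right f)
next
  case (add p q)
  then have "abs_L2 (\<lambda>z. p z + q z) = abs_L2 p + abs_L2 q"
    by (intro abs_L2_add[symmetric] L_infinity_square_integrable trig_poly_L_infinity)
  with add show ?case by (simp add: cinner_add_right)
qed

text \<open>Completeness of the monomials: \<open>f\<close> integrates to 0 against every
  \<open>|p|^2\<close>, so the sign criterion applies to the real and imaginary parts and to their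
  negatives.\<close>

lemma coeff_eq_0_imp_eq_0:
  assumes f: "\<And>n. fcoeff f n = 0"
  shows "f = 0"
proof -
  define h where "h = rep_L2 f"
  have h: "h \<in> square_integrable"
    by (simp add: h_def rep_L2_square_integrable)
  have "integrable circle (\<lambda>z. h z * cnj 1)"
    using square_integrable_prod[OF h square_integrable_powi[of 0]] by simp
  then have int: "integrable circle h" by simp
  have zero: "(\<integral>z. h z * of_real ((cmod (p z))\<^sup>2) \<partial>circle) = 0 \<and> integrable circle (\<lambda>z. h z * of_real ((cmod (p z))\<^sup>2))"
    if p: "trig_poly p" for p
  proof -
    obtain q where q: "trig_poly q" "\<forall>z\<in>sphere 0 1. q z = cnj (p z)"
      using trig_poly_cnj[OF p] by blast
    obtain r where r: "trig_poly r" "\<forall>z\<in>sphere 0 1. r z = p z * q z"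
      using trig_poly_mult[OF p q(1)] by blast
    have eq: "h z * cnj (r z) = h z * of_real ((cmod (p z))\<^sup>2)" if "z \<in> space circle" for z
      using that q r unfolding space_circle complex_norm_square by (simp add: mult.commute)
    have rs: "r \<in> square_integrable"
      by (intro L_infinity_square_integrable trig_poly_L_infinity r)
    have "(\<integral>z. h z * cnj (r z) \<partial>circle) = cinner f (abs_L2 r)"
      using cinner_abs_L2[OF h rs] by (simp add: h_def abs_rep_L2)
    then have "(\<integral>z. h z * cnj (r z) \<partial>circle) = 0"
      using coeff_trig_poly_eq_0[OF f r(1)] by simp
    moreover have "(\<integral>z. h z * cnj (r z) \<partial>circle) = (\<integral>z. h z * of_real ((cmod (p z))\<^sup>2) \<partial>circle)"
      by (rule Bochner_Integration.integral_cong[OF refl eq])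
    moreover have "integrable circle (\<lambda>z. h z * of_real ((cmod (p z))\<^sup>2))"
      using square_integrable_prod[OF h rs] by (subst Bochner_Integration.integrable_cong[OF refl eq[symmetric]])
    ultimately show ?thesis by simp
  qed
  have Re0: "(\<integral>z. Re (h z) * (cmod (p z))\<^sup>2 \<partial>circle) = 0" if "trig_poly p" for p
    using zero[OF that] integral_Re[of circle "\<lambda>z. h z * of_real ((cmod (p z))\<^sup>2)"] by simp
  have Im0: "(\<integral>z. Im (h z) * (cmod (p z))\<^sup>2 \<partial>circle) = 0" if "trig_poly p" for p
    using zero[OF that] integral_Im[of circle "\<lambda>z. h z * of_real ((cmod (p z))\<^sup>2)"] by simp
  have "AE z in circle. 0 \<le> Re (h z)" "AE z in circle. 0 \<le> - Re (h z)"
    "AE z in circle. 0 \<le> Im (h z)" "AE z in circle. 0 \<le> - Im (h z)"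
    by (rule AE_nonneg_if_trig_poly; use int Re0 Im0 in simp)+
  then have "AE z in circle. rep_L2 f z = rep_L2 0 z"
    using rep_abs_L2[OF square_integrable_zero]
    unfolding zero_L2_def[symmetric] by eventually_elim (simp add: complex_eq_iff h_def)
  then show ?thesis by (rule L2_eqI)
qed

lemma eq_if_coeff_eq: "(\<And>n. fcoeff f n = fcoeff g n) \<Longrightarrow> f = g"
  using coeff_eq_0_imp_eq_0[of "f - g"] by (simp add: cinner.diff_left)

section \<open>The Hardy space in terms of Fourier coefficients, and its projection\<close>

lemma hardy_iff: "f \<in> hardy_space \<longleftrightarrow> (\<forall>n<0. fcoeff f n = 0)"
  by (simp add: hardy_space_def fourier_coeff_eq_cinner zpow_def)

lemma hardyD: "f \<in> hardy_space \<Longrightarrow> n < 0 \<Longrightarrow> fcoeff f n = 0"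
  by (simp add: hardy_iff)

lemma zpow_hardy: "n \<ge> 0 \<Longrightarrow> zpow n \<in> hardy_space"
  by (simp add: hardy_iff coeff_zpow)

lemmas hardy_add = complex_vector.subspace_add[OF hardy_space_subspace]
  and hardy_diff = complex_vector.subspace_diff[OF hardy_space_subspace]
  and hardy_scale = complex_vector.subspace_scale[OF hardy_space_subspace]
  and hardy_sum = complex_vector.subspace_sum[OF hardy_space_subspace]

lemma shift_hardy: "f \<in> hardy_space \<Longrightarrow> n \<ge> 0 \<Longrightarrow> shift n f \<in> hardy_space"
  by (simp add: hardy_iff coeff_shift)

lemma orthonormal_zpow_nat: "orthonormal (\<lambda>k::nat. zpow (int k))"
  by (rule orthonormal_zpow) (simp add: inj_def)

lemma orthonormal_zpow_neg: "orthonormal (\<lambda>k::nat. zpow (- 1 - int k))"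
  by (rule orthonormal_zpow) (simp add: inj_def)

abbreviation fourier_nonneg :: "L2 \<Rightarrow> nat \<Rightarrow> L2" where
  "fourier_nonneg f \<equiv> \<lambda>n. \<Sum>k<n. fcoeff f (int k) *\<^sub>C zpow (int k)"

abbreviation fourier_neg :: "L2 \<Rightarrow> nat \<Rightarrow> L2" where
  "fourier_neg f \<equiv> \<lambda>n. \<Sum>k<n. fcoeff f (- 1 - int k) *\<^sub>C zpow (- 1 - int k)"

text \<open>Both one-sided series converge by Bessel's inequality; completeness of the monomials
  identifies their sum. The exponents \<open>- 1 - int k\<close> enumerate the negative
  integers.\<close>

lemma fourier_decomposition:
  "\<exists>y y'. fourier_nonneg f \<longlonglongrightarrow> y \<and>
    fourier_neg f \<longlonglongrightarrow> y' \<and>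
    f = y + y' \<and> (\<forall>n. fcoeff y n = (if n \<ge> 0 then fcoeff f n else 0)) \<and>
    (\<forall>n. fcoeff y' n = (if n \<ge> 0 then 0 else fcoeff f n))"
proof -
  obtain y where y: "fourier_nonneg f \<longlonglongrightarrow> y"
    "\<And>k. fcoeff (f - y) (int k) = 0"
    using orthonormal_projection_exists[OF orthonormal_zpow_nat] by blast
  obtain y' where y': "fourier_neg f \<longlonglongrightarrow> y'"
    "\<And>k. fcoeff (f - y') (- 1 - int k) = 0"
    using orthonormal_projection_exists[OF orthonormal_zpow_neg] by blast
  have cy: "fcoeff y n = (if n \<ge> 0 then fcoeff f n else 0)" for n
  proof (cases "n \<ge> 0")
    case True
    then show ?thesis using y(2)[of "nat n"] by (simp add: cinner.diff_left)
  next
    case False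
    have "(\<lambda>m. fcoeff (fourier_nonneg f m) n) \<longlonglongrightarrow> fcoeff y n"
      by (intro cinner.tendsto y tendsto_const)
    moreover have "fcoeff (fourier_nonneg f m) n = 0" for m
      using False by (simp add: cinner.sum_left cinner_scaleC_left coeff_zpow)
    ultimately show ?thesis using False by (simp add: LIMSEQ_const_iff)
  qed
  have cy': "fcoeff y' n = (if n \<ge> 0 then 0 else fcoeff f n)" for n
  proof (cases "n \<ge> 0")
    case False
    then show ?thesis using y'(2)[of "nat (- 1 - n)"] by (simp add: cinner.diff_left)
  next
    case True
    have "(\<lambda>m. fcoeff (fourier_neg f m) n) \<longlonglongrightarrow> fcoeff y' n"
      by (intro cinner.tendsto y' tendsto_const)
    moreover have "fcoeff (fourier_neg f m) n = 0" for m
      using True by (simp add: cinner.sum_left cinner_scaleC_left coeff_zpow)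
    ultimately show ?thesis using True by (simp add: LIMSEQ_const_iff)
  qed
  have "f = y + y'"
    by (rule eq_if_coeff_eq) (simp add: cinner_add_left cy cy')
  with y(1) y'(1) cy cy' show ?thesis
    by (intro exI[of _ y] exI[of _ y']) simp
qed

lemma hardy_expansion:
  assumes "f \<in> hardy_space"
  shows "fourier_nonneg f \<longlonglongrightarrow> f"
proof -
  obtain y y' where y: "fourier_nonneg f \<longlonglongrightarrow> y"
    "fourier_neg f \<longlonglongrightarrow> y'"
    "f = y + y'" "\<forall>n. fcoeff y n = (if n \<ge> 0 then fcoeff f n else 0)"
    "\<forall>n. fcoeff y' n = (if n \<ge> 0 then 0 else fcoeff f n)"
    using fourier_decomposition[of f] by (elim exE conjE)
  have "y = f"
    by (rule eq_if_coeff_eq) (use assms in \<open>simp add: y(4) hardy_iff\<close>)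
  then show ?thesis using y(1) by simp
qed

lemma cinner_hardy_eq_0:
  assumes "\<And>n. n \<ge> 0 \<Longrightarrow> fcoeff g n = 0" "f \<in> hardy_space"
  shows "cinner g f = 0"
proof -
  have "(\<lambda>n. cinner g (fourier_nonneg f n)) \<longlonglongrightarrow> cinner g f"
    by (intro cinner.tendsto hardy_expansion assms tendsto_const)
  moreover have "cinner g (fourier_nonneg f n) = 0" for n
    by (simp add: cinner.sum_right cinner_scaleC_right assms)
  ultimately show ?thesis by (simp add: LIMSEQ_const_iff)
qed

abbreviation hardy_proj :: "L2 \<Rightarrow> L2" where
  "hardy_proj \<equiv> orthogonal_projection hardy_space"

lemma hardy_proj_eqI:
  assumes "y \<in> hardy_space" "\<And>n. n \<ge> 0 \<Longrightarrow> fcoeff y n = fcoeff f n"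
  shows "hardy_proj f = y"
  unfolding orthogonal_projection_def
proof (rule the_equality)
  show "y \<in> hardy_space \<and> (\<forall>z\<in>hardy_space. cinner (f - y) z = 0)"
    by (intro conjI ballI assms(1), rule cinner_hardy_eq_0) (simp_all add: cinner.diff_left assms(2))
  show "y' = y" if y': "y' \<in> hardy_space \<and> (\<forall>z\<in>hardy_space. cinner (f - y') z = 0)" for y'
  proof (rule eq_if_coeff_eq)
    fix n
    show "fcoeff y' n = fcoeff y n"
    proof (cases "n \<ge> 0")
      case True
      then have "fcoeff (f - y') n = 0" using y' zpow_hardy by blast
      then show ?thesis using assms(2)[OF True] by (simp add: cinner.diff_left)
    next
      case False
      then show ?thesis using assms(1) y' by (simp add: hardy_iff)
    qed
  qed
qed

lemma hardy_proj_hardy: "hardy_proj f \<in> hardy_space"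
  and coeff_hardy_proj: "fcoeff (hardy_proj f) n = (if n \<ge> 0 then fcoeff f n else 0)"
proof -
  obtain y y' where y: "fourier_nonneg f \<longlonglongrightarrow> y"
    "fourier_neg f \<longlonglongrightarrow> y'"
    "f = y + y'" "\<forall>n. fcoeff y n = (if n \<ge> 0 then fcoeff f n else 0)"
    "\<forall>n. fcoeff y' n = (if n \<ge> 0 then 0 else fcoeff f n)"
    using fourier_decomposition[of f] by (elim exE conjE)
  have "y \<in> hardy_space" by (simp add: hardy_iff y(4))
  moreover from this have "hardy_proj f = y"
    by (rule hardy_proj_eqI) (simp add: y(4))
  ultimately show "hardy_proj f \<in> hardy_space" "fcoeff (hardy_proj f) n = (if n \<ge> 0 then fcoeff f n else 0)"
    by (simp_all add: y(4))
qed

lemma hardy_proj_id: "f \<in> hardy_space \<Longrightarrow> hardy_proj f = f"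
  by (rule hardy_proj_eqI) auto

lemma cinner_hardy_proj: "f \<in> hardy_space \<Longrightarrow> cinner (hardy_proj g) f = cinner g f"
  using cinner_hardy_eq_0[of "g - hardy_proj g" f] by (simp add: cinner.diff_left coeff_hardy_proj)

definition cohardy_proj :: "L2 \<Rightarrow> L2" where
  "cohardy_proj f = f - hardy_proj f"

lemma coeff_cohardy_proj: "fcoeff (cohardy_proj f) n = (if n \<ge> 0 then 0 else fcoeff f n)"
  by (simp add: cohardy_proj_def cinner.diff_left coeff_hardy_proj)

lemma hardy_proj_square: "(norm f)\<^sup>2 = (norm (hardy_proj f))\<^sup>2 + (norm (cohardy_proj f))\<^sup>2"
proof -
  have "cinner (cohardy_proj f) (hardy_proj f) = 0"
    by (rule cinner_hardy_eq_0) (simp_all add: coeff_cohardy_proj hardy_proj_hardy)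
  from pythagoras[OF this] show ?thesis
    by (simp add: cohardy_proj_def add.commute)
qed

lemma norm_hardy_proj_le: "norm (hardy_proj f) \<le> norm f"
  by (rule power2_le_imp_le) (simp_all add: hardy_proj_square[of f])

lemma norm_cohardy_proj_le: "norm (cohardy_proj f) \<le> norm f"
  by (rule power2_le_imp_le) (simp_all add: hardy_proj_square[of f])

lemma bounded_clinear_hardy_proj: "bounded_clinear hardy_proj"
  by (rule bounded_clinearI[where K = 1])
    (auto intro!: eq_if_coeff_eq simp: coeff_hardy_proj cinner_add_left cinner_scaleC_left norm_hardy_proj_le)

lemma bounded_clinear_cohardy_proj: "bounded_clinear cohardy_proj"
  by (rule bounded_clinearI[where K = 1])
    (auto intro!: eq_if_coeff_eq simp: coeff_cohardy_proj cinner_add_left cinner_scaleC_left norm_cohardy_proj_le)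

lemmas bounded_linear_hardy_proj = bounded_clinear_imp_bounded_linear[OF bounded_clinear_hardy_proj]
  and bounded_linear_cohardy_proj = bounded_clinear_imp_bounded_linear[OF bounded_clinear_cohardy_proj]

lemmas hardy_proj_diff = linear_diff[OF bounded_linear.linear[OF bounded_linear_hardy_proj]]
  and cohardy_proj_diff = linear_diff[OF bounded_linear.linear[OF bounded_linear_cohardy_proj]]
  and cohardy_proj_add = bounded_clinear_add[OF bounded_clinear_cohardy_proj]

lemma multiplication_diff:
  "\<phi> \<in> L_infinity \<Longrightarrow> multiplication \<phi> (f - g) = multiplication \<phi> f - multiplication \<phi> g"
  by (rule linear_diff[OF bounded_linear.linear[OF bounded_linear_multiplication]])

lemma cohardy_proj_hardy: "f \<in> hardy_space \<Longrightarrow> cohardy_proj f = 0"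
  by (simp add: cohardy_proj_def hardy_proj_id)

lemma finite_frequency_approx:
  assumes "e > 0"
  shows "\<exists>N h. norm (f - h) < e \<and> (\<forall>k. \<bar>k\<bar> \<ge> int N \<longrightarrow> fcoeff h k = 0)"
proof -
  obtain y y' where y: "fourier_nonneg f \<longlonglongrightarrow> y"
    "fourier_neg f \<longlonglongrightarrow> y'"
    "f = y + y'" "\<forall>n. fcoeff y n = (if n \<ge> 0 then fcoeff f n else 0)"
    "\<forall>n. fcoeff y' n = (if n \<ge> 0 then 0 else fcoeff f n)"
    using fourier_decomposition[of f] by (elim exE conjE)
  define h where "h n = (fourier_nonneg f n) + (fourier_neg f n)" for n
  have "h \<longlonglongrightarrow> f"
    by (subst y(3)) (unfold h_def[abs_def], intro tendsto_add y(1,2))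
  then obtain n where "dist (h n) f < e"
    using metric_LIMSEQ_D[OF _ assms, of h f] by blast
  moreover have "fcoeff (h n) k = 0" if "\<bar>k\<bar> \<ge> int (Suc n)" for k
  proof -
    have "fcoeff (fourier_nonneg f n) k = 0"
      "fcoeff (fourier_neg f n) k = 0"
      unfolding cinner.sum_left
      by (intro sum.neutral; use that in \<open>auto simp: cinner_scaleC_left coeff_zpow\<close>)+
    then show ?thesis by (simp add: h_def cinner_add_left)
  qed
  ultimately show ?thesis
    by (intro exI[of _ "Suc n"] exI[of _ "h n"]) (simp add: dist_norm norm_minus_commute)
qed

text \<open>A density argument common to both projections: vectors of finite frequency are
  eventually annihilated, and the remainder is controlled because shifts are isometric and
  \<open>Q\<close> is a contraction.\<close>

lemma shifted_tendsto_0: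
  assumes Q: "\<And>f g. Q (f - g) = Q f - Q g" "\<And>f. norm (Q f) \<le> norm f"
    and zero: "\<And>N h n. \<forall>k. \<bar>k\<bar> \<ge> int N \<longrightarrow> fcoeff h k = 0 \<Longrightarrow> n \<ge> N \<Longrightarrow> Q (shift (s n) h) = 0"
  shows "(\<lambda>n. Q (shift (s n) f) :: L2) \<longlonglongrightarrow> 0"
proof (rule LIMSEQ_I)
  fix e :: real assume "e > 0"
  obtain N h where h: "norm (f - h) < e" "\<forall>k. \<bar>k\<bar> \<ge> int N \<longrightarrow> fcoeff h k = 0"
    using finite_frequency_approx[OF \<open>e > 0\<close>, of f] by (elim exE conjE)
  have "norm (Q (shift (s n) f)) < e" if "n \<ge> N" for n
  proof -
    have "Q (shift (s n) f) = Q (shift (s n) (f - h))"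
      by (simp add: Q(1) shift_diff zero[OF h(2) that])
    also have "norm \<dots> \<le> norm (f - h)"
      using Q(2) norm_shift by metis
    finally show ?thesis using h by simp
  qed
  then show "\<exists>N. \<forall>n\<ge>N. norm (Q (shift (s n) f) - 0) < e" by auto
qed

lemma hardy_proj_shift_tendsto_0: "(\<lambda>n. hardy_proj (shift (- int n) f)) \<longlonglongrightarrow> 0"
  by (rule shifted_tendsto_0[OF hardy_proj_diff norm_hardy_proj_le])
    (rule eq_if_coeff_eq, simp add: coeff_hardy_proj coeff_shift cinner.zero_left)

lemma cohardy_proj_shift_tendsto_0: "(\<lambda>n. cohardy_proj (shift (int n) f)) \<longlonglongrightarrow> 0"
  by (rule shifted_tendsto_0[OF cohardy_proj_diff norm_cohardy_proj_le])
    (rule eq_if_coeff_eq, simp add: coeff_cohardy_proj coeff_shift cinner.zero_left)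

lemma multiplication_zpow: "\<phi> \<in> L_infinity \<Longrightarrow> multiplication \<phi> (zpow n) = shift n (abs_L2 \<phi>)"
  unfolding zpow_def shift_def
  by (simp add: multiplication_abs_L2 powi_L_infinity square_integrable_powi L_infinity_square_integrable mult.commute)

text \<open>Multiplying the monomial \<open>zpow k\<close> by the symbol shifts the symbol by
  \<open>k >= 0\<close>, so it stays analytic; linearity and closedness of \<open>H^2\<close> give
  the rest.\<close>

lemma multiplication_hardy:
  assumes "\<phi> \<in> L_infinity" "abs_L2 \<phi> \<in> hardy_space" "f \<in> hardy_space"
  shows "multiplication \<phi> f \<in> hardy_space"
proof -
  interpret m: bounded_linear "multiplication \<phi>"
    by (rule bounded_linear_multiplication[OF assms(1)])
  have "multiplication \<phi> (fourier_nonneg f n) \<in> hardy_space" for n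
    unfolding m.sum
    by (intro hardy_sum) (simp add: multiplication_scaleC multiplication_zpow assms hardy_scale shift_hardy)
  moreover have "(\<lambda>n. multiplication \<phi> (fourier_nonneg f n)) \<longlonglongrightarrow> multiplication \<phi> f"
    by (intro m.tendsto hardy_expansion assms)
  ultimately show ?thesis
    by (rule closed_sequentially[OF hardy_space_closed])
qed

section \<open>Toeplitz and Hankel operators\<close>

definition hankel :: "(complex \<Rightarrow> complex) \<Rightarrow> L2 \<Rightarrow> L2" where
  "hankel \<phi> f = cohardy_proj (multiplication \<phi> f)"

lemma bounded_clinear_compose:
  "bounded_clinear S \<Longrightarrow> bounded_clinear T \<Longrightarrow> bounded_clinear (\<lambda>x. S (T x))"
  unfolding bounded_clinear_def
  by (auto intro: bounded_linear_compose Vector_Spaces.linear_compose[unfolded o_def])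

lemma bounded_clinear_hankel: "\<phi> \<in> L_infinity \<Longrightarrow> bounded_clinear (hankel \<phi>)"
  unfolding hankel_def
  by (intro bounded_clinear_compose[OF bounded_clinear_cohardy_proj] bounded_clinear_multiplication)

lemma bounded_clinear_Rep_H2: "bounded_clinear Rep_H2"
  by (rule bounded_clinearI[where K = 1]) (simp_all add: plus_H2.rep_eq scaleC_H2.rep_eq norm_H2.rep_eq)

lemma Rep_toeplitz: "Rep_H2 (toeplitz \<phi> f) = hardy_proj (multiplication \<phi> (Rep_H2 f))"
  unfolding toeplitz_def by (rule Abs_H2_inverse[OF hardy_proj_hardy])

lemma bounded_clinear_toeplitz:
  assumes "\<phi> \<in> L_infinity" shows "bounded_clinear (toeplitz \<phi>)"
proof -
  have c: "bounded_clinear (\<lambda>f. hardy_proj (multiplication \<phi> (Rep_H2 f)))"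
    by (intro bounded_clinear_compose[OF bounded_clinear_hardy_proj] bounded_clinear_compose[OF _ bounded_clinear_Rep_H2]
        bounded_clinear_multiplication assms)
  obtain K where "\<And>f. norm (hardy_proj (multiplication \<phi> (Rep_H2 f))) \<le> norm f * K"
    using bounded_linear.bounded[OF bounded_clinear_imp_bounded_linear[OF c]] by blast
  then show ?thesis
    using bounded_clinear_add[OF c] bounded_clinear_scaleC[OF c]
    by (intro bounded_clinearI[where K = K])
      (simp_all add: Rep_H2_inject[symmetric] plus_H2.rep_eq scaleC_H2.rep_eq norm_H2.rep_eq Rep_toeplitz)
qed

lemma toeplitz_adjoint:
  assumes "\<phi> \<in> L_infinity"
  shows "cinner (toeplitz \<phi> f) g = cinner f (toeplitz (\<lambda>z. cnj (\<phi> z)) g)"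
proof -
  have "cinner (toeplitz \<phi> f) g = cinner (multiplication \<phi> (Rep_H2 f)) (Rep_H2 g)"
    by (simp add: cinner_H2.rep_eq Rep_toeplitz cinner_hardy_proj[OF Rep_H2])
  also have "\<dots> = cnj (cinner (multiplication (\<lambda>z. cnj (\<phi> z)) (Rep_H2 g)) (Rep_H2 f))"
    unfolding multiplication_adjoint[OF assms] by (rule cinner_commute)
  also have "\<dots> = cnj (cinner (toeplitz (\<lambda>z. cnj (\<phi> z)) g) f)"
    by (simp add: cinner_H2.rep_eq Rep_toeplitz cinner_hardy_proj[OF Rep_H2])
  also have "\<dots> = cinner f (toeplitz (\<lambda>z. cnj (\<phi> z)) g)"
    by (rule cinner_commute[symmetric])
  finally show ?thesis .
qed

lemma norm_toeplitz_square:
  "(norm (toeplitz \<phi> f))\<^sup>2 = (norm (multiplication \<phi> (Rep_H2 f)))\<^sup>2 - (norm (hankel \<phi> (Rep_H2 f)))\<^sup>2"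
  using hardy_proj_square[of "multiplication \<phi> (Rep_H2 f)"] by (simp add: norm_H2.rep_eq Rep_toeplitz hankel_def)

lemma hankel_cong:
  "\<phi> \<in> L_infinity \<Longrightarrow> \<psi> \<in> L_infinity \<Longrightarrow> AE z in circle. \<phi> z = \<psi> z \<Longrightarrow> hankel \<phi> u = hankel \<psi> u"
  unfolding hankel_def by (simp only: multiplication_cong)

lemma hankel_add_symbol:
  "\<phi> \<in> L_infinity \<Longrightarrow> \<psi> \<in> L_infinity \<Longrightarrow> hankel (\<lambda>z. \<phi> z + \<psi> z) u = hankel \<phi> u + hankel \<psi> u"
  unfolding hankel_def by (simp only: multiplication_add_symbol cohardy_proj_add)

lemma hankel_H_infinity:
  assumes "\<phi> \<in> H_infinity" "u \<in> hardy_space"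
  shows "hankel \<phi> u = 0"
  unfolding hankel_def
  by (intro cohardy_proj_hardy multiplication_hardy) (use assms in \<open>auto simp: H_infinity_def\<close>)

lemma hankel_norm_le:
  assumes "\<phi> \<in> L_infinity" "K \<ge> 0" "AE z in circle. cmod (\<phi> z) \<le> K"
  shows "norm (hankel \<phi> u) \<le> K * norm u"
  unfolding hankel_def
  by (rule order_trans[OF norm_cohardy_proj_le multiplication_norm_le[OF assms]])

lemma multiplication_shift:
  assumes "\<phi> \<in> L_infinity"
  shows "multiplication \<phi> (shift n f) = shift n (multiplication \<phi> f)"
proof -
  have "multiplication (\<lambda>z. \<phi> z * z powi n) f = multiplication (\<lambda>z. z powi n * \<phi> z) f"
    by (simp only: mult.commute)
  then show ?thesis
    unfolding shift_def
    by (simp only: multiplication_multiplication[OF assms powi_L_infinity]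
        multiplication_multiplication[OF powi_L_infinity assms])
qed

lemma multiplication_powi_mult:
  "\<phi> \<in> L_infinity \<Longrightarrow> multiplication (\<lambda>z. z powi n * \<phi> z) f = shift n (multiplication \<phi> f)"
  unfolding shift_def by (simp only: multiplication_multiplication[OF powi_L_infinity])

lemma hankel_powi_mult:
  "\<phi> \<in> L_infinity \<Longrightarrow> hankel (\<lambda>z. z powi n * \<phi> z) u = hankel \<phi> (shift n u)"
  unfolding hankel_def by (simp only: multiplication_powi_mult multiplication_shift)

lemma abs_L2_powi_mult: "\<phi> \<in> L_infinity \<Longrightarrow> abs_L2 (\<lambda>z. z powi n * \<phi> z) = shift n (abs_L2 \<phi>)"
  unfolding shift_def
  by (rule multiplication_abs_L2[OF powi_L_infinity L_infinity_square_integrable, symmetric])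

lemma powi_mult_L_infinity: "\<phi> \<in> L_infinity \<Longrightarrow> (\<lambda>z. z powi n * \<phi> z) \<in> L_infinity"
  by (rule L_infinity_mult[OF powi_L_infinity])

lemma trig_poly_eventually_analytic:
  assumes "trig_poly p"
  shows "\<exists>N. (\<lambda>z. z powi (int N) * p z) \<in> H_infinity"
proof -
  \<comment> \<open>Stated for all large shifts, so that the induction passes through sums.\<close>
  have "\<exists>N. \<forall>n\<ge>N. shift (int n) (abs_L2 p) \<in> hardy_space"
    using assms
  proof (induction rule: trig_poly.induct)
    case (monom c k)
    have eq: "abs_L2 (\<lambda>z. c * z powi k) = c *\<^sub>C zpow k"
      unfolding zpow_def by (rule abs_L2_scaleC[symmetric, OF square_integrable_powi])
    show ?case
      by (intro exI[of _ "nat (- k)"] allI impI) (simp add: eq shift_scaleC shift_zpow hardy_scale zpow_hardy)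
  next
    case (add p q)
    then obtain N M where "\<forall>n\<ge>N. shift (int n) (abs_L2 p) \<in> hardy_space"
      "\<forall>n\<ge>M. shift (int n) (abs_L2 q) \<in> hardy_space" by blast
    moreover have "abs_L2 (\<lambda>z. p z + q z) = abs_L2 p + abs_L2 q"
      by (intro abs_L2_add[symmetric] L_infinity_square_integrable trig_poly_L_infinity add)
    ultimately show ?case
      by (intro exI[of _ "max N M"]) (simp add: shift_add hardy_add)
  qed
  then obtain N where "shift (int N) (abs_L2 p) \<in> hardy_space" by blast
  then have "(\<lambda>z. z powi (int N) * p z) \<in> H_infinity"
    using trig_poly_L_infinity[OF assms]
    by (simp only: H_infinity_def mem_Collect_eq abs_L2_powi_mult powi_mult_L_infinity simp_thms)
  then show ?thesis by blast
qed

text \<open>The condition \<open>\<parallel>H\<^sub>\<phi> S\<^sup>N\<parallel> \<rightarrow> 0\<close>, which characterises compactness of the Hankel operator.\<close>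

definition hankel_vanishing :: "(complex \<Rightarrow> complex) \<Rightarrow> bool" where
  "hankel_vanishing \<phi> \<longleftrightarrow>
     (\<forall>e>0. \<exists>N. \<forall>u\<in>hardy_space. norm (hankel \<phi> (shift (int N) u)) \<le> e * norm u)"

text \<open>The analytic summand has Hankel operator 0 on \<open>H^2\<close>, and a trigonometric
  polynomial near the continuous summand becomes analytic after finitely many shifts. Only the
  uniformly small approximation error remains.\<close>

lemma hankel_vanishing_if_H_infinity_plus_C:
  assumes "\<phi> \<in> H_infinity_plus_C"
  shows "hankel_vanishing \<phi>"
  unfolding hankel_vanishing_def
proof (intro allI impI)
  fix e :: real assume "e > 0"
  obtain f g where \<phi>: "\<phi> \<in> L_infinity" and f: "f \<in> H_infinity" and g: "continuous_on (sphere 0 1) g"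
    and eq: "AE z in circle. \<phi> z = f z + g z"
    using assms unfolding H_infinity_plus_C_def by blast
  have "\<exists>p. trig_poly p \<and> (\<forall>z\<in>sphere 0 1. cmod (g z - p z) < e)"
    using trig_poly_approx[OF g \<open>e > 0\<close>] by metis
  then obtain p where p: "trig_poly p" "\<And>z. z \<in> sphere 0 1 \<Longrightarrow> cmod (g z - p z) < e"
    by blast
  obtain N where N: "(\<lambda>z. z powi (int N) * p z) \<in> H_infinity"
    using trig_poly_eventually_analytic[OF p(1)] by blast
  define r where "r z = g z - p z" for z
  have fL: "f \<in> L_infinity" and "g \<in> L_infinity" and pL: "p \<in> L_infinity"
    using f g p by (simp_all add: H_infinity_def continuous_L_infinity trig_poly_L_infinity)
  then have rL: "r \<in> L_infinity"
    unfolding r_def by (intro L_infinity_diff)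
  have "norm (hankel \<phi> (shift (int N) u)) \<le> e * norm u" if u: "u \<in> hardy_space" for u
  proof -
    have "hankel \<phi> (shift (int N) u) = hankel (\<lambda>z. (f z + p z) + r z) (shift (int N) u)"
      by (intro hankel_cong L_infinity_add \<phi> fL pL rL) (use eq in \<open>eventually_elim, simp add: r_def\<close>)
    also have "\<dots> = hankel f (shift (int N) u) + hankel p (shift (int N) u) + hankel r (shift (int N) u)"
      by (simp only: hankel_add_symbol L_infinity_add fL pL rL)
    also have "hankel f (shift (int N) u) = 0"
      by (intro hankel_H_infinity f shift_hardy u) simp
    also have "hankel p (shift (int N) u) = 0"
      unfolding hankel_powi_mult[OF pL, symmetric] by (intro hankel_H_infinity N u)
    finally have eq: "hankel \<phi> (shift (int N) u) = hankel r (shift (int N) u)"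
      by simp
    have "norm (hankel r (shift (int N) u)) \<le> e * norm (shift (int N) u)"
      using \<open>e > 0\<close> p(2) by (intro hankel_norm_le rL AE_circleI) (simp_all add: r_def less_imp_le)
    then show ?thesis by (simp add: eq norm_shift)
  qed
  then show "\<exists>N. \<forall>u\<in>hardy_space. norm (hankel \<phi> (shift (int N) u)) \<le> e * norm u" by blast
qed

section \<open>Nehari's theorem\<close>

text \<open>The backward shift moves exactly one more coefficient, the constant one, into the
  negative frequencies.\<close>

lemma cohardy_proj_shift_square:
  "(norm (cohardy_proj (shift (- 1) g)))\<^sup>2 = (norm (cohardy_proj g))\<^sup>2 + (cmod (fcoeff g 0))\<^sup>2"
proof -
  have eq: "cohardy_proj (shift (- 1) g) = shift (- 1) (cohardy_proj g + fcoeff g 0 *\<^sub>C zpow 0)"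
  proof (rule eq_if_coeff_eq)
    fix n :: int
    have "n \<ge> 0 \<or> n = - 1 \<or> n < - 1" by linarith
    then show "fcoeff (cohardy_proj (shift (- 1) g)) n
        = fcoeff (shift (- 1) (cohardy_proj g + fcoeff g 0 *\<^sub>C zpow 0)) n"
      by (auto simp: coeff_cohardy_proj coeff_shift cinner_add_left cinner_scaleC_left coeff_zpow)
  qed
  have "cinner (cohardy_proj g) (fcoeff g 0 *\<^sub>C zpow 0) = 0"
    by (simp add: cinner_scaleC_right coeff_cohardy_proj)
  from pythagoras[OF this] show ?thesis
    unfolding eq norm_shift
    by (simp add: norm_scaleC orthonormal_norm[OF orthonormal_zpow_nat, of 0, simplified] power_mult_distrib)
qed

text \<open>A completion problem with one unknown scalar entry, solved by Parrott's lemma on the affine space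
  of functions with constant term \<open>1\<close>.\<close>

lemma nehari_step:
  assumes \<psi>: "\<psi> \<in> L_infinity" and bound: "\<And>u. u \<in> hardy_space \<Longrightarrow> norm (hankel \<psi> u) \<le> \<gamma> * norm u"
    and "\<gamma> \<ge> 0"
  shows "\<exists>c. \<forall>u\<in>hardy_space. norm (hankel (\<lambda>z. z powi (- 1) * (\<psi> z - c)) u) \<le> \<gamma> * norm u"
proof -
  interpret m: bounded_linear "multiplication \<psi>"
    by (rule bounded_linear_multiplication[OF \<psi>])
  interpret h: bounded_linear "hankel \<psi>"
    by (rule bounded_clinear_imp_bounded_linear[OF bounded_clinear_hankel[OF \<psi>]])
  \<comment> \<open>\<open>F\<close> is the room that the Hankel bound leaves at \<open>u\<close>.
    The entry \<open>L u\<close> joins the negative part after division by \<open>z\<close>, and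
    subtracting \<open>c\<close> from the symbol changes it to
    \<open>L u - c * fcoeff u 0\<close>.\<close>
  define F where "F u = \<gamma>\<^sup>2 * (norm u)\<^sup>2 - (norm (hankel \<psi> u))\<^sup>2" for u
  define L where "L u = fcoeff (multiplication \<psi> u) 0" for u
  define C where "C = {u \<in> hardy_space. fcoeff u 0 = 1}"
  have F_nonneg: "0 \<le> F u" if "u \<in> hardy_space" for u
    using power_mono[OF bound[OF that] norm_ge_zero, of 2] by (simp add: F_def power_mult_distrib)
  have dom: "(cmod (L w))\<^sup>2 \<le> F w" if w: "w \<in> hardy_space" "fcoeff w 0 = 0" for w
  proof -
    define v where "v = shift (- 1) w"
    have v: "v \<in> hardy_space"
      unfolding hardy_iff
    proof (intro allI impI)
      fix n :: int assume "n < 0"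
      then have "n + 1 < 0 \<or> n + 1 = 0" by linarith
      then show "fcoeff v n = 0"
        using w by (auto simp: v_def coeff_shift hardy_iff)
    qed
    have "shift 1 v = w"
      by (simp add: v_def shift_shift shift_0)
    \<comment> \<open>A vector without constant term is \<open>z\<close> times an analytic
      \<open>v\<close>; the Hankel bound at \<open>v\<close> already accounts for the additional
      entry \<open>L w\<close>.\<close>
    have "(norm (hankel \<psi> w))\<^sup>2 + (cmod (L w))\<^sup>2 = (norm (cohardy_proj (shift (- 1) (multiplication \<psi> w))))\<^sup>2"
      by (simp add: cohardy_proj_shift_square hankel_def L_def)
    also have "shift (- 1) (multiplication \<psi> w) = multiplication \<psi> v"
      by (simp add: v_def multiplication_shift[OF \<psi>])
    also have "norm (cohardy_proj (multiplication \<psi> v)) \<le> \<gamma> * norm v"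
      using bound[OF v] by (simp add: hankel_def)
    then have "(norm (cohardy_proj (multiplication \<psi> v)))\<^sup>2 \<le> (\<gamma> * norm v)\<^sup>2"
      by (intro power_mono) auto
    also have "(\<gamma> * norm v)\<^sup>2 = \<gamma>\<^sup>2 * (norm w)\<^sup>2"
      by (simp add: v_def norm_shift power_mult_distrib)
    finally show ?thesis by (simp add: F_def)
  qed
  have "\<exists>c. \<forall>f\<in>C. (norm (L f - c))\<^sup>2 \<le> F f"
  proof (rule parrott[of C L F])
    show "convex C"
      unfolding convex_def C_def
    proof safe
      fix x y :: L2 and u v :: real
      assume xy: "x \<in> hardy_space" "y \<in> hardy_space" "fcoeff x 0 = 1" "fcoeff y 0 = 1" "u + v = 1"
      then show "u *\<^sub>R x + v *\<^sub>R y \<in> hardy_space"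
        unfolding scaleR_scaleC by (intro hardy_add hardy_scale)
      show "fcoeff (u *\<^sub>R x + v *\<^sub>R y) 0 = 1"
        using xy by (simp add: cinner_add_left cinner.scaleR_left scaleR_conv_of_real flip: of_real_add)
    qed
    have "zpow 0 \<in> C"
      by (simp add: C_def zpow_hardy coeff_zpow)
    then show "C \<noteq> {}" by blast
    show "linear L"
      unfolding L_def
      by (intro linearI) (simp_all add: m.add m.scaleR cinner_add_left cinner.scaleR_left)
    show "0 \<le> F f" if "f \<in> C" for f
      using that by (intro F_nonneg) (simp add: C_def)
    show "F ((1 - t) *\<^sub>R f + t *\<^sub>R g) = (1 - t) * F f + t * F g - t * (1 - t) * F (f - g)" for t f g
      unfolding F_def h.add h.scaleR h.diff norm_convex_combination by (simp add: algebra_simps)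
    \<comment> \<open>Differences of elements of \<open>C\<close> have constant coefficient 0, where
      \<open>dom\<close> applies.\<close>
    show "(norm (L (f - g)))\<^sup>2 \<le> F (f - g)" if "f \<in> C" "g \<in> C" for f g
      using that by (intro dom) (auto simp: C_def hardy_diff cinner.diff_left)
    show "\<exists>c. \<forall>f\<in>C. (norm (L f - c))\<^sup>2 \<le> F f" if "\<And>f. f \<in> C \<Longrightarrow> (norm (L f - c))\<^sup>2 \<le> F f" for c
      using that by blast
  qed
  then obtain c where c: "\<And>f. f \<in> C \<Longrightarrow> (norm (L f - c))\<^sup>2 \<le> F f"
    by blast
  \<comment> \<open>Homogeneity carries the bound from constant coefficient 1 to any nonzero one;
    the value 0 is \<open>dom\<close>.\<close>
  have main: "(cmod (L u - c * fcoeff u 0))\<^sup>2 \<le> F u" if u: "u \<in> hardy_space" for u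
  proof (cases "fcoeff u 0 = 0")
    case True
    then show ?thesis using dom[OF u] by simp
  next
    case False
    define a where "a = fcoeff u 0"
    define f where "f = (1 / a) *\<^sub>C u"
    have a: "a \<noteq> 0" using False by (simp add: a_def)
    have "f \<in> C"
      using u a by (simp add: C_def f_def hardy_scale cinner_scaleC_left) (simp add: a_def)
    have uf: "u = a *\<^sub>C f"
      using a by (simp add: f_def scaleC_scaleC)
    have "L u = a * L f"
      by (simp add: uf L_def multiplication_scaleC[OF \<psi>] cinner_scaleC_left)
    then have "L u - c * fcoeff u 0 = a * (L f - c)"
      by (simp add: a_def algebra_simps)
    then have "(cmod (L u - c * fcoeff u 0))\<^sup>2 = (cmod a)\<^sup>2 * (cmod (L f - c))\<^sup>2"
      by (simp add: norm_mult power_mult_distrib)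
    also have "\<dots> \<le> (cmod a)\<^sup>2 * F f"
      using c[OF \<open>f \<in> C\<close>] by (intro mult_left_mono) auto
    also have "\<dots> = F u"
      by (simp add: F_def uf norm_scaleC bounded_clinear_scaleC[OF bounded_clinear_hankel[OF \<psi>]]
          power_mult_distrib algebra_simps)
    finally show ?thesis .
  qed
  have "norm (hankel (\<lambda>z. z powi (- 1) * (\<psi> z - c)) u) \<le> \<gamma> * norm u" if u: "u \<in> hardy_space" for u
  proof (rule power2_le_imp_le)
    have cL: "(\<lambda>z. \<psi> z - c) \<in> L_infinity"
      by (intro L_infinity_diff \<psi> const_L_infinity)
    have "multiplication (\<lambda>z. \<psi> z + - c) u = multiplication \<psi> u + (- c) *\<^sub>C u"
      by (simp only: multiplication_add_symbol[OF \<psi> const_L_infinity] multiplication_const)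
    then have m: "multiplication (\<lambda>z. \<psi> z - c) u = multiplication \<psi> u + (- c) *\<^sub>C u"
      by simp
    have 1: "cohardy_proj (multiplication (\<lambda>z. \<psi> z - c) u) = hankel \<psi> u"
      unfolding m by (simp add: hankel_def cohardy_proj_diff cohardy_proj_hardy hardy_scale u)
    have 2: "fcoeff (multiplication (\<lambda>z. \<psi> z - c) u) 0 = L u - c * fcoeff u 0"
      unfolding m by (simp add: L_def cinner.diff_left cinner_scaleC_left)
    have "(norm (hankel (\<lambda>z. z powi (- 1) * (\<psi> z - c)) u))\<^sup>2
        = (norm (hankel \<psi> u))\<^sup>2 + (cmod (L u - c * fcoeff u 0))\<^sup>2"
      by (simp only: hankel_def[of "\<lambda>z. z powi (- 1) * (\<psi> z - c)"] multiplication_powi_mult[OF cL]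
          cohardy_proj_shift_square 1 2)
    also have "\<dots> \<le> (\<gamma> * norm u)\<^sup>2"
      using main[OF u] by (simp add: F_def power_mult_distrib)
    finally show "(norm (hankel (\<lambda>z. z powi (- 1) * (\<psi> z - c)) u))\<^sup>2 \<le> (\<gamma> * norm u)\<^sup>2" .
  qed (use \<open>\<gamma> \<ge> 0\<close> in simp)
  then show ?thesis by blast
qed

lemma norm_zpow: "norm (zpow n) = 1"
  using orthonormal_norm[OF orthonormal_zpow[of "\<lambda>i::int. i"], of n] by simp

lemma multiplication_abs_L2_commute:
  assumes "\<phi> \<in> L_infinity" "\<psi> \<in> L_infinity"
  shows "multiplication \<phi> (abs_L2 \<psi>) = multiplication \<psi> (abs_L2 \<phi>)"
  by (simp add: multiplication_abs_L2 assms L_infinity_square_integrable mult.commute)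

text \<open>Backward shifts push all of \<open>g\<close> into the negative frequencies in the limit,
  so the bounds on the negative parts recover the full norm.\<close>

lemma norm_le_if_cohardy_proj_shift_le:
  assumes "\<And>N. norm (cohardy_proj (shift (- int N) g)) \<le> K"
  shows "norm g \<le> K"
proof -
  have "(norm g)\<^sup>2 \<le> (norm (hardy_proj (shift (- int N) g)))\<^sup>2 + K\<^sup>2" for N
    using hardy_proj_square[of "shift (- int N) g"] power_mono[OF assms[of N] norm_ge_zero, of 2]
    by (simp add: norm_shift)
  moreover have "(\<lambda>N. (norm (hardy_proj (shift (- int N) g)))\<^sup>2 + K\<^sup>2) \<longlonglongrightarrow> (norm (0::L2))\<^sup>2 + K\<^sup>2"
    by (intro tendsto_intros hardy_proj_shift_tendsto_0)
  ultimately have "(norm g)\<^sup>2 \<le> K\<^sup>2"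
    using LIMSEQ_le_const by fastforce
  moreover have "K \<ge> 0"
    using assms[of 0] norm_ge_zero order_trans by blast
  ultimately show ?thesis
    by (rule power2_le_imp_le)
qed

lemma integral_weight:
  assumes p: "p \<in> L_infinity"
  shows "(\<integral>z. (K - (cmod (rep_L2 f z))\<^sup>2) * (cmod (p z))\<^sup>2 \<partial>circle)
    = K * (norm (abs_L2 p))\<^sup>2 - (norm (multiplication p f))\<^sup>2"
proof -
  have ps: "p \<in> square_integrable" by (rule L_infinity_square_integrable[OF p])
  have [measurable]: "p \<in> borel_measurable circle" by (rule L_infinity_measurable[OF p])
  have ip: "integrable circle (\<lambda>z. (cmod (p z))\<^sup>2)"
    using ps by (simp add: square_integrable_def)
  have ipf: "integrable circle (\<lambda>z. (cmod (p z))\<^sup>2 * (cmod (rep_L2 f z))\<^sup>2)"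
    using square_integrable_mult[OF p rep_L2_square_integrable[of f]]
    by (simp add: square_integrable_def norm_mult power_mult_distrib)
  have np: "(norm (abs_L2 p))\<^sup>2 = (\<integral>z. (cmod (p z))\<^sup>2 \<partial>circle)"
    unfolding norm_L2_square
    by (rule integral_cong_AE) (measurable, use rep_abs_L2[OF ps] in \<open>eventually_elim, simp\<close>)
  have "(\<integral>z. (K - (cmod (rep_L2 f z))\<^sup>2) * (cmod (p z))\<^sup>2 \<partial>circle)
      = (\<integral>z. K * (cmod (p z))\<^sup>2 - (cmod (p z))\<^sup>2 * (cmod (rep_L2 f z))\<^sup>2 \<partial>circle)"
    by (intro Bochner_Integration.integral_cong refl) (simp add: algebra_simps)
  then show ?thesis
    using ip ipf by (simp add: np multiplication_norm_square[OF p])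
qed

lemma integrable_weight: "integrable circle (\<lambda>z. K - (cmod (rep_L2 f z))\<^sup>2)"
  by (intro Bochner_Integration.integrable_diff integrable_L2_square) simp

text \<open>The roles are exchanged: the polynomial \<open>p\<close> is the bounded multiplier, so
  \<open>f\<close> may be any element of \<open>L^2\<close>. The weight
  \<open>\<gamma>^2 - |f|^2\<close> is tested against \<open>|p|^2\<close>.\<close>

lemma AE_norm_le_if_multiplication_le:
  assumes le: "\<And>p. trig_poly p \<Longrightarrow> norm (multiplication p f) \<le> \<gamma> * norm (abs_L2 p)" and "\<gamma> \<ge> 0"
  shows "AE z in circle. cmod (rep_L2 f z) \<le> \<gamma>"
proof -
  have "AE z in circle. 0 \<le> \<gamma>\<^sup>2 - (cmod (rep_L2 f z))\<^sup>2"
  proof (rule AE_nonneg_if_trig_poly[OF integrable_weight])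
    fix p assume p: "trig_poly p"
    show "0 \<le> (\<integral>z. (\<gamma>\<^sup>2 - (cmod (rep_L2 f z))\<^sup>2) * (cmod (p z))\<^sup>2 \<partial>circle)"
      using power_mono[OF le[OF p] norm_ge_zero, of 2]
      by (simp add: integral_weight trig_poly_L_infinity p power_mult_distrib)
  qed
  then show ?thesis
    by eventually_elim (use \<open>\<gamma> \<ge> 0\<close> power2_le_imp_le in auto)
qed

text \<open>Iterating \<open>nehari_step\<close> determines the coefficients \<open>c n\<close> of
  \<open>h\<close>. On the circle \<open>X n\<close> is \<open>z powi (- n)\<close> times
  \<open>\<phi>\<close> minus the part of \<open>h\<close> below degree \<open>n\<close>. Its Hankel
  bound controls ever more coefficients of \<open>\<phi> - h\<close> and in the limit the whole
  multiplier.\<close>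

lemma nehari:
  assumes \<phi>: "\<phi> \<in> L_infinity" and bound: "\<And>u. u \<in> hardy_space \<Longrightarrow> norm (hankel \<phi> u) \<le> \<gamma> * norm u"
    and "\<gamma> \<ge> 0"
  shows "\<exists>h\<in>H_infinity. AE z in circle. cmod (\<phi> z - h z) \<le> \<gamma>"
proof -
  define P where "P \<psi> \<longleftrightarrow> \<psi> \<in> L_infinity \<and> (\<forall>u\<in>hardy_space. norm (hankel \<psi> u) \<le> \<gamma> * norm u)" for \<psi>
  have "\<exists>c. P (\<lambda>z. z powi (- 1) * (\<psi> z - c))" if "P \<psi>" for \<psi>
    using nehari_step[of \<psi> \<gamma>] that \<open>\<gamma> \<ge> 0\<close>
    unfolding P_def by (simp only: powi_mult_L_infinity L_infinity_diff const_L_infinity simp_thms)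
  then obtain C where C: "\<And>\<psi>. P \<psi> \<Longrightarrow> P (\<lambda>z. z powi (- 1) * (\<psi> z - C \<psi>))"
    by metis
  define X where "X n = ((\<lambda>\<psi> z. z powi (- 1) * (\<psi> z - C \<psi>)) ^^ n) \<phi>" for n :: nat
  define c where "c n = C (X n)" for n
  have X_Suc: "X (Suc n) = (\<lambda>z. z powi (- 1) * (X n z - c n))" for n
    by (simp add: X_def c_def)
  have "P (X n)" for n
  proof (induction n)
    case 0
    show ?case using \<phi> bound by (simp add: P_def X_def)
  next
    case (Suc n)
    then show ?case unfolding X_Suc c_def by (rule C)
  qed
  then have X: "X n \<in> L_infinity" and XH: "u \<in> hardy_space \<Longrightarrow> norm (hankel (X n) u) \<le> \<gamma> * norm u" for n u
    by (auto simp: P_def)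
  define F where "F = abs_L2 \<phi>"
  define x where "x n = abs_L2 (X n)" for n
  define p where "p n = (\<Sum>k<n. c k *\<^sub>C zpow (int k))" for n
  have XcL: "(\<lambda>z. X n z - c n) \<in> L_infinity" for n
    by (intro L_infinity_diff X const_L_infinity)
  have abs_Xc: "abs_L2 (\<lambda>z. X n z - c n) = x n - c n *\<^sub>C zpow 0" for n
  proof -
    have "c n *\<^sub>C zpow 0 = abs_L2 (\<lambda>z. c n)"
      using abs_L2_scaleC[OF square_integrable_powi[of 0], of "c n"] by (simp add: zpow_def)
    then show ?thesis
      by (simp add: x_def abs_L2_diff L_infinity_square_integrable X const_L_infinity)
  qed
  have x_Suc: "x (Suc n) = shift (- 1) (x n - c n *\<^sub>C zpow 0)" for n
    unfolding x_def[of "Suc n"] X_Suc abs_L2_powi_mult[OF XcL] abs_Xc ..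
  have Fx: "F - p n = shift (int n) (x n)" for n
  proof (induction n)
    case 0
    show ?case by (simp add: p_def F_def x_def X_def shift_0)
  next
    case (Suc n)
    have "F - p (Suc n) = shift (int n) (x n) - c n *\<^sub>C zpow (int n)"
      by (simp add: p_def Suc[symmetric] algebra_simps)
    also have "\<dots> = shift (int n) (x n - c n *\<^sub>C zpow 0)"
      by (simp add: shift_diff shift_scaleC shift_zpow)
    also have "\<dots> = shift (int (Suc n)) (x (Suc n))"
      by (simp add: x_Suc shift_shift)
    finally show ?case .
  qed
  have x_p: "shift (- int n) (F - p n) = x n" for n
    by (simp add: Fx shift_shift shift_0)
  have coeff_p: "fcoeff (p n) k = (if 0 \<le> k \<and> k < int n then c (nat k) else 0)" for n k
  proof (cases "0 \<le> k \<and> k < int n")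
    case True
    have "fcoeff (p n) (int (nat k)) = c (nat k)"
      unfolding p_def using True by (intro cinner_orthonormal_sum[OF orthonormal_zpow_nat]) auto
    with True show ?thesis by simp
  next
    case False
    then show ?thesis
      unfolding p_def cinner.sum_left by (auto intro!: sum.neutral simp: cinner_scaleC_left coeff_zpow)
  qed
  \<comment> \<open>Each step adds the square of \<open>fcoeff F n - c n\<close> to the squared norm
    of the Hankel operator at the constant function 1, which stays below \<open>\<gamma>^2\<close>.
    Hence the \<open>c n\<close> are square summable.\<close>
  have sum_le: "(\<Sum>k<n. (cmod (fcoeff F (int k) - c k))\<^sup>2) \<le> \<gamma>\<^sup>2" for n
  proof -
    have "(norm (hankel (X n) (zpow 0)))\<^sup>2 = (norm (hankel \<phi> (zpow 0)))\<^sup>2 + (\<Sum>k<n. (cmod (fcoeff F (int k) - c k))\<^sup>2)"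
    proof (induction n)
      case 0
      show ?case by (simp add: X_def)
    next
      case (Suc n)
      have m: "multiplication (\<lambda>z. X n z - c n) (zpow 0) = x n - c n *\<^sub>C zpow 0"
        by (simp add: multiplication_zpow[OF XcL] shift_0 abs_Xc)
      have "cohardy_proj (x n - c n *\<^sub>C zpow 0) = hankel (X n) (zpow 0)"
        by (simp add: cohardy_proj_diff cohardy_proj_hardy hardy_scale zpow_hardy hankel_def
            multiplication_zpow[OF X] shift_0 x_def)
      moreover have "fcoeff (x n - c n *\<^sub>C zpow 0) 0 = fcoeff F (int n) - c n"
        by (simp add: cinner.diff_left cinner_scaleC_left coeff_zpow x_p[symmetric] coeff_shift coeff_p)
      ultimately have "(norm (hankel (X (Suc n)) (zpow 0)))\<^sup>2
          = (norm (hankel (X n) (zpow 0)))\<^sup>2 + (cmod (fcoeff F (int n) - c n))\<^sup>2"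
        unfolding X_Suc hankel_def[of "\<lambda>z. z powi (- 1) * (X n z - c n)"] multiplication_powi_mult[OF XcL]
          cohardy_proj_shift_square m by simp
      with Suc show ?case by simp
    qed
    moreover have "(norm (hankel (X n) (zpow 0)))\<^sup>2 \<le> (\<gamma> * norm (zpow 0))\<^sup>2"
      by (intro power_mono XH zpow_hardy) auto
    ultimately show ?thesis
      using zero_le_power2[of "norm (hankel \<phi> (zpow 0))"] unfolding norm_zpow mult_1_right by linarith
  qed
  have "summable (\<lambda>k. (cmod (c k))\<^sup>2)"
  proof (rule summable_comparison_test'[where N = 0])
    show "summable (\<lambda>k. 2 * (cmod (fcoeff F (int k)))\<^sup>2 + 2 * (cmod (fcoeff F (int k) - c k))\<^sup>2)"
    proof (intro summable_add summable_mult)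
      show "summable (\<lambda>k. (cmod (fcoeff F (int k)))\<^sup>2)"
        by (rule summable_bessel[OF orthonormal_zpow_nat])
      show "summable (\<lambda>k. (cmod (fcoeff F (int k) - c k))\<^sup>2)"
        by (rule bounded_imp_summable[where B = "\<gamma>\<^sup>2"])
          (use sum_le[of "Suc _"] in \<open>auto simp: lessThan_Suc_atMost\<close>)
    qed
    show "norm ((cmod (c k))\<^sup>2) \<le> 2 * (cmod (fcoeff F (int k)))\<^sup>2 + 2 * (cmod (fcoeff F (int k) - c k))\<^sup>2" for k
      using cmod_add_square_le[of "fcoeff F (int k)" "- (fcoeff F (int k) - c k)"]
      by (simp add: norm_minus_commute)
  qed
  then obtain h where h: "p \<longlonglongrightarrow> h"
    using orthonormal_series_convergent[OF orthonormal_zpow_nat, of c] unfolding convergent_def p_def by blast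
  have h_coeff: "fcoeff h k = (if 0 \<le> k then c (nat k) else 0)" for k
  proof -
    have "(\<lambda>n. fcoeff (p n) k) \<longlonglongrightarrow> fcoeff h k"
      by (intro cinner.tendsto h tendsto_const)
    moreover have "(\<lambda>n. fcoeff (p n) k) \<longlonglongrightarrow> (if 0 \<le> k then c (nat k) else 0)"
      by (rule tendsto_eventually, rule eventually_sequentiallyI[of "Suc (nat k)"]) (auto simp: coeff_p)
    ultimately show ?thesis by (rule LIMSEQ_unique)
  qed
  \<comment> \<open>After a backward shift by \<open>n\<close> the tail \<open>h - p n\<close> is
    still in \<open>H^2\<close>, so multiplied by the analytic \<open>u\<close> it adds nothing to
    the negative part; what is left is the Hankel operator of \<open>X n\<close> at
    \<open>u\<close>.\<close>
  have analytic: "norm (multiplication u (F - h)) \<le> \<gamma> * norm (abs_L2 u)" if u: "u \<in> H_infinity" for u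
  proof (rule norm_le_if_cohardy_proj_shift_le)
    fix n
    have uL: "u \<in> L_infinity" and uH: "abs_L2 u \<in> hardy_space"
      using u by (simp_all add: H_infinity_def)
    have tail: "shift (- int n) (h - p n) \<in> hardy_space"
      unfolding hardy_iff by (auto simp: coeff_shift cinner.diff_left h_coeff coeff_p)
    have "shift (- int n) (multiplication u (F - h)) = multiplication u (shift (- int n) (F - h))"
      by (rule multiplication_shift[OF uL, symmetric])
    also have "F - h = (F - p n) - (h - p n)"
      by simp
    also have "multiplication u (shift (- int n) ((F - p n) - (h - p n)))
        = multiplication u (x n) - multiplication u (shift (- int n) (h - p n))"
      by (simp only: shift_diff[of _ "F - p n"] x_p multiplication_diff[OF uL])
    also have "multiplication u (x n) = multiplication (X n) (abs_L2 u)"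
      unfolding x_def by (rule multiplication_abs_L2_commute[OF uL X])
    finally have "cohardy_proj (shift (- int n) (multiplication u (F - h))) = hankel (X n) (abs_L2 u)"
      by (simp add: cohardy_proj_diff hankel_def cohardy_proj_hardy[OF multiplication_hardy[OF uL uH tail]])
    then show "norm (cohardy_proj (shift (- int n) (multiplication u (F - h)))) \<le> \<gamma> * norm (abs_L2 u)"
      using XH[OF uH] by simp
  qed
  have AEle: "AE z in circle. cmod (rep_L2 (F - h) z) \<le> \<gamma>"
  proof (rule AE_norm_le_if_multiplication_le[OF _ \<open>\<gamma> \<ge> 0\<close>])
    fix q assume q: "trig_poly q"
    \<comment> \<open>A power of \<open>z\<close> makes \<open>q\<close> analytic without changing
      either norm.\<close>
    obtain N where N: "(\<lambda>z. z powi (int N) * q z) \<in> H_infinity"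
      using trig_poly_eventually_analytic[OF q] by blast
    show "norm (multiplication q (F - h)) \<le> \<gamma> * norm (abs_L2 q)"
      using analytic[OF N]
      unfolding multiplication_powi_mult[OF trig_poly_L_infinity[OF q]] abs_L2_powi_mult[OF trig_poly_L_infinity[OF q]]
        norm_shift .
  qed
  have le: "AE z in circle. cmod (\<phi> z - rep_L2 h z) \<le> \<gamma>"
    using AEle rep_L2_diff[of F h] rep_abs_L2[OF L_infinity_square_integrable[OF \<phi>]]
    unfolding F_def[symmetric] by eventually_elim simp
  obtain K where "AE z in circle. cmod (\<phi> z) \<le> K"
    using \<phi> by (metis L_infinityE)
  then have "AE z in circle. cmod (rep_L2 h z) \<le> K + \<gamma>"
    using le
  proof eventually_elim
    case (elim z)
    then show ?case
      using norm_triangle_ineq4[of "\<phi> z" "\<phi> z - rep_L2 h z"] by simp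
  qed
  then have "rep_L2 h \<in> L_infinity"
    by (rule L_infinityI[OF rep_L2_measurable])
  moreover have "h \<in> hardy_space"
    by (simp add: hardy_iff h_coeff)
  ultimately have "rep_L2 h \<in> H_infinity"
    by (simp add: H_infinity_def abs_rep_L2)
  with le show ?thesis by blast
qed

section \<open>Approximation by trigonometric polynomials in \<open>L\<^sup>\<infinity>\<close>\<close>

lemma abs_L2_monomial: "abs_L2 (\<lambda>z. a * z powi n) = a *\<^sub>C zpow n"
  unfolding zpow_def by (rule abs_L2_scaleC[symmetric, OF square_integrable_powi])

lemma abs_L2_trig_sum:
  assumes "finite I"
  shows "abs_L2 (\<lambda>z. \<Sum>i\<in>I. a i * z powi e i) = (\<Sum>i\<in>I. a i *\<^sub>C zpow (e i))"
  using assms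
proof (induction I rule: finite_induct)
  case empty
  show ?case by (simp add: zero_L2_def)
next
  case (insert i I)
  have "(\<lambda>z. \<Sum>i\<in>I. a i * z powi e i) \<in> square_integrable" "(\<lambda>z. a i * z powi e i) \<in> square_integrable"
    by (intro L_infinity_square_integrable trig_poly_L_infinity trig_poly_sum trig_poly.monom)+
  from abs_L2_add[OF this(2) this(1)] insert show ?case
    by (simp add: abs_L2_monomial)
qed

lemma norm_abs_L2_le:
  assumes "f \<in> L_infinity" "K \<ge> 0" "AE z in circle. cmod (f z) \<le> K"
  shows "norm (abs_L2 f) \<le> K"
  using multiplication_norm_le[OF assms, of "zpow 0"]
  by (simp add: multiplication_zpow[OF assms(1)] norm_shift norm_zpow)

text \<open>The Fejer mean is written as \<open>z \<mapsto> \<langle>f v\<^sub>z, v\<^sub>z\<rangle> / M\<close> with \<open>\<parallel>v\<^sub>z\<parallel>\<^sup>2 = M\<close>, which makes it a contraction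
  for the supremum norm.\<close>

definition fejer :: "nat \<Rightarrow> L2 \<Rightarrow> complex \<Rightarrow> complex" where
  "fejer M f = (\<lambda>z. \<Sum>(j, k)\<in>{..<M} \<times> {..<M}. fcoeff f (int k - int j) / of_nat M * z powi (int k - int j))"

lemma trig_poly_fejer: "trig_poly (fejer M f)"
  unfolding fejer_def case_prod_beta by (intro trig_poly_sum trig_poly.monom)

lemma norm_fejer_le:
  assumes f: "f \<in> L_infinity" and \<delta>: "\<delta> \<ge> 0" "AE z in circle. cmod (f z) \<le> \<delta>"
    and z: "z \<in> sphere 0 1" and "M > 0"
  shows "cmod (fejer M (abs_L2 f) z) \<le> \<delta>"
proof -
  have "z \<noteq> 0" using z by auto
  define v where "v = (\<Sum>k<M. z powi (- int k) *\<^sub>C zpow (int k))"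
  have "(norm v)\<^sup>2 = (\<Sum>k<M. (cmod (z powi (- int k)))\<^sup>2)"
    unfolding v_def by (rule norm_orthonormal_sum[OF orthonormal_zpow_nat]) simp
  also have "\<dots> = real M"
    using z by (simp add: norm_power_int del: power_int_minus)
  finally have nv: "(norm v)\<^sup>2 = real M" .
  interpret m: bounded_linear "multiplication f"
    by (rule bounded_linear_multiplication[OF f])
  have "cinner (multiplication f v) v
      = (\<Sum>j<M. \<Sum>k<M. z powi (- int j) * cnj (z powi (- int k)) * fcoeff (abs_L2 f) (int k - int j))"
    by (simp add: v_def m.sum multiplication_scaleC[OF f] multiplication_zpow[OF f] cinner.sum_left cinner.sum_right
        cinner_scaleC_left cinner_scaleC_right coeff_shift mult.assoc sum_distrib_left mult_ac
        del: complex_cnj_power_int) (rule sum.swap)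
  also have "\<dots> = (\<Sum>j<M. \<Sum>k<M. fcoeff (abs_L2 f) (int k - int j) * z powi (int k - int j))"
  proof (intro sum.cong refl)
    fix j k
    have "z powi (- int j) * cnj (z powi (- int k)) = z powi (int k - int j)"
      unfolding cnj_powi_sphere[OF z] minus_minus
      by (subst power_int_add[symmetric]) (use \<open>z \<noteq> 0\<close> in simp_all)
    then show "z powi (- int j) * cnj (z powi (- int k)) * fcoeff (abs_L2 f) (int k - int j)
        = fcoeff (abs_L2 f) (int k - int j) * z powi (int k - int j)"
      by (simp only: mult.commute)
  qed
  also have "\<dots> = of_nat M * fejer M (abs_L2 f) z"
    using \<open>M > 0\<close> by (simp add: fejer_def sum.cartesian_product sum_distrib_left case_prod_beta)
  finally have "real M * cmod (fejer M (abs_L2 f) z) = cmod (cinner (multiplication f v) v)"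
    by (simp add: norm_mult)
  also have "\<dots> \<le> norm (multiplication f v) * norm v"
    by (rule norm_cinner_le)
  also have "\<dots> \<le> (\<delta> * norm v) * norm v"
    by (intro mult_right_mono multiplication_norm_le f \<delta>) simp
  also have "\<dots> = real M * \<delta>"
    using nv by (simp add: power2_eq_square mult_ac)
  finally show ?thesis
    using \<open>M > 0\<close> by simp
qed

lemma coeff_fejer_neg:
  "fcoeff (abs_L2 (fejer M f)) (- int n) = (real (M - n) / real M) *\<^sub>R fcoeff f (- int n)"
proof -
  \<comment> \<open>The index pairs that contribute to frequency \<open>- n\<close>: there are
    \<open>M - n\<close> of them, and truncated subtraction correctly gives none for
    \<open>n >= M\<close>.\<close>
  define D where "D = {(j, k). (j, k) \<in> {..<M} \<times> {..<M} \<and> int k - int j = - int n}"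
  have "D = (\<lambda>k. (k + n, k)) ` {..<M - n}"
    by (auto simp: D_def image_iff)
  then have "card D = M - n"
    by (simp add: card_image inj_on_def)
  have "abs_L2 (fejer M f)
      = (\<Sum>(j, k)\<in>{..<M} \<times> {..<M}. (fcoeff f (int k - int j) / of_nat M) *\<^sub>C zpow (int k - int j))"
    unfolding fejer_def case_prod_beta by (rule abs_L2_trig_sum) simp
  then have "fcoeff (abs_L2 (fejer M f)) (- int n)
      = (\<Sum>(j, k)\<in>{..<M} \<times> {..<M}. if (j, k) \<in> D then fcoeff f (- int n) / of_nat M else 0)"
    by (simp add: cinner.sum_left case_prod_beta cinner_scaleC_left coeff_zpow D_def)
      (auto intro!: sum.cong)
  also have "\<dots> = (\<Sum>x\<in>{x \<in> {..<M} \<times> {..<M}. x \<in> D}. fcoeff f (- int n) / of_nat M)"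
    unfolding case_prod_beta prod.collapse by (rule sum.inter_filter[symmetric]) simp
  also have "{x \<in> {..<M} \<times> {..<M}. x \<in> D} = D"
    by (auto simp: D_def)
  also have "(\<Sum>x\<in>D. fcoeff f (- int n) / of_nat M) = of_nat (M - n) * (fcoeff f (- int n) / of_nat M)"
    by (simp add: \<open>card D = M - n\<close>)
  also have "\<dots> = (real (M - n) / real M) *\<^sub>R fcoeff f (- int n)"
    by (simp add: scaleR_conv_of_real)
  finally show ?thesis .
qed

text \<open>\<open>p\<close> is a Fejer mean of \<open>f\<close> with its negative coefficients restored to those of \<open>f\<close>.\<close>

lemma trig_poly_congruent_hardy:
  assumes f: "f \<in> L_infinity" and \<delta>: "\<delta> \<ge> 0" "AE z in circle. cmod (f z) \<le> \<delta>"
    and neg: "\<And>n. n < - int N \<Longrightarrow> fcoeff (abs_L2 f) n = 0" and "\<epsilon> > 0"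
  shows "\<exists>p. trig_poly p \<and> (\<forall>z\<in>sphere 0 1. cmod (p z) \<le> \<delta> + \<epsilon>) \<and> abs_L2 f - abs_L2 p \<in> hardy_space"
proof -
  define F where "F = abs_L2 f"
  \<comment> \<open>The correction \<open>r\<close> has \<open>N\<close> terms, each at most
    \<open>N / M * norm F\<close> in modulus; this choice makes their sum at most
    \<open>\<epsilon>\<close>.\<close>
  obtain m :: nat where m: "real m \<ge> real N * real N * norm F / \<epsilon>"
    using real_arch_simple by blast
  define M where "M = m + N + 1"
  have M: "M > 0" "M \<ge> N" "real N * real N * norm F / \<epsilon> \<le> real M"
    using m by (simp_all add: M_def)
  \<comment> \<open>The Fejer mean keeps the fraction \<open>(M - n) / M\<close> of the coefficient
    at \<open>- n\<close>; the missing fraction is \<open>n / M\<close>.\<close>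
  define b where "b n = (real n / real M) *\<^sub>R fcoeff F (- int n)" for n
  define r where "r z = (\<Sum>n\<in>{1..N}. b n * z powi (- int n))" for z
  define p where "p z = fejer M F z + r z" for z
  have r: "trig_poly r"
    unfolding r_def by (intro trig_poly_sum trig_poly.monom)
  have p: "trig_poly p"
    unfolding p_def by (intro trig_poly.add trig_poly_fejer r)
  have "cmod (p z) \<le> \<delta> + \<epsilon>" if z: "z \<in> sphere 0 1" for z
  proof -
    have "cmod (b n * z powi (- int n)) \<le> real N / real M * norm F" if "n \<in> {1..N}" for n
    proof -
      have "cmod (fcoeff F (- int n)) \<le> norm F"
        using norm_cinner_le[of F "zpow (- int n)"] by (simp add: norm_zpow)
      moreover have "real n / real M \<le> real N / real M"
        using that by (intro divide_right_mono) auto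
      moreover have "cmod (z powi (- int n)) = 1"
        using z by (simp add: norm_power_int)
      ultimately show ?thesis
        unfolding norm_mult b_def norm_scaleR by (simp only: mult_1_right) (intro mult_mono; simp)
    qed
    then have "cmod (r z) \<le> real (card {1..N}) * (real N / real M * norm F)"
      unfolding r_def by (rule sum_norm_bound)
    also have "\<dots> = real N * real N * norm F / real M"
      by simp
    also have "\<dots> \<le> \<epsilon>"
      using M \<open>\<epsilon> > 0\<close> by (simp add: field_simps)
    finally have "cmod (r z) \<le> \<epsilon>" .
    moreover have "cmod (fejer M F z) \<le> \<delta>"
      unfolding F_def by (intro norm_fejer_le f \<delta> z M)
    ultimately show ?thesis
      unfolding p_def by (intro order_trans[OF norm_triangle_ineq] add_mono)
  qed
  moreover have "F - abs_L2 p \<in> hardy_space"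
    unfolding hardy_iff
  proof (intro allI impI)
    fix k :: int assume "k < 0"
    define n where "n = nat (- k)"
    have k: "k = - int n" "n > 0" using \<open>k < 0\<close> by (simp_all add: n_def)
    have "abs_L2 p = abs_L2 (fejer M F) + abs_L2 r"
      unfolding p_def
      by (intro abs_L2_add[symmetric] L_infinity_square_integrable trig_poly_L_infinity trig_poly_fejer r)
    moreover have "abs_L2 r = (\<Sum>n\<in>{1..N}. b n *\<^sub>C zpow (- int n))"
      unfolding r_def by (rule abs_L2_trig_sum) simp
    moreover have "fcoeff (\<Sum>n\<in>{1..N}. b n *\<^sub>C zpow (- int n)) k = (if n \<le> N then b n else 0)"
    proof -
      have "fcoeff (\<Sum>n\<in>{1..N}. b n *\<^sub>C zpow (- int n)) k = (\<Sum>i\<in>{1..N}. if i = n then b n else 0)"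
        unfolding cinner.sum_left
        by (intro sum.cong refl) (auto simp: cinner_scaleC_left coeff_zpow k)
      then show ?thesis using k by simp
    qed
    moreover have "fcoeff F k = 0" if "\<not> n \<le> N"
      unfolding F_def using neg k that by simp
    moreover have "real (M - n) / real M + real n / real M = 1" if "n \<le> N"
      using M that by (simp flip: add_divide_distrib)
    ultimately show "fcoeff (F - abs_L2 p) k = 0"
      using coeff_fejer_neg[of M F n]
      by (auto simp: cinner.diff_left cinner_add_left b_def k simp flip: scaleR_left_distrib)
  qed
  ultimately show ?thesis
    using p unfolding F_def by blast
qed

text \<open>The symbols \<open>G k\<close> converge uniformly to \<open>\<phi>\<close> and have
  finitely many negative frequencies. Their increments are replaced, modulo \<open>H^2\<close>, by
  trigonometric polynomials that are still summable in supremum norm, and the sum of these is the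
  continuous summand.\<close>

lemma H_infinity_plus_C_if_hankel_vanishing:
  assumes \<phi>: "\<phi> \<in> L_infinity" and van: "hankel_vanishing \<phi>"
  shows "\<phi> \<in> H_infinity_plus_C"
proof -
  define d where "d k = (1/2 :: real) ^ k" for k
  have d: "d k > 0" "d (Suc k) \<le> d k" for k
    by (simp_all add: d_def)
  have "\<exists>N h. h \<in> H_infinity \<and> (AE z in circle. cmod (z powi int N * \<phi> z - h z) \<le> d k)" for k
  proof -
    obtain N where N: "\<And>u. u \<in> hardy_space \<Longrightarrow> norm (hankel \<phi> (shift (int N) u)) \<le> d k * norm u"
      using van d(1)[of k] unfolding hankel_vanishing_def by blast
    have "\<exists>h\<in>H_infinity. AE z in circle. cmod (z powi int N * \<phi> z - h z) \<le> d k"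
      using N d(1)[of k] by (intro nehari powi_mult_L_infinity \<phi>) (simp_all only: hankel_powi_mult[OF \<phi>] less_imp_le)
    then show ?thesis by blast
  qed
  then obtain N h where h: "\<And>k. h k \<in> H_infinity"
    and close: "\<And>k. AE z in circle. cmod (z powi int (N k) * \<phi> z - h k z) \<le> d k"
    by metis
  have hL: "h k \<in> L_infinity" and hH: "abs_L2 (h k) \<in> hardy_space" for k
    using h[of k] by (simp_all add: H_infinity_def)
  define G where "G k z = z powi (- int (N k)) * h k z" for k z
  have GL: "G k \<in> L_infinity" for k
    unfolding G_def by (rule powi_mult_L_infinity[OF hL])
  have G_coeff: "fcoeff (abs_L2 (G k)) n = 0" if "n < - int (N k)" for k n
    unfolding G_def abs_L2_powi_mult[OF hL] coeff_shift using hardyD[OF hH] that by simp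
  have G_close: "AE z in circle. cmod (\<phi> z - G k z) \<le> d k" for k
    using close[of k] AE_space
  proof eventually_elim
    case (elim z)
    then have z: "cmod z = 1" "z \<noteq> 0" by (auto simp: space_circle)
    have inv: "z powi (- int (N k)) * z powi int (N k) = 1"
      by (subst power_int_add[symmetric]) (use z in simp_all)
    have "\<phi> z - G k z = (z powi (- int (N k)) * z powi int (N k)) * \<phi> z - G k z"
      by (simp only: inv mult_1)
    also have "\<dots> = z powi (- int (N k)) * (z powi int (N k) * \<phi> z - h k z)"
      by (simp only: G_def right_diff_distrib mult.assoc)
    also have "cmod \<dots> = cmod (z powi int (N k) * \<phi> z - h k z)"
      using z(1) by (simp only: norm_mult norm_power_int power_int_1_left mult_1)
    finally show ?case using elim by simp
  qed
  \<comment> \<open>Almost everywhere bounded by \<open>d k + d (Suc k)\<close>, hence by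
    \<open>2 * d k\<close>; the replacement by \<open>p k\<close> costs another
    \<open>d k\<close>.\<close>
  define D where "D k z = G (Suc k) z - G k z" for k z
  have DL: "D k \<in> L_infinity" for k
    unfolding D_def by (intro L_infinity_diff GL)
  have D_abs: "abs_L2 (D k) = abs_L2 (G (Suc k)) - abs_L2 (G k)" for k
    unfolding D_def by (intro abs_L2_diff[symmetric] L_infinity_square_integrable GL)
  have D_le: "AE z in circle. cmod (D k z) \<le> 2 * d k" for k
    using G_close[of k] G_close[of "Suc k"]
  proof eventually_elim
    case (elim z)
    have "cmod (D k z) \<le> cmod (\<phi> z - G k z) + cmod (\<phi> z - G (Suc k) z)"
      using norm_triangle_ineq4[of "\<phi> z - G k z" "\<phi> z - G (Suc k) z"] by (simp add: D_def)
    then show ?case using elim d(2)[of k] by linarith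
  qed
  have "\<exists>p. trig_poly p \<and> (\<forall>z\<in>sphere 0 1. cmod (p z) \<le> 2 * d k + d k) \<and> abs_L2 (D k) - abs_L2 p \<in> hardy_space" for k
  proof (rule trig_poly_congruent_hardy[OF DL _ D_le _ d(1)])
    show "fcoeff (abs_L2 (D k)) n = 0" if "n < - int (max (N k) (N (Suc k)))" for n
      using that by (simp add: D_abs cinner.diff_left G_coeff)
  qed (simp add: d_def)
  then obtain p where p: "\<And>k. trig_poly (p k)" "\<And>k z. z \<in> sphere 0 1 \<Longrightarrow> cmod (p k z) \<le> 2 * d k + d k"
    "\<And>k. abs_L2 (D k) - abs_L2 (p k) \<in> hardy_space"
    by metis
  obtain K where K: "K \<ge> 0" "AE z in circle. cmod (G 0 z) \<le> K"
    using GL by (rule L_infinityE)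
  have "\<exists>q. trig_poly q \<and> (\<forall>z\<in>sphere 0 1. cmod (q z) \<le> K + 1) \<and> abs_L2 (G 0) - abs_L2 q \<in> hardy_space"
    by (rule trig_poly_congruent_hardy[OF GL K, of "N 0"]) (simp_all add: G_coeff)
  then obtain q where q: "trig_poly q" "abs_L2 (G 0) - abs_L2 q \<in> hardy_space"
    by blast
  define s where "s n z = q z + (\<Sum>k<n. p k z)" for n z
  have s: "trig_poly (s n)" for n
    unfolding s_def by (intro trig_poly.add q trig_poly_sum p)
  define c where "c z = q z + (\<Sum>k. p k z)" for z
  have unif: "uniform_limit (sphere 0 1) s c sequentially"
    unfolding s_def[abs_def] c_def[abs_def]
  proof (intro uniform_limit_add uniform_limit_const Weierstrass_m_test)
    show "norm (p k z) \<le> 3 * d k" if "z \<in> sphere 0 1" for k z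
      using p(2)[OF that, of k] by simp
    show "summable (\<lambda>k. 3 * d k)"
      unfolding d_def by (intro summable_mult summable_geometric) simp
  qed
  have c: "continuous_on (sphere 0 1) c"
    by (rule uniform_limit_theorem[OF _ unif]) (auto intro!: always_eventually trig_poly_continuous_on s)
  then have cL: "c \<in> L_infinity"
    by (rule continuous_L_infinity)
  have Gs: "abs_L2 (G n) - abs_L2 (s n) \<in> hardy_space" for n
  proof (induction n)
    case 0
    show ?case using q(2) by (simp add: s_def)
  next
    case (Suc n)
    have "abs_L2 (s (Suc n)) = abs_L2 (\<lambda>z. s n z + p n z)"
      by (simp add: s_def[abs_def] add.assoc)
    also have "\<dots> = abs_L2 (s n) + abs_L2 (p n)"
      by (intro abs_L2_add[symmetric] L_infinity_square_integrable trig_poly_L_infinity s p)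
    finally have "abs_L2 (G (Suc n)) - abs_L2 (s (Suc n))
        = (abs_L2 (G n) - abs_L2 (s n)) + (abs_L2 (D n) - abs_L2 (p n))"
      by (simp add: D_abs)
    then show ?case
      using Suc p(3)[of n] by (simp only: hardy_add)
  qed
  have G_lim: "(\<lambda>n. abs_L2 (G n)) \<longlonglongrightarrow> abs_L2 \<phi>"
  proof (rule metric_LIMSEQ_I)
    fix e :: real assume "e > 0"
    then obtain n0 where n0: "d n0 < e"
      using real_arch_pow_inv[of e "1/2"] unfolding d_def by auto
    have "dist (abs_L2 (G n)) (abs_L2 \<phi>) < e" if "n \<ge> n0" for n
    proof -
      have "AE z in circle. cmod (G n z - \<phi> z) \<le> d n"
        using G_close[of n] by eventually_elim (simp add: norm_minus_commute)
      then have "norm (abs_L2 (\<lambda>z. G n z - \<phi> z)) \<le> d n"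
        using d(1)[of n] by (intro norm_abs_L2_le L_infinity_diff \<phi> GL) simp_all
      then have "dist (abs_L2 (G n)) (abs_L2 \<phi>) \<le> d n"
        by (simp add: dist_norm abs_L2_diff L_infinity_square_integrable \<phi> GL)
      also have "d n \<le> d n0"
        unfolding d_def using that by (intro power_decreasing) auto
      finally show ?thesis using n0 by simp
    qed
    then show "\<exists>n0. \<forall>n\<ge>n0. dist (abs_L2 (G n)) (abs_L2 \<phi>) < e" by blast
  qed
  have s_lim: "(\<lambda>n. abs_L2 (s n)) \<longlonglongrightarrow> abs_L2 c"
  proof (rule metric_LIMSEQ_I)
    fix e :: real assume "e > 0"
    then have "\<forall>\<^sub>F n in sequentially. \<forall>z\<in>sphere 0 1. dist (s n z) (c z) < e / 2"
      by (intro uniform_limitD[OF unif]) simp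
    then obtain n0 where n0: "\<And>n z. n \<ge> n0 \<Longrightarrow> z \<in> sphere 0 1 \<Longrightarrow> dist (s n z) (c z) < e / 2"
      unfolding eventually_sequentially by blast
    have "dist (abs_L2 (s n)) (abs_L2 c) < e" if "n \<ge> n0" for n
    proof -
      have "norm (abs_L2 (\<lambda>z. s n z - c z)) \<le> e / 2"
        using \<open>e > 0\<close> n0[OF that]
        by (intro norm_abs_L2_le L_infinity_diff cL trig_poly_L_infinity s AE_circleI) (auto simp: dist_norm less_imp_le)
      then have "dist (abs_L2 (s n)) (abs_L2 c) \<le> e / 2"
        by (simp add: dist_norm abs_L2_diff L_infinity_square_integrable trig_poly_L_infinity s cL)
      then show ?thesis using \<open>e > 0\<close> by simp
    qed
    then show "\<exists>n0. \<forall>n\<ge>n0. dist (abs_L2 (s n)) (abs_L2 c) < e" by blast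
  qed
  \<comment> \<open>\<open>L^2\<close> convergence suffices here: \<open>H^2\<close> is closed, and
    boundedness of \<open>\<phi> - c\<close> comes from its two terms.\<close>
  have "abs_L2 \<phi> - abs_L2 c \<in> hardy_space"
    using tendsto_diff[OF G_lim s_lim] by (rule closed_sequentially[OF hardy_space_closed Gs])
  then have "(\<lambda>z. \<phi> z - c z) \<in> H_infinity"
    by (simp add: H_infinity_def L_infinity_diff \<phi> cL abs_L2_diff L_infinity_square_integrable)
  then show ?thesis
    unfolding H_infinity_plus_C_def using \<phi> c
    by (intro CollectI conjI bexI[of _ "\<lambda>z. \<phi> z - c z"] exI[of _ c]) auto
qed

section \<open>Absolutely minimum attaining Toeplitz operators\<close>

lemma Abs_H2_zpow: "Rep_H2 (Abs_H2 (zpow (int n))) = zpow (int n)"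
  by (rule Abs_H2_inverse[OF zpow_hardy]) simp

lemma orthonormal_H2: "orthonormal (\<lambda>n. Abs_H2 (zpow (int n)))"
  by (simp add: orthonormal_def cinner_H2.rep_eq Abs_H2_zpow coeff_zpow)

text \<open>An element of \<open>H^2\<close> orthogonal to the first \<open>N\<close> monomials is
  divisible by the \<open>N\<close>-th power of \<open>z\<close> within \<open>H^2\<close>, so the
  shift form of the condition becomes a tail estimate for an orthonormal sequence.\<close>

lemma hankel_H2_tail:
  assumes "hankel_vanishing \<phi>" "\<epsilon> > 0"
  shows "\<exists>N. \<forall>x. (\<forall>j<N. cinner x (Abs_H2 (zpow (int j))) = 0) \<longrightarrow> norm (hankel \<phi> (Rep_H2 x)) \<le> \<epsilon> * norm x"
proof -
  obtain N where N: "\<And>u. u \<in> hardy_space \<Longrightarrow> norm (hankel \<phi> (shift (int N) u)) \<le> \<epsilon> * norm u"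
    using assms unfolding hankel_vanishing_def by blast
  have "norm (hankel \<phi> (Rep_H2 x)) \<le> \<epsilon> * norm x" if x: "\<forall>j<N. cinner x (Abs_H2 (zpow (int j))) = 0" for x
  proof -
    have c: "fcoeff (Rep_H2 x) (int j) = 0" if "j < N" for j
      using x that by (simp add: cinner_H2.rep_eq Abs_H2_zpow)
    have "shift (- int N) (Rep_H2 x) \<in> hardy_space"
      unfolding hardy_iff
    proof (intro allI impI)
      fix n :: int assume "n < 0"
      show "fcoeff (shift (- int N) (Rep_H2 x)) n = 0"
      proof (cases "n + int N < 0")
        case True
        then show ?thesis using hardyD[OF Rep_H2] by (simp add: coeff_shift)
      next
        case False
        then show ?thesis using c[of "nat (n + int N)"] \<open>n < 0\<close> by (simp add: coeff_shift)
      qed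
    qed
    from N[OF this] show ?thesis
      by (simp add: shift_shift shift_0 norm_shift norm_H2.rep_eq)
  qed
  then show ?thesis by blast
qed

lemma toeplitz_AM_if:
  assumes \<phi>: "\<phi> \<in> L_infinity" and a: "AE z in circle. cmod (\<phi> z) = a" and van: "hankel_vanishing \<phi>"
  shows "toeplitz \<phi> \<in> AM_operators"
    and "complex_of_real a \<in> essential_spectrum (abs_operator (toeplitz \<phi>))"
proof -
  define L where "L x = hankel \<phi> (Rep_H2 x)" for x
  have L: "bounded_clinear L"
    unfolding L_def by (intro bounded_clinear_compose[OF bounded_clinear_hankel[OF \<phi>]] bounded_clinear_Rep_H2)
  have T: "bounded_clinear (toeplitz \<phi>)"
    by (rule bounded_clinear_toeplitz[OF \<phi>])
  have defect: "(norm (toeplitz \<phi> x))\<^sup>2 = a\<^sup>2 * (norm x)\<^sup>2 - (norm (L x))\<^sup>2" for x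
    by (simp add: norm_toeplitz_square multiplication_norm_eq[OF \<phi> a] L_def norm_H2.rep_eq[of x])
  note tail = hankel_H2_tail[OF van, folded L_def]
  have "compact (closure (L ` cball 0 1))"
    by (rule compact_closure_image_if_tail_small[OF orthonormal_H2 L tail])
  then show "toeplitz \<phi> \<in> AM_operators"
    by (rule AM_operators_if_compact_defect[OF T bounded_clinear_imp_bounded_linear[OF L] _ defect])
  have "a \<ge> 0"
  proof -
    have "\<exists>z. cmod (\<phi> z) = a"
      using eventually_happens[OF a] circle.not_empty by (simp add: trivial_limit_def AE_iff_null) 
    then show ?thesis by force
  qed
  define R where "R x = abs_operator (toeplitz \<phi>) x - complex_of_real a *\<^sub>C x" for x
  have S: "bounded_clinear (toeplitz (\<lambda>z. cnj (\<phi> z)))"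
    by (rule bounded_clinear_toeplitz[OF L_infinity_cnj[OF \<phi>]])
  have pos: "positive_operator (abs_operator (toeplitz \<phi>))"
    by (rule positive_abs_operator[OF T S toeplitz_adjoint[OF \<phi>]])
  have RL: "norm (R x) \<le> norm (L x)" for x
    using norm_abs_operator_diff_le[OF T S toeplitz_adjoint[OF \<phi>] \<open>a \<ge> 0\<close> defect, of x]
    by (simp add: R_def scaleR_scaleC)
  have R: "bounded_clinear R"
  proof -
    have A: "bounded_clinear (abs_operator (toeplitz \<phi>))"
      using pos by (simp add: positive_operator_def)
    obtain K where K: "\<And>x. norm (L x) \<le> norm x * K"
      using bounded_linear.bounded[OF bounded_clinear_imp_bounded_linear[OF L]] by blast
    show ?thesis
      by (rule bounded_clinearI[where K = K])
        (use order_trans[OF RL K] in \<open>auto simp: R_def bounded_clinear_add[OF A] bounded_clinear_scaleC[OF A]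
          scaleC_add_right scaleC.diff_right scaleC_scaleC mult.commute\<close>)
  qed
  have "\<exists>N. \<forall>x. (\<forall>j<N. cinner x (Abs_H2 (zpow (int j))) = 0) \<longrightarrow> norm (R x) \<le> \<epsilon> * norm x" if "\<epsilon> > 0" for \<epsilon>
    using tail[OF that] order_trans[OF RL] by blast
  then have "\<not> fredholm R"
    by (intro not_fredholm_if_compact[OF orthonormal_H2 R] compact_closure_image_if_tail_small[OF orthonormal_H2 R])
  then show "complex_of_real a \<in> essential_spectrum (abs_operator (toeplitz \<phi>))"
    by (simp add: essential_spectrum_def R_def[abs_def])
qed

section \<open>Necessity: test vectors moved to high frequencies\<close>

lemma Rep_Abs_shift:
  "u \<in> hardy_space \<Longrightarrow> Rep_H2 (Abs_H2 (shift (int n) u)) = shift (int n) u"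
  by (rule Abs_H2_inverse[OF shift_hardy]) simp_all

text \<open>The inner product with \<open>w\<close> is at most the norm of the analytic part of the
  backward shift of \<open>w\<close>, uniformly in the unit vectors \<open>g n\<close>. They may
  therefore vary with \<open>n\<close>, as failure of \<open>hankel_vanishing\<close>
  requires.\<close>

lemma weakly_null_shift:
  assumes g: "\<And>n. g n \<in> hardy_space" "\<And>n. norm (g n) = 1"
  shows "weakly_null (\<lambda>n. Abs_H2 (shift (int n) (g n)))"
  unfolding weakly_null_def
proof
  fix w
  have le: "cmod (cinner (Abs_H2 (shift (int n) (g n))) w) \<le> norm (hardy_proj (shift (- int n) (Rep_H2 w)))" for n
  proof -
    have "cinner (Abs_H2 (shift (int n) (g n))) w = cinner (g n) (shift (- int n) (Rep_H2 w))"
      by (simp add: cinner_H2.rep_eq Rep_Abs_shift g cinner_shift)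
    also have "\<dots> = cnj (cinner (hardy_proj (shift (- int n) (Rep_H2 w))) (g n))"
      unfolding cinner_hardy_proj[OF g(1)] by (rule cinner_commute)
    finally show ?thesis
      using norm_cinner_le[of "hardy_proj (shift (- int n) (Rep_H2 w))" "g n"] by (simp add: g)
  qed
  show "(\<lambda>n. cinner (Abs_H2 (shift (int n) (g n))) w) \<longlonglongrightarrow> 0"
    by (rule Lim_null_comparison[OF always_eventually[OF allI[OF le]]
          tendsto_norm_zero[OF hardy_proj_shift_tendsto_0]])
qed

lemma norm_toeplitz_shift_tendsto:
  assumes \<phi>: "\<phi> \<in> L_infinity" and g: "g \<in> hardy_space"
  shows "(\<lambda>n. (norm (toeplitz \<phi> (Abs_H2 (shift (int n) g))))\<^sup>2) \<longlonglongrightarrow> (norm (multiplication \<phi> g))\<^sup>2"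
proof -
  have eq: "(norm (toeplitz \<phi> (Abs_H2 (shift (int n) g))))\<^sup>2
      = (norm (multiplication \<phi> g))\<^sup>2 - (norm (cohardy_proj (shift (int n) (multiplication \<phi> g))))\<^sup>2" for n
    unfolding norm_toeplitz_square Rep_Abs_shift[OF g] hankel_def multiplication_shift[OF \<phi>] norm_shift ..
  have "(\<lambda>n. (norm (multiplication \<phi> g))\<^sup>2 - (norm (cohardy_proj (shift (int n) (multiplication \<phi> g))))\<^sup>2)
      \<longlonglongrightarrow> (norm (multiplication \<phi> g))\<^sup>2 - (norm (0::L2))\<^sup>2"
    by (intro tendsto_intros cohardy_proj_shift_tendsto_0)
  then show ?thesis by (simp add: eq)
qed

lemma norm_Abs_shift:
  "u \<in> hardy_space \<Longrightarrow> norm (Abs_H2 (shift (int n) u)) = norm u"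
  by (simp add: norm_H2.rep_eq Rep_Abs_shift norm_shift)

text \<open>Shifts of \<open>g\<close> and of \<open>g'\<close> are weakly null, and the values
  along them tend to the two squared multiplication norms, which cannot differ. Exchanging
  \<open>g\<close> and \<open>g'\<close> gives equality.\<close>

lemma toeplitz_AM_norm_multiplication_eq:
  assumes \<phi>: "\<phi> \<in> L_infinity" and AM: "toeplitz \<phi> \<in> AM_operators"
    and g: "g \<in> hardy_space" "norm g = 1" and g': "g' \<in> hardy_space" "norm g' = 1"
  shows "norm (multiplication \<phi> g) \<le> norm (multiplication \<phi> g')"
proof (rule ccontr)
  define A where "A = (norm (multiplication \<phi> g'))\<^sup>2"
  define B where "B = (norm (multiplication \<phi> g))\<^sup>2"
  assume "\<not> ?thesis"
  then have "A < B"
    unfolding A_def B_def by (intro power_strict_mono) auto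
  \<comment> \<open>Levels strictly inside the interval, since the limits \<open>A\<close> and
    \<open>B\<close> give only eventual inequalities on either side of them.\<close>
  define a b where "a = (2 * A + B) / 3" and "b = (A + 2 * B) / 3"
  have ab: "A < a" "a < b" "b < B"
    using \<open>A < B\<close> by (simp_all add: a_def b_def)
  show False
  proof (rule AM_operators_no_gap[OF AM toeplitz_adjoint[OF \<phi>] _ _ _ _ _ _ \<open>a < b\<close>])
    show "weakly_null (\<lambda>n. Abs_H2 (shift (int n) g'))" "weakly_null (\<lambda>n. Abs_H2 (shift (int n) g))"
      by (intro weakly_null_shift g g')+
    show "norm (Abs_H2 (shift (int n) g')) = 1" "norm (Abs_H2 (shift (int n) g)) = 1" for n
      by (simp_all add: norm_Abs_shift g g')
    have "\<forall>\<^sub>F n in sequentially. (norm (toeplitz \<phi> (Abs_H2 (shift (int n) g'))))\<^sup>2 < a"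
      using norm_toeplitz_shift_tendsto[OF \<phi> g'(1)] ab(1) unfolding A_def by (rule order_tendstoD)
    then show "\<forall>\<^sub>F n in sequentially. (norm (toeplitz \<phi> (Abs_H2 (shift (int n) g'))))\<^sup>2 \<le> a"
      by eventually_elim simp
    have "\<forall>\<^sub>F n in sequentially. b < (norm (toeplitz \<phi> (Abs_H2 (shift (int n) g))))\<^sup>2"
      using norm_toeplitz_shift_tendsto[OF \<phi> g(1)] ab(3) unfolding B_def by (rule order_tendstoD)
    then show "\<forall>\<^sub>F n in sequentially. b \<le> (norm (toeplitz \<phi> (Abs_H2 (shift (int n) g))))\<^sup>2"
      by eventually_elim simp
  qed
qed

text \<open>Multiplication by \<open>\<phi>\<close> scales all norms in \<open>H^2\<close> by one
  factor \<open>\<beta>\<close>. A shift extends this to trigonometric polynomials \<open>p\<close>,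
  so both signs of the weight \<open>\<beta>^2 - |\<phi>|^2\<close> have nonnegative integral
  against \<open>|p|^2\<close>.\<close>

lemma toeplitz_AM_const_modulus:
  assumes \<phi>: "\<phi> \<in> L_infinity" and AM: "toeplitz \<phi> \<in> AM_operators"
  shows "\<exists>a. AE z in circle. cmod (\<phi> z) = a"
proof -
  define \<beta> where "\<beta> = norm (multiplication \<phi> (zpow 0))"
  have unit: "norm (multiplication \<phi> g) = \<beta>" if "g \<in> hardy_space" "norm g = 1" for g
    unfolding \<beta>_def using that zpow_hardy[of 0] norm_zpow[of 0]
    by (intro antisym toeplitz_AM_norm_multiplication_eq[OF \<phi> AM]) auto
  have hardy: "norm (multiplication \<phi> g) = \<beta> * norm g" if g: "g \<in> hardy_space" for g
  proof (cases "g = 0")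
    case True
    then show ?thesis
      using multiplication_scaleC[OF \<phi>, of 0 0] by (simp add: scaleC.zero_left)
  next
    case False
    define g' where "g' = complex_of_real (1 / norm g) *\<^sub>C g"
    have g': "g' \<in> hardy_space" "norm g' = 1"
      unfolding g'_def using g False by (simp_all add: hardy_scale norm_scaleC norm_divide)
    have "norm (multiplication \<phi> g') = (1 / norm g) * norm (multiplication \<phi> g)"
      unfolding g'_def multiplication_scaleC[OF \<phi>] norm_scaleC by (simp add: norm_divide)
    then show ?thesis
      using unit[OF g'] False by (simp add: field_simps)
  qed
  define f where "f = abs_L2 \<phi>"
  have eq: "norm (multiplication p f) = \<beta> * norm (abs_L2 p)" if p: "trig_poly p" for p
  proof -
    have pL: "p \<in> L_infinity" by (rule trig_poly_L_infinity[OF p])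
    obtain n where n: "(\<lambda>z. z powi int n * p z) \<in> H_infinity"
      using trig_poly_eventually_analytic[OF p] by blast
    then have "shift (int n) (abs_L2 p) \<in> hardy_space"
      by (simp only: H_infinity_def mem_Collect_eq abs_L2_powi_mult[OF pL])
    from hardy[OF this] show ?thesis
      by (simp add: f_def multiplication_abs_L2_commute[OF pL \<phi>] multiplication_shift[OF \<phi>] norm_shift)
  qed
  have "AE z in circle. cmod (rep_L2 f z) \<le> \<beta>"
    by (rule AE_norm_le_if_multiplication_le) (simp_all add: eq \<beta>_def)
  moreover have "AE z in circle. 0 \<le> - (\<beta>\<^sup>2 - (cmod (rep_L2 f z))\<^sup>2)"
  proof (rule AE_nonneg_if_trig_poly)
    show "0 \<le> (\<integral>z. - (\<beta>\<^sup>2 - (cmod (rep_L2 f z))\<^sup>2) * (cmod (p z))\<^sup>2 \<partial>circle)" if "trig_poly p" for p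
      unfolding mult_minus_left Bochner_Integration.integral_minus integral_weight[OF trig_poly_L_infinity[OF that]]
      by (simp add: eq[OF that] power_mult_distrib)
  qed (rule Bochner_Integration.integrable_minus[OF integrable_weight])
  ultimately have "AE z in circle. cmod (\<phi> z) = \<beta>"
    using rep_abs_L2[OF L_infinity_square_integrable[OF \<phi>]]
  proof eventually_elim
    case (elim z)
    then have "\<beta>\<^sup>2 \<le> (cmod (rep_L2 f z))\<^sup>2" by simp
    then have "\<beta> \<le> cmod (rep_L2 f z)"
      by (rule power2_le_imp_le) simp
    with elim show ?case by (simp add: f_def)
  qed
  then show ?thesis by blast
qed

text \<open>If the tails do not vanish, some unit vectors at ever higher frequencies have Hankel
  norm above \<open>e\<close>, which keeps the values at or below \<open>a^2 - e^2\<close>. Along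
  the plain monomials the values tend to \<open>a^2\<close>, a different level.\<close>

lemma toeplitz_AM_hankel_vanishing:
  assumes \<phi>: "\<phi> \<in> L_infinity" and AM: "toeplitz \<phi> \<in> AM_operators"
    and a: "AE z in circle. cmod (\<phi> z) = a"
  shows "hankel_vanishing \<phi>"
proof (rule ccontr)
  assume "\<not> hankel_vanishing \<phi>"
  then obtain e where e: "e > 0"
    and "\<And>n. \<exists>u\<in>hardy_space. e * norm u < norm (hankel \<phi> (shift (int n) u))"
    unfolding hankel_vanishing_def by (meson not_le)
  then obtain u where u: "\<And>n. u n \<in> hardy_space" "\<And>n. e * norm (u n) < norm (hankel \<phi> (shift (int n) (u n)))"
    by metis
  have u0: "u n \<noteq> 0" for n
  proof
    assume "u n = 0"
    then have "hankel \<phi> (shift (int n) (u n)) = 0"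
      using linear_0[OF bounded_linear.linear[OF bounded_clinear_imp_bounded_linear[OF
          bounded_clinear_compose[OF bounded_clinear_hankel[OF \<phi>] bounded_clinear_shift[of "int n"]]]]]
      by simp
    with u(2)[of n] \<open>u n = 0\<close> show False by simp
  qed
  define v where "v n = complex_of_real (1 / norm (u n)) *\<^sub>C u n" for n
  have v: "v n \<in> hardy_space" "norm (v n) = 1" for n
    using u0[of n] u(1)[of n] by (simp_all add: v_def hardy_scale norm_scaleC norm_divide)
  have hv: "e < norm (hankel \<phi> (shift (int n) (v n)))" for n
  proof -
    have "norm (hankel \<phi> (shift (int n) (v n))) = norm (hankel \<phi> (shift (int n) (u n))) / norm (u n)"
      by (simp add: v_def shift_scaleC bounded_clinear_scaleC[OF bounded_clinear_hankel[OF \<phi>]] norm_scaleC norm_divide)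
    then show ?thesis
      using u(2)[of n] u0[of n] by (simp add: pos_less_divide_eq)
  qed
  have Tv: "(norm (toeplitz \<phi> (Abs_H2 (shift (int n) (v n)))))\<^sup>2 \<le> a\<^sup>2 - e\<^sup>2" for n
  proof -
    have "e\<^sup>2 \<le> (norm (hankel \<phi> (shift (int n) (v n))))\<^sup>2"
      using e hv[of n] by (intro power_mono) auto
    then show ?thesis
      by (simp add: norm_toeplitz_square Rep_Abs_shift v multiplication_norm_eq[OF \<phi> a] norm_shift)
  qed
  \<comment> \<open>The upper level is halved to \<open>a^2 - e^2 / 2\<close>, since
    \<open>a^2\<close> is only reached in the limit.\<close>
  have gap: "a\<^sup>2 - e\<^sup>2 < a\<^sup>2 - e\<^sup>2 / 2"
    using e by simp
  show False
  proof (rule AM_operators_no_gap[OF AM toeplitz_adjoint[OF \<phi>] _ _ _ _ _ _ gap])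
    show "weakly_null (\<lambda>n. Abs_H2 (shift (int n) (v n)))" "weakly_null (\<lambda>n. Abs_H2 (shift (int n) (zpow 0)))"
      by (intro weakly_null_shift v zpow_hardy norm_zpow order_refl)+
    show "norm (Abs_H2 (shift (int n) (v n))) = 1" "norm (Abs_H2 (shift (int n) (zpow 0))) = 1" for n
      by (simp_all add: norm_Abs_shift v zpow_hardy norm_zpow)
    show "\<forall>\<^sub>F n in sequentially. (norm (toeplitz \<phi> (Abs_H2 (shift (int n) (v n)))))\<^sup>2 \<le> a\<^sup>2 - e\<^sup>2"
      using Tv by (intro always_eventually allI)
    have "(\<lambda>n. (norm (toeplitz \<phi> (Abs_H2 (shift (int n) (zpow 0)))))\<^sup>2) \<longlonglongrightarrow> a\<^sup>2"
      using norm_toeplitz_shift_tendsto[OF \<phi> zpow_hardy[of 0]]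
      by (simp add: multiplication_norm_eq[OF \<phi> a] norm_zpow)
    moreover have "a\<^sup>2 - e\<^sup>2 / 2 < a\<^sup>2"
      using e by simp
    ultimately have "\<forall>\<^sub>F n in sequentially. a\<^sup>2 - e\<^sup>2 / 2 < (norm (toeplitz \<phi> (Abs_H2 (shift (int n) (zpow 0)))))\<^sup>2"
      by (rule order_tendstoD)
    then show "\<forall>\<^sub>F n in sequentially. a\<^sup>2 - e\<^sup>2 / 2 \<le> (norm (toeplitz \<phi> (Abs_H2 (shift (int n) (zpow 0)))))\<^sup>2"
      by eventually_elim simp
  qed
qed

theorem theorem2p7:
  fixes \<phi> :: "complex \<Rightarrow> complex"
  assumes "\<phi> \<in> L_infinity"
  shows "toeplitz \<phi> \<in> AM_operators \<longleftrightarrow>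
    (\<exists>\<alpha>\<in>essential_spectrum (abs_operator (toeplitz \<phi>)).
       AE z in circle. complex_of_real (cmod (\<phi> z)) = \<alpha>) \<and>
    \<phi> \<in> H_infinity_plus_C"
proof
  assume AM: "toeplitz \<phi> \<in> AM_operators"
  obtain a where a: "AE z in circle. cmod (\<phi> z) = a"
    using toeplitz_AM_const_modulus[OF assms AM] by blast
  have van: "hankel_vanishing \<phi>"
    by (rule toeplitz_AM_hankel_vanishing[OF assms AM a])
  have "AE z in circle. complex_of_real (cmod (\<phi> z)) = of_real a"
    using a by eventually_elim simp
  then show "(\<exists>\<alpha>\<in>essential_spectrum (abs_operator (toeplitz \<phi>)).
       AE z in circle. complex_of_real (cmod (\<phi> z)) = \<alpha>) \<and> \<phi> \<in> H_infinity_plus_C"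
    using toeplitz_AM_if(2)[OF assms a van] H_infinity_plus_C_if_hankel_vanishing[OF assms van] by blast
next
  assume "(\<exists>\<alpha>\<in>essential_spectrum (abs_operator (toeplitz \<phi>)).
       AE z in circle. complex_of_real (cmod (\<phi> z)) = \<alpha>) \<and> \<phi> \<in> H_infinity_plus_C"
  then obtain \<alpha> where \<alpha>: "AE z in circle. complex_of_real (cmod (\<phi> z)) = \<alpha>"
    and HC: "\<phi> \<in> H_infinity_plus_C" by blast
  have "AE z in circle. cmod (\<phi> z) = Re \<alpha>"
    using \<alpha> by eventually_elim auto
  then show "toeplitz \<phi> \<in> AM_operators"
    by (rule toeplitz_AM_if(1)[OF assms _ hankel_vanishing_if_H_infinity_plus_C[OF HC]])
qed

end
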